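(* For all but $o_{n\to\infty}(n!)$ of the permutations $\sigma\in S_n$ we have \[\Delta(\sigma)\ge(\log n)^{\zeta-o(1)},\] where $\zeta=\limsup_{k\to\infty}\frac{\log k}{\log(1/\beta_k)}$ and $o(1)\to0$ as $n\to\infty$.
   Context: For a permutation $\sigma\in S_n$, a divisor $d$ of $\sigma$ is a product of a subset of the cycles of $\sigma$ (distinct subsets give distinct divisors), and $\mathrm{length}(d)$ is the total length of those cycles. Define $\Delta(\sigma):=\max_r\#\{d\mid\sigma:\ \mathrm{length}(d)=r\}$. A logarithmic random set is a random $\mathbf{A}\subseteq\mathbb{N}$ with each $i$ included independently with probability $1/i$. For $k\ge2$, $\beta_k$ is the supremum of all $c<1$ such that, with probability tending to $1$ as $D\to\infty$, there exist distinct $A_1,\dots,A_k\subseteq\mathbf{A}\cap[D^c,D]$ with $\sum_{a\in A_1}a=\cdots=\sum_{a\in A_k}a$. *)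

theory Defs
  imports "HOL-Probability.Probability" "HOL-Combinatorics.Orbits"
    "HOL-Library.Landau_Symbols"
begin

text \<open>
  Here \<open>\<sigma>\<close> is meant to permute \<open>{1..n}\<close>. A cycle (fixed points included) is represented by its
  support, an orbit of \<open>\<sigma>\<close>. A divisor is represented by the set of its cycles, not by the
  product permutation: the latter does not see the cycles of length 1, while distinct
  sets of cycles have to be counted as distinct divisors.
\<close>

definition perm_cycles :: "nat \<Rightarrow> (nat \<Rightarrow> nat) \<Rightarrow> nat set set" where
  "perm_cycles n \<sigma> = orbit \<sigma> ` {1..n}"

definition perm_divisors :: "nat \<Rightarrow> (nat \<Rightarrow> nat) \<Rightarrow> nat set set set" where
  "perm_divisors n \<sigma> = Pow (perm_cycles n \<sigma>)"

definition divisor_length :: "nat set set \<Rightarrow> nat" where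
  "divisor_length d = (\<Sum>C\<in>d. card C)"

definition perm_Delta :: "nat \<Rightarrow> (nat \<Rightarrow> nat) \<Rightarrow> nat" where
  "perm_Delta n \<sigma> = (MAX r. card {d \<in> perm_divisors n \<sigma>. divisor_length d = r})"

text \<open>
  The law of a logarithmic random set, through its indicator function \<open>\<omega>\<close> on the positive
  integers; the random set itself is \<open>random_set \<omega>\<close>.
\<close>

definition log_random :: "(nat \<Rightarrow> bool) measure" where
  "log_random = (\<Pi>\<^sub>M i\<in>{1..}. measure_pmf (bernoulli_pmf (1 / real i)))"

definition random_set :: "(nat \<Rightarrow> bool) \<Rightarrow> nat set" where
  "random_set \<omega> = {i \<in> {1..}. \<omega> i}"

definition has_equal_sums :: "nat \<Rightarrow> nat set \<Rightarrow> bool" where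
  "has_equal_sums k B \<longleftrightarrow>
     (\<exists>A :: nat \<Rightarrow> nat set. inj_on A {1..k} \<and> (\<forall>j\<in>{1..k}. A j \<subseteq> B) \<and>
        (\<forall>i\<in>{1..k}. \<forall>j\<in>{1..k}. \<Sum>(A i) = \<Sum>(A j)))"

definition equal_sums_prob :: "nat \<Rightarrow> real \<Rightarrow> real \<Rightarrow> real" where
  "equal_sums_prob k c D =
     measure log_random {\<omega> \<in> space log_random.
       has_equal_sums k {a \<in> random_set \<omega>. D powr c \<le> real a \<and> real a \<le> D}}"

definition beta :: "nat \<Rightarrow> real" where
  "beta k = Sup {c. c < 1 \<and> (equal_sums_prob k c \<longlongrightarrow> 1) at_top}"

text \<open>
  The limsup is taken in \<open>ereal\<close> so that it always exists. Since \<open>0 < beta k < 1\<close> for \<open>k \<ge> 2\<close>, no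
  division by 0 is involved; the values at \<open>k < 2\<close> do not matter.
\<close>

definition zeta :: ereal where
  "zeta = limsup (\<lambda>k. ereal (ln (real k) / ln (1 / beta k)))"

end

theory Submission
  imports Defs "HOL-Real_Asymp.Real_Asymp"
begin

text \<open>
  \<^bold>\<open>Lower bound.\<close> Cut \<open>[1, sqrt n]\<close> into about \<open>ln (ln n) / ln (1 / c)\<close> disjoint blocks
  \<open>[D powr c, D]\<close> with c just below \<open>beta k\<close>. Up to a constant factor, the cycle lengths in one block
  behave like the logarithmic random set, so most blocks carry k equal sums; combining the
  choices made in different blocks gives \<open>k\<close> to the number of good blocks many divisors of the
  same length.

  \<^bold>\<open>\<open>beta k \<ge> 0\<close>.\<close> It suffices that infinitely many disjoint ranges contain, with probability bounded
  below, two subsets with equal sums. Let \<open>\<mu>\<close> be the law of a signed sum with independent uniform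
  coefficients in \<open>{-1, 0, 1}\<close>. Adding an element divides the collision probability of \<open>\<mu>\<close> by 3,
  up to an error inverse to the size of the element. As \<open>ln 3 > 1\<close>, the collision probability of all
  elements up to y becomes \<open>O(1 / y)\<close>, so a positive proportion of the integers up to
  \<open>O(y)\<close> are signed sums, and larger elements hit one of them.

  \<^bold>\<open>\<open>zeta < \<infinity>\<close>.\<close> A bound on high moments shows that passing from y to \<open>y ^ 2\<close> multiplies the
  maximal multiplicity of subset sums by at most a constant, with high probability; hence
  \<open>beta k\<close> is at most a negative power of k.
\<close>

text \<open>\<open>beta\<close> is a supremum of reals, so its defining set must first be shown
  nonempty; the long analysis of signed sums only puts 0 into it. The proof works with
  \<open>0 \<le> beta k \<le> 1\<close>: a k with \<open>beta k\<close> equal to 0 or 1 contributes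
  the value 0 to the limsup, and exponents \<open>a \<le> 0\<close> are trivial because
  \<open>perm_Delta\<close> is at least 1. For a positive exponent below \<open>zeta\<close> a
  single k with a larger quotient suffices. Finiteness of \<open>zeta\<close> matters because the
  exponent in the theorem is a real number.

  Only failure events are carried from the random set to permutations. Their probabilities tend to 0
  along the blocks, so a comparison up to the factor 4 is enough, and bounding the mean number of
  failing blocks avoids any independence between cycle lengths in different blocks. Each fixed
  exponent below \<open>zeta\<close> thus has an exceptional set of density 0; a diagonal choice of
  exponents produces the o(1).\<close>

section \<open>Finite marginals of the logarithmic random set\<close>

text \<open>The element 0 of I does no harm: by \<open>1 / 0 = 0\<close> it is almost surely absent.\<close>

definition log_weight :: "nat set \<Rightarrow> nat set \<Rightarrow> real" where
  "log_weight I S = (\<Prod>i\<in>I. if i \<in> S then 1 / real i else 1 - 1 / real i)"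

text \<open>The expectation of \<open>h\<close> at the random set cut to \<open>I\<close>. Every
  event of the proof depends on finitely many integers, so finite sums replace the infinite product
  measure.\<close>

definition lexp :: "nat set \<Rightarrow> (nat set \<Rightarrow> real) \<Rightarrow> real" where
  "lexp I h = (\<Sum>S\<in>Pow I. log_weight I S * h S)"

definition lprob :: "nat set \<Rightarrow> (nat set \<Rightarrow> bool) \<Rightarrow> real" where
  "lprob I P = lexp I (\<lambda>S. of_bool (P S))"

lemma log_weight_nonneg: "log_weight I S \<ge> 0"
  unfolding log_weight_def
proof (intro prod_nonneg ballI)
  fix i show "0 \<le> (if i \<in> S then 1 / real i else 1 - 1 / real i)"
    by (cases "i = 0") (auto simp: field_simps)
qed

lemma lexp_mono: "(\<And>S. S \<subseteq> I \<Longrightarrow> h S \<le> g S) \<Longrightarrow> lexp I h \<le> lexp I g"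
  unfolding lexp_def by (intro sum_mono mult_left_mono log_weight_nonneg) auto

lemma lexp_cong: "(\<And>S. S \<subseteq> I \<Longrightarrow> h S = g S) \<Longrightarrow> lexp I h = lexp I g"
  unfolding lexp_def by (intro sum.cong) auto

lemma lexp_add: "lexp I (\<lambda>S. h S + g S) = lexp I h + lexp I g"
  unfolding lexp_def by (simp add: algebra_simps sum.distrib)

lemma lexp_cmult: "lexp I (\<lambda>S. c * h S) = c * lexp I h"
  unfolding lexp_def by (simp add: sum_distrib_left mult_ac)

lemma lexp_nonneg: "(\<And>S. S \<subseteq> I \<Longrightarrow> h S \<ge> 0) \<Longrightarrow> lexp I h \<ge> 0"
  unfolding lexp_def by (intro sum_nonneg mult_nonneg_nonneg log_weight_nonneg) auto

lemma lexp_empty [simp]: "lexp {} h = h {}"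
  by (simp add: lexp_def log_weight_def)

lemma lexp_singleton: "lexp {i} h = (1 - 1 / real i) * h {} + 1 / real i * h {i}"
proof -
  have "Pow {i} = {{}, {i}}" by auto
  then show ?thesis by (simp add: lexp_def log_weight_def)
qed

text \<open>Independence in Fubini form: the weight is multiplicative over disjoint ranges. Every
  argument that reveals small elements first and then averages over larger ones rests on
  this.\<close>

lemma lexp_union:
  assumes "finite I" "finite J" "I \<inter> J = {}"
  shows "lexp (I \<union> J) h = lexp I (\<lambda>S. lexp J (\<lambda>T. h (S \<union> T)))"
proof -
  have *: "log_weight (I \<union> J) (S \<union> T) = log_weight I S * log_weight J T" if "S \<subseteq> I" "T \<subseteq> J" for S T
    unfolding log_weight_def using assms that
    by (subst prod.union_disjoint) (auto intro!: arg_cong2[where f="(*)"] prod.cong)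
  have "lexp (I \<union> J) h = (\<Sum>(S, T)\<in>Pow I \<times> Pow J. log_weight (I \<union> J) (S \<union> T) * h (S \<union> T))"
    unfolding lexp_def
    by (rule sum.reindex_bij_witness[where i="\<lambda>(S, T). S \<union> T" and j="\<lambda>R. (R \<inter> I, R \<inter> J)"])
      (use assms in \<open>auto simp flip: Int_Un_distrib simp: inf.absorb1\<close>)
  also have "\<dots> = (\<Sum>(S, T)\<in>Pow I \<times> Pow J. log_weight I S * log_weight J T * h (S \<union> T))"
    by (intro sum.cong) (auto simp: *)
  also have "\<dots> = lexp I (\<lambda>S. lexp J (\<lambda>T. h (S \<union> T)))"
    by (simp add: lexp_def sum.cartesian_product [symmetric] sum_distrib_left mult_ac)
  finally show ?thesis .
qed

lemma lexp_prod:
  assumes "finite I"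
  shows "lexp I (\<lambda>S. \<Prod>i\<in>I. if i \<in> S then f i else g i) =
    (\<Prod>i\<in>I. 1 / real i * f i + (1 - 1 / real i) * g i)"
  using assms
proof (induction I)
  case (insert i I)
  have "lexp (insert i I) (\<lambda>S. \<Prod>j\<in>insert i I. if j \<in> S then f j else g j) =
    lexp ({i} \<union> I) (\<lambda>S. \<Prod>j\<in>insert i I. if j \<in> S then f j else g j)" by simp
  also have "\<dots> = lexp {i} (\<lambda>S. lexp I (\<lambda>T. \<Prod>j\<in>insert i I. if j \<in> S \<union> T then f j else g j))"
    using insert by (subst lexp_union) auto
  also have "\<dots> = lexp {i} (\<lambda>S. (if i \<in> S then f i else g i) *
      lexp I (\<lambda>T. \<Prod>j\<in>I. if j \<in> T then f j else g j))"
    unfolding lexp_cmult [symmetric]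
  proof (intro lexp_cong)
    fix S T assume "S \<subseteq> {i}" "T \<subseteq> I"
    then show "(\<Prod>j\<in>insert i I. if j \<in> S \<union> T then f j else g j) =
      (if i \<in> S then f i else g i) * (\<Prod>j\<in>I. if j \<in> T then f j else g j)"
      using insert by (subst prod.insert) (auto intro!: arg_cong2[where f="(*)"] prod.cong)
  qed
  finally show ?case using insert by (simp add: lexp_singleton algebra_simps)
qed auto

lemma lexp_const: "finite I \<Longrightarrow> lexp I (\<lambda>_. c) = c"
proof -
  assume "finite I"
  from lexp_prod[OF this, of "\<lambda>_. 1" "\<lambda>_. 1"] have "lexp I (\<lambda>_. 1) = 1" by simp
  with lexp_cmult[of I c "\<lambda>_. 1"] show ?thesis by simp
qed

lemma lprob_mono: "(\<And>S. S \<subseteq> I \<Longrightarrow> P S \<Longrightarrow> Q S) \<Longrightarrow> lprob I P \<le> lprob I Q"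
  unfolding lprob_def by (intro lexp_mono) auto

lemma lprob_nonneg: "lprob I P \<ge> 0"
  unfolding lprob_def by (intro lexp_nonneg) auto

lemma lprob_compl: "finite I \<Longrightarrow> lprob I (\<lambda>S. \<not> P S) = 1 - lprob I P"
proof -
  assume "finite I"
  have "lprob I (\<lambda>S. \<not> P S) + lprob I P = lexp I (\<lambda>_. 1)"
    unfolding lprob_def lexp_add [symmetric] by (intro lexp_cong) auto
  then show ?thesis using \<open>finite I\<close> by (simp add: lexp_const)
qed

lemma lprob_le_1: "finite I \<Longrightarrow> lprob I P \<le> 1"
  using lprob_compl[of I P] lprob_nonneg[of I "\<lambda>S. \<not> P S"] by simp

lemma lprob_disj: "lprob I (\<lambda>S. P S \<or> Q S) \<le> lprob I P + lprob I Q"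
  unfolding lprob_def lexp_add [symmetric] by (intro lexp_mono) auto

lemma lprob_Bex:
  assumes "finite L"
  shows "lprob I (\<lambda>S. \<exists>l\<in>L. P l S) \<le> (\<Sum>l\<in>L. lprob I (P l))"
  using assms
proof (induction L)
  case empty then show ?case by (simp add: lprob_def lexp_def)
next
  case (insert l L)
  have "lprob I (\<lambda>S. \<exists>l\<in>insert l L. P l S) = lprob I (\<lambda>S. P l S \<or> (\<exists>l\<in>L. P l S))" by simp
  also have "\<dots> \<le> lprob I (P l) + (\<Sum>l\<in>L. lprob I (P l))"
    using lprob_disj[of I "P l" "\<lambda>S. \<exists>l\<in>L. P l S"] insert by linarith
  finally show ?case using insert by simp
qed

lemma lprob_markov:
  assumes "\<And>S. S \<subseteq> I \<Longrightarrow> h S \<ge> 0" "t > 0"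
  shows "lprob I (\<lambda>S. h S \<ge> t) \<le> lexp I h / t"
proof -
  have "lprob I (\<lambda>S. h S \<ge> t) \<le> lexp I (\<lambda>S. (1 / t) * h S)"
    unfolding lprob_def using assms by (intro lexp_mono) (auto simp: field_simps)
  then show ?thesis by (simp only: lexp_cmult) simp
qed

text \<open>The elements outside \<open>I\<close> average out. This allows events about different
  ranges to be combined over one common ground set.\<close>

lemma lexp_restrict:
  assumes "finite J" "I \<subseteq> J"
  shows "lexp J (\<lambda>S. h (S \<inter> I)) = lexp I h"
proof -
  have fin: "finite I" "finite (J - I)" using assms finite_subset by auto
  have "lexp (I \<union> (J - I)) (\<lambda>S. h (S \<inter> I)) =
      lexp I (\<lambda>S. lexp (J - I) (\<lambda>T. h ((S \<union> T) \<inter> I)))"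
    using fin by (intro lexp_union) auto
  also have "\<dots> = lexp I (\<lambda>S. lexp (J - I) (\<lambda>T. h S))"
  proof (intro lexp_cong)
    fix S T assume "S \<subseteq> I" "T \<subseteq> J - I"
    then have "(S \<union> T) \<inter> I = S" by auto
    then show "h ((S \<union> T) \<inter> I) = h S" by simp
  qed
  also have "\<dots> = lexp I h" using fin by (simp add: lexp_const)
  finally show ?thesis using assms by (simp add: Un_absorb1)
qed

lemma lprob_restrict:
  "finite J \<Longrightarrow> I \<subseteq> J \<Longrightarrow> lprob J (\<lambda>S. P (S \<inter> I)) = lprob I P"
  unfolding lprob_def by (rule lexp_restrict)

text \<open>A conditional lower bound: whatever part in \<open>I\<close> satisfying \<open>P\<close>
  has been revealed, the rest succeeds with chance at least \<delta>. Chaining it builds a relation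
  one range at a time.\<close>

lemma lprob_union_ge:
  assumes "finite I" "finite J" "I \<inter> J = {}"
    and "\<And>S. S \<subseteq> I \<Longrightarrow> P S \<Longrightarrow> lprob J (\<lambda>T. R (S \<union> T)) \<ge> \<delta>" "\<delta> \<ge> 0"
  shows "lprob (I \<union> J) R \<ge> \<delta> * lprob I P"
proof -
  have "\<delta> * lprob I P = lexp I (\<lambda>S. \<delta> * of_bool (P S))"
    by (simp add: lprob_def lexp_cmult)
  also have "\<dots> \<le> lexp I (\<lambda>S. lprob J (\<lambda>T. R (S \<union> T)))"
    using assms lprob_nonneg by (intro lexp_mono) auto
  also have "\<dots> = lprob (I \<union> J) R"
    using assms by (simp add: lprob_def lexp_union)
  finally show ?thesis .
qed

lemma lprob_avoid:
  assumes "finite I" "X \<subseteq> I"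
  shows "lprob I (\<lambda>S. S \<inter> X = {}) = (\<Prod>i\<in>X. 1 - 1 / real i)"
proof -
  have fX: "finite X" using assms finite_subset by auto
  have "lprob I (\<lambda>S. S \<inter> X = {}) = lprob X (\<lambda>S. S = {})"
    using lprob_restrict[OF assms, of "\<lambda>S. S = {}"] by simp
  also have "\<dots> = lexp X (\<lambda>S. \<Prod>i\<in>X. if i \<in> S then 0 else 1)"
    unfolding lprob_def
  proof (intro lexp_cong)
    fix S assume "S \<subseteq> X"
    then show "of_bool (S = {}) = (\<Prod>i\<in>X. if i \<in> S then 0 else (1::real))"
      using fX by (cases "S = {}") (auto simp: prod_zero_iff)
  qed
  also have "\<dots> = (\<Prod>i\<in>X. 1 - 1 / real i)"
    using fX by (simp add: lexp_prod)
  finally show ?thesis .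
qed

text \<open>The factors \<open>(i - 1) / i\<close> telescope. The chance that a range is empty thus
  depends only on the ratio of its endpoints, which makes all estimates scale invariant.\<close>

lemma prod_one_minus_inverse:
  assumes "1 \<le> x" "x \<le> y"
  shows "(\<Prod>i\<in>{x<..y}. 1 - 1 / real i) = real x / real y"
  using assms(2)
proof (induction rule: dec_induct)
  case base then show ?case using assms by simp
next
  case (step n)
  have "{x<..Suc n} = insert (Suc n) {x<..n}" using step by auto
  then show ?case using step assms by (simp add: field_simps)
qed

text \<open>The bridge from the product measure to finite sums: the event splits into cylinders, one
  for each possible trace on \<open>I\<close>.\<close>

lemma measure_log_random:
  assumes "finite I" "I \<subseteq> {1..}"
  shows "measure log_random {\<omega> \<in> space log_random. P {i\<in>I. \<omega> i}} = lprob I P"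
proof -
  let ?M = "\<lambda>i. measure_pmf (bernoulli_pmf (1 / real i))"
  interpret product_prob_space ?M "{1..}" by unfold_locales
  have cyl: "{\<omega> \<in> space log_random. {i\<in>I. \<omega> i} = S} =
      prod_emb {1..} ?M I (\<Pi>\<^sub>E i\<in>I. {i \<in> S})" if "S \<subseteq> I" for S
    using that assms
    by (auto simp: log_random_def prod_emb_def space_PiM PiE_def restrict_def Pi_def extensional_def)
  have sets: "{\<omega> \<in> space log_random. {i\<in>I. \<omega> i} = S} \<in> sets log_random" if "S \<subseteq> I" for S
    unfolding cyl[OF that] unfolding log_random_def
    by (intro sets_PiM_I) (use assms in auto)
  have m: "measure log_random {\<omega> \<in> space log_random. {i\<in>I. \<omega> i} = S} = log_weight I S" if "S \<subseteq> I" for S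
    unfolding cyl[OF that] unfolding log_random_def
    by (subst measure_PiM_emb) (use assms in
        \<open>auto simp: log_weight_def measure_pmf_single intro!: prod.cong\<close>)
  have eq: "{\<omega> \<in> space log_random. P {i\<in>I. \<omega> i}} =
     (\<Union>S\<in>{S\<in>Pow I. P S}. {\<omega> \<in> space log_random. {i\<in>I. \<omega> i} = S})" by auto
  interpret L: prob_space log_random unfolding log_random_def by unfold_locales
  have "measure log_random {\<omega> \<in> space log_random. P {i\<in>I. \<omega> i}} =
     (\<Sum>S\<in>{S\<in>Pow I. P S}. measure log_random {\<omega> \<in> space log_random. {i\<in>I. \<omega> i} = S})"
    unfolding eq using assms sets
    by (intro L.finite_measure_finite_Union) (auto simp: disjoint_family_on_def)
  also have "\<dots> = (\<Sum>S\<in>{S\<in>Pow I. P S}. log_weight I S)" by (intro sum.cong) (auto simp: m)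
  also have "\<dots> = lprob I P"
    unfolding lprob_def lexp_def using assms by (intro sum.mono_neutral_cong_left) auto
  finally show ?thesis .
qed

lemma equal_sums_prob_eq:
  "equal_sums_prob k c D = lprob {a. 1 \<le> a \<and> D powr c \<le> real a \<and> real a \<le> D} (has_equal_sums k)"
proof -
  let ?I = "{a. 1 \<le> a \<and> D powr c \<le> real a \<and> real a \<le> D}"
  have "?I \<subseteq> {..nat \<lceil>D\<rceil>}" by (auto simp: le_nat_iff) linarith
  then have "finite ?I" using finite_subset by blast
  have "{a \<in> random_set \<omega>. D powr c \<le> real a \<and> real a \<le> D} = {i\<in>?I. \<omega> i}" for \<omega>
    by (auto simp: random_set_def)
  then show ?thesis
    unfolding equal_sums_prob_def using measure_log_random[OF \<open>finite ?I\<close>, of "has_equal_sums k"]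
    by auto
qed

section \<open>Families of subsets with a common sum\<close>

text \<open>Trades the injective enumeration in the definition for an unindexed set of at least k
  subsets, which is easier to build and to combine.\<close>

lemma has_equal_sumsI:
  assumes "finite F" "F \<subseteq> Pow B" "\<And>X. X \<in> F \<Longrightarrow> \<Sum>X = s" "k \<le> card F"
  shows "has_equal_sums k B"
proof -
  obtain f where f: "f ` {1..k} \<subseteq> F" "inj_on f {1..k}"
    using card_le_inj[of "{1..k}" F] assms by auto
  show ?thesis unfolding has_equal_sums_def
    by (rule exI[of _ f]) (use f assms in \<open>auto simp: image_subset_iff\<close>)
qed

lemma has_equal_sumsE:
  assumes "has_equal_sums k B"
  obtains F s where "finite F" "F \<subseteq> Pow B" "\<And>X. X \<in> F \<Longrightarrow> \<Sum>X = s" "card F = k"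
proof -
  obtain A where A: "inj_on A {1..k}" "\<forall>j\<in>{1..k}. A j \<subseteq> B"
    "\<forall>i\<in>{1..k}. \<forall>j\<in>{1..k}. \<Sum>(A i) = \<Sum>(A j)"
    using assms unfolding has_equal_sums_def by blast
  show ?thesis
  proof (rule that[of "A ` {1..k}" "\<Sum>(A 1)"])
    fix X assume "X \<in> A ` {1..k}"
    then obtain j where "j \<in> {1..k}" "X = A j" by auto
    then show "\<Sum>X = \<Sum>(A 1)" using A(3)[rule_format, of j 1] by auto
  qed (use A in \<open>auto simp: card_image\<close>)
qed

lemma has_equal_sums_mono:
  assumes "has_equal_sums k B" "B \<subseteq> B'" "k' \<le> k"
  shows "has_equal_sums k' B'"
proof -
  obtain F s where "finite F" "F \<subseteq> Pow B" "\<And>X. X \<in> F \<Longrightarrow> \<Sum>X = s" "card F = k"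
    using has_equal_sumsE[OF assms(1)] by blast
  then show ?thesis using assms by (intro has_equal_sumsI[of F _ s]) auto
qed

lemma has_equal_sums_1: "has_equal_sums (Suc 0) B"
  by (rule has_equal_sumsI[of "{{}}" _ 0]) auto

text \<open>A union of one choice from each side determines both choices, and its sum is
  \<open>s + t\<close>. This multiplicativity turns many good blocks into a power of k.\<close>

lemma has_equal_sums_Un:
  assumes "has_equal_sums k B" "has_equal_sums l B'" "B \<inter> B' = {}" "finite B" "finite B'"
  shows "has_equal_sums (k * l) (B \<union> B')"
proof -
  obtain F s where F: "finite F" "F \<subseteq> Pow B" "\<And>X. X \<in> F \<Longrightarrow> \<Sum>X = s" "card F = k"
    using has_equal_sumsE[OF assms(1)] by blast
  obtain G t where G: "finite G" "G \<subseteq> Pow B'" "\<And>X. X \<in> G \<Longrightarrow> \<Sum>X = t" "card G = l"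
    using has_equal_sumsE[OF assms(2)] by blast
  have inj: "inj_on (\<lambda>(X, Y). X \<union> Y) (F \<times> G)"
  proof (rule inj_on_inverseI[where g="\<lambda>Z. (Z \<inter> B, Z \<inter> B')"])
    fix x assume "x \<in> F \<times> G"
    then show "((case x of (X, Y) \<Rightarrow> X \<union> Y) \<inter> B, (case x of (X, Y) \<Rightarrow> X \<union> Y) \<inter> B') = x"
      using F(2) G(2) assms(3) by (cases x) blast
  qed
  show ?thesis
  proof (rule has_equal_sumsI[of "(\<lambda>(X, Y). X \<union> Y) ` (F \<times> G)" _ "s + t"])
    fix Z assume "Z \<in> (\<lambda>(X, Y). X \<union> Y) ` (F \<times> G)"
    then obtain X Y where Z: "Z = X \<union> Y" "X \<in> F" "Y \<in> G" by auto
    then have "X \<subseteq> B" "Y \<subseteq> B'" using F(2) G(2) by auto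
    then have "X \<inter> Y = {}" "finite X" "finite Y"
      using assms(3-5) finite_subset by blast+
    then show "\<Sum>Z = s + t" using Z F G by (simp add: sum.union_disjoint)
  qed (use F G inj in \<open>auto simp: card_image\<close>)
qed

text \<open>An integer version of the geometric progression \<open>N * (1 + 1 / t) ^ l\<close>;
  elements are revealed window by window. It is used with \<open>t = 1000\<close> for signed sums
  and with \<open>t = n ^ 2\<close> for multiplicities.\<close>

primrec window :: "nat \<Rightarrow> nat \<Rightarrow> nat \<Rightarrow> nat" where
  "window t N 0 = N"
| "window t N (Suc l) = window t N l + window t N l div t"

lemma window_mono: "l \<le> m \<Longrightarrow> window t N l \<le> window t N m"
  by (rule lift_Suc_mono_le[where f="window t N"]) auto

lemma window_ge: "N \<le> window t N l"
  using window_mono[of 0 l t N] by simp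

section \<open>Equal sums occur almost surely\<close>

text \<open>The odds of a being present are \<open>(1 / a) / (1 - 1 / a) = 1 / (a - 1)\<close>, so
  adding a to the empty set multiplies its weight by this number.\<close>

lemma log_weight_singleton:
  assumes "a \<in> V" "finite V" "2 \<le> a"
  shows "log_weight V {a} = (\<Prod>i\<in>V. 1 - 1 / real i) / (real a - 1)"
proof -
  have "log_weight V {a} = 1 / real a * (\<Prod>i\<in>V - {a}. 1 - 1 / real i)"
    unfolding log_weight_def using assms by (subst prod.remove[of _ a]) (auto intro!: prod.cong)
  moreover have "(\<Prod>i\<in>V. 1 - 1 / real i) = (1 - 1 / real a) * (\<Prod>i\<in>V - {a}. 1 - 1 / real i)"
    using assms by (subst prod.remove[of _ a]) auto
  moreover have "1 - 1 / real a = (real a - 1) / real a" using assms by (simp add: field_simps)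
  ultimately show ?thesis using assms by simp
qed

text \<open>The source of every error inverse to the scale: a quantity whose total over all
  positions a is bounded contributes at most \<open>1 / y\<close> times that total.\<close>

lemma log_weight_singleton_le:
  assumes "a \<in> {y<..y'}" "1 \<le> y"
  shows "log_weight {y<..y'} {a} \<le> 1 / real y"
proof -
  have "log_weight {y<..y'} {a} = (real y / real y') / (real a - 1)"
    using assms by (subst log_weight_singleton) (auto simp: prod_one_minus_inverse)
  also have "\<dots> \<le> 1 / (real a - 1)"
    using assms by (intro divide_right_mono) auto
  also have "\<dots> \<le> 1 / real y" using assms by (intro divide_left_mono) auto
  finally show ?thesis .
qed

text \<open>Only windows with exactly one element change the process; empty and crowded windows keep
  the value \<open>H0\<close>.\<close>

lemma lexp_at_most_single:
  assumes "finite V"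
  shows "lexp V (\<lambda>T. if \<exists>a. T = {a} then H1 (the_elem T) else H0) =
    H0 + (\<Sum>a\<in>V. log_weight V {a} * (H1 a - H0))"
proof -
  let ?f = "\<lambda>T. if \<exists>a. T = {a} then H1 (the_elem T) - H0 else 0"
  have "lexp V (\<lambda>T. if \<exists>a. T = {a} then H1 (the_elem T) else H0) = lexp V (\<lambda>T. H0 + ?f T)"
    by (intro lexp_cong) auto
  also have "\<dots> = H0 + lexp V ?f"
    using assms by (simp only: lexp_add lexp_const)
  also have "lexp V ?f = (\<Sum>T\<in>(\<lambda>a. {a}) ` V. log_weight V T * ?f T)"
    unfolding lexp_def using assms by (intro sum.mono_neutral_right) auto
  also have "\<dots> = (\<Sum>a\<in>V. log_weight V {a} * (H1 a - H0))"
    by (subst sum.reindex) (auto simp: inj_on_def)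
  finally show ?thesis .
qed

section \<open>Collisions of signed sums\<close>

text \<open>The autocorrelation of the multiplicities: the number of ordered pairs of entries of
  \<open>M\<close> with difference \<open>b\<close>.\<close>

definition collisions :: "int multiset \<Rightarrow> int \<Rightarrow> real" where
  "collisions M b = (\<Sum>x\<in>#M. real (count M (x + b)))"

text \<open>Multisets keep multiplicities, so after m steps from a single 0 the multiset has
  \<open>3 ^ m\<close> entries and is the law \<mu> of the signed sum before normalization.\<close>

definition add_signed :: "int \<Rightarrow> int multiset \<Rightarrow> int multiset" where
  "add_signed a M = M + image_mset (\<lambda>x. x + a) M + image_mset (\<lambda>x. x - a) M"

lemma count_image_add: "count (image_mset (\<lambda>x. x + a) M) z = count M (z - a)" for a :: int
  by (induction M) auto

lemma count_image_diff: "count (image_mset (\<lambda>x. x - a) M) z = count M (z + a)" for a :: int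
  by (induction M) auto

lemma size_ext [simp]: "size (add_signed a M) = 3 * size M"
  by (simp add: add_signed_def)

text \<open>Two copies carry coefficients from -1, 0, 1. Among the nine pairs the difference is 0
  three times, 1 and -1 twice each, 2 and -2 once each.\<close>

lemma collisions_add_signed: "collisions (add_signed a M) 0 =
  3 * collisions M 0 + 2 * collisions M a + 2 * collisions M (- a) + collisions M (2 * a) + collisions M (- 2 * a)"
proof -
  have [simp]: "count (add_signed a M) z = count M z + count M (z - a) + count M (z + a)" for z
    by (simp add: add_signed_def count_image_add count_image_diff)
  have e: "x + 2 * a = x + a + a" "x - 2 * a = x - a - a" for x by simp_all
  have "collisions (add_signed a M) 0 = (\<Sum>x\<in>#M. real (count (add_signed a M) x)) +
      (\<Sum>x\<in>#M. real (count (add_signed a M) (x + a))) + (\<Sum>x\<in>#M. real (count (add_signed a M) (x - a)))"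
    unfolding collisions_def by (subst (2) add_signed_def) (simp add: multiset.map_comp o_def)
  also have "\<dots> = 3 * collisions M 0 + 2 * collisions M a + 2 * collisions M (- a) + collisions M (2 * a) + collisions M (- 2 * a)"
    unfolding collisions_def by (simp add: sum_mset.distrib e algebra_simps)
  finally show ?thesis .
qed

lemma sum_count_le: "finite Z \<Longrightarrow> (\<Sum>z\<in>Z. count M z) \<le> size M"
proof -
  assume "finite Z"
  then have "(\<Sum>z\<in>Z. count M z) = (\<Sum>z\<in>Z \<inter> set_mset M. count M z)"
    by (intro sum.mono_neutral_right) (auto simp: count_eq_zero_iff)
  also have "\<dots> \<le> (\<Sum>z\<in>set_mset M. count M z)" by (intro sum_mono2) auto
  finally show ?thesis by (simp add: size_multiset_overloaded_eq)
qed

lemma sum_sum_mset_swap: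
  fixes g :: "'a \<Rightarrow> 'b \<Rightarrow> real"
  shows "(\<Sum>a\<in>V. \<Sum>x\<in>#M. g a x) = (\<Sum>x\<in>#M. \<Sum>a\<in>V. g a x)"
  by (induction M) (auto simp: sum.distrib)

lemma sum_mset_eq_sum_count:
  fixes g :: "'a \<Rightarrow> real"
  shows "(\<Sum>x\<in>#M. g x) = (\<Sum>x\<in>set_mset M. real (count M x) * g x)"
proof (induction M)
  case (add x M)
  have "(\<Sum>z\<in>set_mset (add_mset x M). real (count (add_mset x M) z) * g z) =
      (\<Sum>z\<in>set_mset (add_mset x M). real (count M z) * g z + (if z = x then g z else 0))"
    by (intro sum.cong) (auto simp: algebra_simps)
  also have "\<dots> = (\<Sum>z\<in>set_mset (add_mset x M). real (count M z) * g z) + g x"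
    by (simp only: sum.distrib) (simp add: sum.delta')
  also have "(\<Sum>z\<in>set_mset (add_mset x M). real (count M z) * g z) =
      (\<Sum>z\<in>set_mset M. real (count M z) * g z)"
    by (intro sum.mono_neutral_right) (auto simp: not_in_iff)
  finally show ?case using add by simp
qed auto

text \<open>For a fixed entry x the points \<open>x + f a\<close> are distinct, so their
  multiplicities add up to at most \<open>size M\<close>. Hence shifted collisions are small on
  average over a, though not for each single a.\<close>

lemma sum_collisions_le:
  assumes "finite V" "inj_on f V"
  shows "(\<Sum>a\<in>V. collisions M (f a)) \<le> real (size M) ^ 2"
proof -
  have "(\<Sum>a\<in>V. collisions M (f a)) = (\<Sum>x\<in>#M. \<Sum>a\<in>V. real (count M (x + f a)))"
    unfolding collisions_def by (rule sum_sum_mset_swap)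
  also have "\<dots> \<le> (\<Sum>x\<in>#M. real (size M))"
  proof (intro sum_mset_mono)
    fix x
    have "(\<Sum>a\<in>V. count M (x + f a)) = (\<Sum>z\<in>(\<lambda>a. x + f a) ` V. count M z)"
      using assms by (subst sum.reindex) (auto simp: inj_on_def)
    also have "\<dots> \<le> size M" using assms by (intro sum_count_le) auto
    finally show "(\<Sum>a\<in>V. real (count M (x + f a))) \<le> real (size M)"
      by (simp flip: of_nat_sum)
  qed
  also have "\<dots> = real (size M) ^ 2" by (simp add: power2_eq_square)
  finally show ?thesis .
qed

lemma collisions_0_eq: "collisions M 0 = (\<Sum>x\<in>set_mset M. real (count M x) ^ 2)"
proof -
  have "collisions M 0 = (\<Sum>x\<in>set_mset M. real (count M x) * real (count M x))"
    unfolding collisions_def by (simp add: sum_mset_eq_sum_count)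
  then show ?thesis by (simp add: power2_eq_square)
qed

lemma collisions_nonneg: "collisions M b \<ge> 0"
  unfolding collisions_def by (simp add: sum_mset_eq_sum_count sum_nonneg)

lemma collisions_0_pos: "M \<noteq> {#} \<Longrightarrow> collisions M 0 > 0"
  unfolding collisions_0_eq by (intro sum_pos) auto

text \<open>Cauchy-Schwarz for the multiplicities: few collisions force many distinct
  values.\<close>

lemma size_squared_le: "real (size M) ^ 2 \<le> real (card (set_mset M)) * collisions M 0"
  using Cauchy_Schwarz_ineq_sum[of "\<lambda>_. 1" "\<lambda>x. real (count M x)" "set_mset M"]
  by (simp add: collisions_0_eq size_multiset_overloaded_eq)

text \<open>For nonempty \<open>M\<close>, the probability that two independent uniform entries
  agree.\<close>

definition collision_rate :: "int multiset \<Rightarrow> real" where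
  "collision_rate M = collisions M 0 / real (size M) ^ 2"

lemma collision_rate_pos: "M \<noteq> {#} \<Longrightarrow> collision_rate M > 0"
  unfolding collision_rate_def using collisions_0_pos by (intro divide_pos_pos) auto

section \<open>Effect of one window on the collision rate\<close>

lemma powr_add_le:
  fixes x y s :: real assumes "x \<ge> 0" "y \<ge> 0" "0 < s" "s \<le> 1"
  shows "(x + y) powr s \<le> x powr s + y powr s"
proof (cases "x + y = 0")
  case False
  then have pos: "x + y > 0" using assms by simp
  have "x / (x + y) \<le> (x / (x + y)) powr s" "y / (x + y) \<le> (y / (x + y)) powr s"
    using assms pos powr_mono'[of s 1 "x / (x + y)"] powr_mono'[of s 1 "y / (x + y)"] by auto
  moreover have "x / (x + y) + y / (x + y) = 1"
    using pos by (simp add: add_divide_distrib [symmetric])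
  ultimately have "1 \<le> (x / (x + y)) powr s + (y / (x + y)) powr s"
    by linarith
  also have "\<dots> = (x powr s + y powr s) / (x + y) powr s"
    using assms pos by (simp add: powr_divide add_divide_distrib)
  finally show ?thesis using pos by (simp add: field_simps)
qed (use assms in auto)

text \<open>Jensen for a concave power: Young's inequality supplies the tangent line at x. The
  weights are left unnormalized because they are the chances of one-element windows.\<close>

lemma sum_powr_jensen:
  fixes c q :: "'a \<Rightarrow> real"
  assumes "\<And>a. a \<in> V \<Longrightarrow> c a \<ge> 0" "\<And>a. a \<in> V \<Longrightarrow> q a > 0" "0 < s" "s < 1" "x > 0"
    and "(\<Sum>a\<in>V. c a * q a) \<le> (\<Sum>a\<in>V. c a) * x"
  shows "(\<Sum>a\<in>V. c a * q a powr s) \<le> (\<Sum>a\<in>V. c a) * x powr s"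
proof -
  have "q a powr s \<le> x powr s * (s * (q a / x) + (1 - s))" if "a \<in> V" for a
  proof -
    have "(q a / x) powr s * 1 powr (1 - s) \<le> s * (q a / x) + (1 - s) * 1"
      using assms that by (intro Youngs_inequality_0) auto
    then show ?thesis using assms that assms(2)[OF that] by (simp add: powr_divide field_simps)
  qed
  then have "(\<Sum>a\<in>V. c a * q a powr s) \<le> (\<Sum>a\<in>V. c a * (x powr s * (s * (q a / x) + (1 - s))))"
    using assms by (intro sum_mono mult_left_mono) auto
  also have "\<dots> = x powr s * (s / x * (\<Sum>a\<in>V. c a * q a) + (1 - s) * (\<Sum>a\<in>V. c a))"
  proof -
    have "c a * (x powr s * (s * (q a / x) + (1 - s))) =
      x powr s * (s / x * (c a * q a) + (1 - s) * c a)" for a by (simp add: algebra_simps)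
    then show ?thesis by (simp only: sum.distrib flip: sum_distrib_left)
  qed
  also have "\<dots> \<le> x powr s * (s / x * ((\<Sum>a\<in>V. c a) * x) + (1 - s) * (\<Sum>a\<in>V. c a))"
    using assms by (intro mult_left_mono add_mono) auto
  also have "\<dots> = (\<Sum>a\<in>V. c a) * x powr s" using assms by (simp add: field_simps)
  finally show ?thesis .
qed

text \<open>A window with several elements is skipped. This only discards available sums, and it
  keeps the estimate of one step linear in the weights of single elements.\<close>

definition signed_step :: "int multiset \<Rightarrow> nat set \<Rightarrow> int multiset" where
  "signed_step M T = (if \<exists>a. T = {a} then add_signed (int (the_elem T)) M else M)"

text \<open>Dividing the rate by 3 multiplies its 1/8-th power by this number. The next constant is
  the 1/8-th power of \<open>2 / (3 * p)\<close>, with the chance p of a one-element window replaced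
  by its lower bound 99/100000.\<close>

definition third_root8 :: real where "third_root8 = (1 / 3) powr (1 / 8)"
definition jump_const :: real where "jump_const = (2 / (3 * (99 / 100000))) powr (1 / 8)"

text \<open>The exponent 1/8 is small enough for \<open>s < 1 - 3 powr (- s)\<close>. Since a window of ratio 1001/1000
  holds exactly one element with probability nearly 1/1000 (at least 99/100000), the mean of the
  collision rate to this power decays faster than the scale to this power grows. First moments
  do not decay fast enough: they are dominated by sets with unusually few elements.\<close>

lemma collision_rate_signed_step:
  assumes y: "10 ^ 6 \<le> y" and M: "M \<noteq> {#}"
  defines "V \<equiv> {y<..y + y div 1000}"
  shows "lexp V (\<lambda>T. collision_rate (signed_step M T) powr (1 / 8)) \<le>
    (1 - 99 / 100000 * (1 - third_root8)) * collision_rate M powr (1 / 8) + jump_const * (1 / real y) powr (1 / 8)"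
proof -
  define y' where "y' = y + y div 1000"
  define p where "p = (\<Sum>a\<in>V. log_weight V {a})"
  define Q where "Q = collision_rate M"
  define c where "c = real (size M) ^ 2"
  have V: "V = {y<..y'}" "finite V" by (auto simp: V_def y'_def)
  have Q: "Q > 0" using M by (simp add: Q_def collision_rate_pos)
  have c: "c > 0" using M by (simp add: c_def)
  have yr: "real y \<ge> 1000000" using y by simp
  have "y = 1000 * (y div 1000) + y mod 1000" by simp
  moreover have "y mod 1000 < 1000" by simp
  ultimately have "real y \<le> 1000 * real (y div 1000) + 1000"
    and le: "1000 * real (y div 1000) \<le> real y" by linarith+
  \<comment> \<open>Rounding loses at most 1, which is at most a thousandth of
    \<open>y / 1000\<close> because \<open>y \<ge> 10 ^ 6\<close>.\<close>
  then have d: "real (y div 1000) \<ge> 999 / 1000000 * real y" using yr by simp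
  have y'le: "real y' \<le> 1001 / 1000 * real y" using le by (simp add: y'_def)
  have y'ge: "real y' > 0" "y' \<ge> y" using yr by (auto simp: y'_def)
  have wtV: "log_weight V {a} = (real y / real y') / (real a - 1)" if "a \<in> V" for a
    using that yr V(2) by (subst log_weight_singleton) (auto simp: V prod_one_minus_inverse)
  have "log_weight V {a} \<ge> (real y / real y') / real y'" if "a \<in> V" for a
    unfolding wtV[OF that] using that yr V by (intro divide_left_mono) auto
  then have "p \<ge> (\<Sum>a\<in>V. (real y / real y') / real y')"
    unfolding p_def by (intro sum_mono) auto
  also have "(\<Sum>a\<in>V. (real y / real y') / real y') = real (y div 1000) * real y / (real y')\<^sup>2"
    by (simp add: V y'_def power2_eq_square)
  finally have p1: "p \<ge> real (y div 1000) * real y / (real y')\<^sup>2" .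
  have "real (y div 1000) * real y / (real y')\<^sup>2 \<ge>
      (999 / 1000000 * real y) * real y / (1001 / 1000 * real y)\<^sup>2"
    using d y'le y'ge yr by (intro frac_le mult_right_mono power_mono) auto
  moreover have "(999 / 1000000 * real y) * real y / (1001 / 1000 * real y)\<^sup>2 \<ge> 99 / 100000"
    using yr by (simp add: field_simps power2_eq_square)
  ultimately have p: "p \<ge> 99 / 100000" using p1 by linarith
  have "p \<le> lexp V (\<lambda>_. 1)"
    unfolding p_def lexp_def using V log_weight_nonneg
    by (subst sum.reindex[of "\<lambda>a. {a}" V "log_weight V", symmetric, unfolded o_def])
      (auto intro!: sum_mono2)
  then have p_le: "p \<le> 1" using V by (simp add: lexp_const)
  \<comment> \<open>Bounds the mean new rate, given exactly one element in the window. Equal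
    coefficients give \<open>Q / 3\<close>; the shifted collisions total at most
    \<open>6 * c\<close>, have weight at most \<open>1 / y\<close>, and are divided by
    \<open>9 * c\<close> and by p.\<close>
  define x where "x = Q / 3 + 2 / (3 * p * real y)"
  have x: "x > 0" using Q p yr by (auto simp: x_def intro!: add_pos_pos)
  have nQ: "collision_rate (add_signed (int a) M) = Q / 3 + (2 * collisions M (int a) + 2 * collisions M (- int a) +
      collisions M (2 * int a) + collisions M (- 2 * int a)) / (9 * c)" for a
    using c unfolding collision_rate_def Q_def c_def by (simp add: collisions_add_signed field_simps)
  have "(\<Sum>a\<in>V. log_weight V {a} * collision_rate (add_signed (int a) M)) = p * (Q / 3) +
      (\<Sum>a\<in>V. log_weight V {a} * ((2 * collisions M (int a) + 2 * collisions M (- int a) +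
      collisions M (2 * int a) + collisions M (- 2 * int a)) / (9 * c)))"
    unfolding nQ p_def by (simp only: distrib_left sum.distrib sum_distrib_right)
  also have "\<dots> \<le> p * (Q / 3) +
      (\<Sum>a\<in>V. 1 / real y * ((2 * collisions M (int a) + 2 * collisions M (- int a) +
      collisions M (2 * int a) + collisions M (- 2 * int a)) / (9 * c)))"
    using yr c by (intro add_left_mono sum_mono mult_right_mono)
      (auto simp: V collisions_nonneg intro!: log_weight_singleton_le divide_nonneg_pos add_nonneg_nonneg)
  also have "(\<Sum>a\<in>V. 1 / real y * ((2 * collisions M (int a) + 2 * collisions M (- int a) +
      collisions M (2 * int a) + collisions M (- 2 * int a)) / (9 * c))) =
    1 / (9 * c * real y) * (2 * (\<Sum>a\<in>V. collisions M (int a)) + 2 * (\<Sum>a\<in>V. collisions M (- int a)) +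
      (\<Sum>a\<in>V. collisions M (2 * int a)) + (\<Sum>a\<in>V. collisions M (- 2 * int a)))"
  proof -
    have "1 / real y * (t / (9 * c)) = 1 / (9 * c * real y) * t" for t by simp
    then show ?thesis by (simp only: sum.distrib flip: sum_distrib_left)
  qed
  also have "\<dots> \<le> 1 / (9 * c * real y) * (2 * c + 2 * c + c + c)"
    unfolding c_def using V
    by (intro mult_left_mono add_mono sum_collisions_le) (auto simp: inj_on_def)
  also have "p * (Q / 3) + \<dots> = p * x"
    using c p yr by (simp add: x_def field_simps)
  finally have avg: "(\<Sum>a\<in>V. log_weight V {a} * collision_rate (add_signed (int a) M)) \<le> p * x" by simp
  have add_signed_ne: "add_signed a M \<noteq> {#}" for a using M by (simp add: add_signed_def)
  have "(\<Sum>a\<in>V. log_weight V {a} * collision_rate (add_signed (int a) M) powr (1 / 8)) \<le> p * x powr (1 / 8)"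
    unfolding p_def using avg x by (intro sum_powr_jensen)
      (auto simp: log_weight_nonneg add_signed_ne p_def intro: collision_rate_pos)
  also have "x powr (1 / 8) \<le> (Q / 3) powr (1 / 8) + (2 / (3 * p * real y)) powr (1 / 8)"
    unfolding x_def using Q p yr by (intro powr_add_le) auto
  also have "(Q / 3) powr (1 / 8) = third_root8 * Q powr (1 / 8)"
    using Q by (simp add: third_root8_def powr_mult [symmetric])
  also have "(2 / (3 * p * real y)) powr (1 / 8) \<le>
      (2 / (3 * (99 / 100000)) * (1 / real y)) powr (1 / 8)"
    using p yr by (intro powr_mono2) (auto simp: field_simps)
  also have "\<dots> = jump_const * (1 / real y) powr (1 / 8)"
    unfolding jump_const_def using yr by (subst powr_mult) auto
  finally have S: "(\<Sum>a\<in>V. log_weight V {a} * collision_rate (add_signed (int a) M) powr (1 / 8)) \<le>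
      p * (third_root8 * Q powr (1 / 8) + jump_const * (1 / real y) powr (1 / 8))"
    using p by simp
  have third_root8: "third_root8 \<le> 1" unfolding third_root8_def by (intro powr_le1) auto
  have jump_const: "jump_const \<ge> 0" by (simp add: jump_const_def)
  have "lexp V (\<lambda>T. collision_rate (signed_step M T) powr (1 / 8)) =
     lexp V (\<lambda>T. if \<exists>a. T = {a} then collision_rate (add_signed (int (the_elem T)) M) powr (1 / 8) else Q powr (1 / 8))"
    by (intro lexp_cong) (auto simp: signed_step_def Q_def)
  also have "\<dots> = Q powr (1 / 8) +
      (\<Sum>a\<in>V. log_weight V {a} * (collision_rate (add_signed (int a) M) powr (1 / 8) - Q powr (1 / 8)))"
    using V by (intro lexp_at_most_single) auto
  also have "\<dots> = Q powr (1 / 8) - p * Q powr (1 / 8) +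
      (\<Sum>a\<in>V. log_weight V {a} * collision_rate (add_signed (int a) M) powr (1 / 8))"
    by (simp add: right_diff_distrib sum_subtractf p_def sum_distrib_right)
  also have "\<dots> \<le> Q powr (1 / 8) - p * Q powr (1 / 8) +
      p * (third_root8 * Q powr (1 / 8) + jump_const * (1 / real y) powr (1 / 8))"
    using S by simp
  also have "\<dots> = (1 - p * (1 - third_root8)) * Q powr (1 / 8) + p * (jump_const * (1 / real y) powr (1 / 8))"
    by (simp add: algebra_simps)
  also have "\<dots> \<le> (1 - 99 / 100000 * (1 - third_root8)) * Q powr (1 / 8) + 1 * (jump_const * (1 / real y) powr (1 / 8))"
    using p_le jump_const mult_right_mono[OF p, of "1 - third_root8"] third_root8
    by (intro add_mono mult_right_mono) (auto simp: algebra_simps)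
  finally show ?thesis by (simp add: Q_def)
qed

lemma power8_powr: "(x ^ 8) powr (1 / 8) = x" if "x > 0" for x :: real
  using powr_powr[of x 8 "1 / 8"] that by simp

text \<open>\<open>0.872 ^ 8\<close> is about 0.3343, just above 1/3.\<close>

lemma third_root8_le: "third_root8 \<le> 872 / 1000"
proof -
  have "third_root8 \<le> ((872 / 1000) ^ 8) powr (1 / 8)"
    unfolding third_root8_def by (intro powr_mono2) (auto simp: power_divide)
  also have "\<dots> = 872 / 1000"
    by (intro power8_powr) auto
  finally show ?thesis .
qed

lemma third_root8_nonneg: "third_root8 \<ge> 0" by (simp add: third_root8_def)

text \<open>The factor per window for the product of the mean 1/8-th power of the rate and the
  1/8-th power of the scale. A value below 1 expresses that the rate falls faster than the inverse
  scale.\<close>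

definition contraction_const :: real where
  "contraction_const = (1001 / 1000) powr (1 / 8) * (1 - 99 / 100000 * (1 - third_root8))"

lemma powr_1001_le: "(1001 / 1000) powr (1 / 8 :: real) \<le> 1 + 1 / 8000"
proof -
  have "(1001 / 1000) powr (1 / 8 :: real) \<le> ((1 + 1 / 8000) ^ 8) powr (1 / 8)"
    by (intro powr_mono2) (auto simp: power_divide)
  also have "\<dots> = 1 + 1 / 8000" by (intro power8_powr) auto
  finally show ?thesis .
qed

text \<open>The margin is thin: the scale gains 1/8000 = 0.000125 in relative terms, the rate loses
  0.00099 * 0.128 = 0.00012672.\<close>

lemma contraction_const: "0 < contraction_const" "contraction_const < 1"
proof -
  have "contraction_const \<le> (1 + 1 / 8000) * (1 - 99 / 100000 * (1 - 872 / 1000))"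
    unfolding contraction_const_def using powr_1001_le third_root8_le third_root8_nonneg by (intro mult_mono) auto
  then show "contraction_const < 1" by simp
  show "0 < contraction_const" unfolding contraction_const_def using third_root8_nonneg by (intro mult_pos_pos) auto
qed

section \<open>Signed sums along the windows\<close>

primrec signed_sums :: "nat \<Rightarrow> nat \<Rightarrow> nat set \<Rightarrow> int multiset" where
  "signed_sums N 0 S = {#0#}"
| "signed_sums N (Suc l) S = signed_step (signed_sums N l S) (S \<inter> {window 1000 N l<..window 1000 N (Suc l)})"

text \<open>The process looks only at elements revealed so far, so the estimate for one window
  applies conditionally on the earlier ones.\<close>

lemma signed_sums_local: "S \<inter> {..window 1000 N l} = S' \<inter> {..window 1000 N l} \<Longrightarrow> signed_sums N l S = signed_sums N l S'"
proof (induction l)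
  case (Suc l)
  have "S \<inter> {..window 1000 N l} = (S \<inter> {..window 1000 N (Suc l)}) \<inter> {..window 1000 N l}"
    "S' \<inter> {..window 1000 N l} = (S' \<inter> {..window 1000 N (Suc l)}) \<inter> {..window 1000 N l}"
    by auto
  then have "signed_sums N l S = signed_sums N l S'" using Suc by simp
  moreover have "S \<inter> {window 1000 N l<..window 1000 N (Suc l)} = (S \<inter> {..window 1000 N (Suc l)}) \<inter> {window 1000 N l<..window 1000 N (Suc l)}"
    "S' \<inter> {window 1000 N l<..window 1000 N (Suc l)} = (S' \<inter> {..window 1000 N (Suc l)}) \<inter> {window 1000 N l<..window 1000 N (Suc l)}"
    by auto
  ultimately show ?case using Suc.prems by simp
qed simp

lemma signed_sums_nonempty: "signed_sums N l S \<noteq> {#}"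
  by (induction l) (auto simp: signed_step_def add_signed_def)

text \<open>Each window contributes at most one element, so absolute values are bounded by a
  geometric series of ratio about 1001/1000. It is about 1001 times its last term; 2000 leaves room
  for rounding.\<close>

lemma signed_sums_elem:
  assumes "10 ^ 6 \<le> N" "h \<in># signed_sums N l S"
  shows "\<bar>h\<bar> \<le> 2000 * int (window 1000 N l)"
    "\<exists>A B. A \<subseteq> S \<inter> {N<..window 1000 N l} \<and> B \<subseteq> S \<inter> {N<..window 1000 N l} \<and> h = int (\<Sum>A) - int (\<Sum>B)"
proof -
  have "\<bar>h\<bar> \<le> 2000 * int (window 1000 N l) \<and>
    (\<exists>A B. A \<subseteq> S \<inter> {N<..window 1000 N l} \<and> B \<subseteq> S \<inter> {N<..window 1000 N l} \<and> h = int (\<Sum>A) - int (\<Sum>B))"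
    using assms(2)
  proof (induction l arbitrary: h)
    case 0
    then show ?case by (auto intro!: exI[of _ "{}"])
  next
    case (Suc l)
    define y where "y = window 1000 N l"
    define y' where "y' = window 1000 N (Suc l)"
    have yN: "N \<le> y" by (simp add: y_def window_ge)
    have y': "y' = y + y div 1000" by (simp add: y_def y'_def)
    \<comment> \<open>The slack \<open>2000 * (y' - y)\<close> between consecutive bounds pays for
      the one new element, which is at most \<open>y'\<close>.\<close>
    have big: "2000 * y + y' \<le> 2000 * y'"
    proof -
      define d m where "d = y div 1000" and "m = y mod 1000"
      have "y = 1000 * d + m" "m < 1000" "y \<ge> 1000000"
        using yN assms(1) by (simp_all add: d_def m_def)
      then have "m \<le> 999 * d" by linarith
      with \<open>y = 1000 * d + m\<close> have "y + d \<le> 2000 * d" by linarith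
      then show ?thesis unfolding y' d_def [symmetric] distrib_left by linarith
    qed
    have old: "\<bar>g\<bar> \<le> 2000 * int y \<and> (\<exists>A B. A \<subseteq> S \<inter> {N<..y} \<and> B \<subseteq> S \<inter> {N<..y} \<and>
        g = int (\<Sum>A) - int (\<Sum>B))" if "g \<in># signed_sums N l S" for g
      using Suc.IH[OF that] by (simp add: y_def)
    have sub: "{N<..y} \<subseteq> {N<..y'}" using y' by auto
    have keep: ?case if hM: "h \<in># signed_sums N l S"
    proof -
      obtain A B where "A \<subseteq> S \<inter> {N<..y}" "B \<subseteq> S \<inter> {N<..y}" "h = int (\<Sum>A) - int (\<Sum>B)"
        using old[OF hM] by blast
      then show ?thesis unfolding y'_def [symmetric]
        using sub old[OF hM] y' by (intro conjI exI[of _ A] exI[of _ B]) auto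
    qed
    show ?case
    proof (cases "\<exists>a. S \<inter> {y<..y'} = {a}")
      case True
      then obtain a where a: "S \<inter> {y<..y'} = {a}" by auto
      then have aS: "a \<in> S" "y < a" "a \<le> y'" by auto
      have "h \<in># add_signed (int a) (signed_sums N l S)"
        using Suc.prems a by (auto simp: signed_step_def y_def y'_def)
      then consider "h \<in># signed_sums N l S" | g where "g \<in># signed_sums N l S" "h = g + int a"
        | g where "g \<in># signed_sums N l S" "h = g - int a" by (auto simp: add_signed_def)
      then show ?thesis
      proof cases
        case 2
        then obtain A B where AB: "A \<subseteq> S \<inter> {N<..y}" "B \<subseteq> S \<inter> {N<..y}"
          "g = int (\<Sum>A) - int (\<Sum>B)" using old by blast
        have "finite A" "a \<notin> A" using AB aS finite_subset[of A "{N<..y}"] by auto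
        then have "h = int (\<Sum>(insert a A)) - int (\<Sum>B)" using AB 2 by simp
        moreover have "insert a A \<subseteq> S \<inter> {N<..y'}" "B \<subseteq> S \<inter> {N<..y'}"
          using AB sub aS yN by auto
        moreover have "\<bar>h\<bar> \<le> 2000 * int y'" using old[OF 2(1)] 2(2) aS big by linarith
        ultimately show ?thesis unfolding y'_def by blast
      next
        case 3
        then obtain A B where AB: "A \<subseteq> S \<inter> {N<..y}" "B \<subseteq> S \<inter> {N<..y}"
          "g = int (\<Sum>A) - int (\<Sum>B)" using old by blast
        have "finite B" "a \<notin> B" using AB aS finite_subset[of B "{N<..y}"] by auto
        then have "h = int (\<Sum>A) - int (\<Sum>(insert a B))" using AB 3 by simp
        moreover have "A \<subseteq> S \<inter> {N<..y'}" "insert a B \<subseteq> S \<inter> {N<..y'}"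
          using AB sub aS yN by auto
        moreover have "\<bar>h\<bar> \<le> 2000 * int y'" using old[OF 3(1)] 3(2) aS big by linarith
        ultimately show ?thesis unfolding y'_def by blast
      qed (rule keep)
    next
      case False
      then show ?thesis using Suc.prems keep by (simp add: signed_step_def y_def y'_def)
    qed
  qed
  then show "\<bar>h\<bar> \<le> 2000 * int (window 1000 N l)"
    "\<exists>A B. A \<subseteq> S \<inter> {N<..window 1000 N l} \<and> B \<subseteq> S \<inter> {N<..window 1000 N l} \<and> h = int (\<Sum>A) - int (\<Sum>B)"
    by auto
qed

definition mean_rate :: "nat \<Rightarrow> nat \<Rightarrow> real" where
  "mean_rate N l = lexp {N<..window 1000 N l} (\<lambda>S. collision_rate (signed_sums N l S) powr (1 / 8))"

lemma mean_rate_Suc: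
  assumes N: "10 ^ 6 \<le> N"
  shows "mean_rate N (Suc l) \<le> (1 - 99 / 100000 * (1 - third_root8)) * mean_rate N l + jump_const * (1 / real (window 1000 N l)) powr (1 / 8)"
proof -
  define y where "y = window 1000 N l"
  define y' where "y' = window 1000 N (Suc l)"
  have yN: "N \<le> y" by (simp add: y_def window_ge)
  have y': "y' = y + y div 1000" by (simp add: y_def y'_def)
  have split: "{N<..y'} = {N<..y} \<union> {y<..y'}" using yN y' by auto
  have "mean_rate N (Suc l) = lexp {N<..y} (\<lambda>S. lexp {y<..y'} (\<lambda>T. collision_rate (signed_sums N (Suc l) (S \<union> T)) powr (1 / 8)))"
    unfolding mean_rate_def y'_def [symmetric] split by (intro lexp_union) auto
  also have "\<dots> = lexp {N<..y} (\<lambda>S. lexp {y<..y'} (\<lambda>T. collision_rate (signed_step (signed_sums N l S) T) powr (1 / 8)))"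
  proof (intro lexp_cong)
    fix S T assume ST: "S \<subseteq> {N<..y}" "T \<subseteq> {y<..y'}"
    have "signed_sums N l (S \<union> T) = signed_sums N l S" using ST by (intro signed_sums_local) (auto simp: y_def)
    moreover have "(S \<union> T) \<inter> {y<..y'} = T" using ST by auto
    ultimately show "collision_rate (signed_sums N (Suc l) (S \<union> T)) powr (1 / 8) = collision_rate (signed_step (signed_sums N l S) T) powr (1 / 8)"
      by (simp add: y_def y'_def)
  qed
  also have "\<dots> \<le> lexp {N<..y} (\<lambda>S. (1 - 99 / 100000 * (1 - third_root8)) * collision_rate (signed_sums N l S) powr (1 / 8) +
      jump_const * (1 / real y) powr (1 / 8))"
    unfolding y' using yN N signed_sums_nonempty by (intro lexp_mono collision_rate_signed_step) auto
  also have "\<dots> = (1 - 99 / 100000 * (1 - third_root8)) * mean_rate N l + jump_const * (1 / real y) powr (1 / 8)"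
    by (simp add: lexp_add lexp_cmult lexp_const mean_rate_def y_def)
  finally show ?thesis by (simp add: y_def)
qed

text \<open>After multiplication by the scale, \<open>mean_rate_Suc\<close> becomes an affine
  recursion with factor \<open>contraction_const\<close> and input at most
  \<open>2 * jump_const\<close>; the last summand is its fixed point.\<close>

lemma mean_rate_bound:
  assumes N: "10 ^ 6 \<le> N"
  shows "mean_rate N l * real (window 1000 N l) powr (1 / 8) \<le> contraction_const ^ l * real N powr (1 / 8) + 2 * jump_const / (1 - contraction_const)"
proof (induction l)
  case 0
  have "collision_rate {#0#} = 1" by (simp add: collision_rate_def collisions_def)
  then have "mean_rate N 0 = 1" by (simp add: mean_rate_def)
  moreover have "2 * jump_const / (1 - contraction_const) \<ge> 0" using contraction_const by (simp add: jump_const_def)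
  ultimately show ?case by simp
next
  case (Suc l)
  define y where "y = real (window 1000 N l)"
  define y' where "y' = real (window 1000 N (Suc l))"
  have y: "y \<ge> 10 ^ 6"
    using N window_ge[of N 1000 l] unfolding y_def by (simp add: order_trans)
  have "1000 * (window 1000 N l div 1000) \<le> window 1000 N l" by simp
  then have "1000 * real (window 1000 N l div 1000) \<le> real (window 1000 N l)" by linarith
  then have le: "y' \<le> 1001 / 1000 * y" by (simp add: y_def y'_def)
  have "y' powr (1 / 8) \<le> (1001 / 1000 * y) powr (1 / 8)"
    using le by (intro powr_mono2) (auto simp: y'_def)
  also have "\<dots> = (1001 / 1000) powr (1 / 8) * y powr (1 / 8)"
    using y by (subst powr_mult) auto
  finally have le': "y' powr (1 / 8) \<le> (1001 / 1000) powr (1 / 8) * y powr (1 / 8)" .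
  have F0: "mean_rate N l \<ge> 0" unfolding mean_rate_def by (intro lexp_nonneg) auto
  have K: "jump_const \<ge> 0" by (simp add: jump_const_def)
  have c0: "1 - 99 / 100000 * (1 - third_root8) \<ge> 0" using third_root8_nonneg by auto
  have "mean_rate N (Suc l) * y' powr (1 / 8) \<le>
     ((1 - 99 / 100000 * (1 - third_root8)) * mean_rate N l + jump_const * (1 / y) powr (1 / 8)) *
     ((1001 / 1000) powr (1 / 8) * y powr (1 / 8))"
    using mean_rate_Suc[OF N, of l] le' F0 K c0 unfolding y_def [symmetric]
    by (intro mult_mono add_nonneg_nonneg) (auto simp: mean_rate_def intro!: lexp_nonneg)
  also have "\<dots> = contraction_const * (mean_rate N l * y powr (1 / 8)) +
      jump_const * (1001 / 1000) powr (1 / 8) * ((1 / y) powr (1 / 8) * y powr (1 / 8))"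
    by (simp add: contraction_const_def algebra_simps)
  also have "(1 / y) powr (1 / 8) * y powr (1 / 8) = 1"
    using y by (subst powr_mult [symmetric]) auto
  also have "contraction_const * (mean_rate N l * y powr (1 / 8)) + jump_const * (1001 / 1000) powr (1 / 8) * 1 \<le>
      contraction_const * (contraction_const ^ l * real N powr (1 / 8) + 2 * jump_const / (1 - contraction_const)) + jump_const * 2 * 1"
    using Suc.IH contraction_const K powr_1001_le unfolding y_def
    by (intro add_mono mult_left_mono mult_right_mono) auto
  also have "\<dots> = contraction_const ^ Suc l * real N powr (1 / 8) + 2 * jump_const / (1 - contraction_const)"
    using contraction_const by (simp add: field_simps)
  finally show ?case by (simp only: y'_def)
qed

text \<open>The 2 comes from Markov's inequality at level 1/2, the 1 bounds the forgotten initial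
  term, and the power 8 undoes the exponent 1/8.\<close>

definition spread_const :: real where "spread_const = (2 * (1 + 2 * jump_const / (1 - contraction_const))) powr 8"

lemma spread_const_pos: "spread_const > 0"
proof -
  have "2 * jump_const / (1 - contraction_const) \<ge> 0" using contraction_const by (simp add: jump_const_def)
  then show ?thesis unfolding spread_const_def by simp
qed

text \<open>The number of windows is taken so large that the initial term is below 1. Markov's
  inequality then bounds the collision rate by \<open>spread_const / y\<close>, and
  \<open>size_squared_le\<close> converts this into many distinct values.\<close>

lemma many_signed_sums:
  assumes N: "10 ^ 6 \<le> N"
  obtains l where "lprob {N<..window 1000 N l} (\<lambda>S. real (card (set_mset (signed_sums N l S))) \<ge> real (window 1000 N l) / spread_const) \<ge> 1 / 2"
proof -
  define K where "K = 1 + 2 * jump_const / (1 - contraction_const)"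
  have "2 * jump_const / (1 - contraction_const) \<ge> 0" using contraction_const by (simp add: jump_const_def)
  then have K: "K \<ge> 1" by (simp add: K_def)
  have N0: "real N powr (1 / 8) > 0" using N by simp
  obtain l where l: "contraction_const ^ l < 1 / real N powr (1 / 8)"
    using real_arch_pow_inv[of "1 / real N powr (1 / 8)" contraction_const] contraction_const N0 by auto
  define y where "y = real (window 1000 N l)"
  have y: "y > 0" using window_ge[of N 1000 l] N by (simp add: y_def)
  have "mean_rate N l * y powr (1 / 8) \<le> K"
    using mean_rate_bound[OF N, of l] l N0 by (simp add: K_def y_def field_simps)
  then have F: "mean_rate N l \<le> K / y powr (1 / 8)" using y by (simp add: field_simps)
  let ?t = "2 * K / y powr (1 / 8)"
  have t: "?t > 0" using K y by simp
  let ?h = "\<lambda>S. collision_rate (signed_sums N l S) powr (1 / 8)"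
  have "lprob {N<..window 1000 N l} (\<lambda>S. ?h S \<ge> ?t) \<le> mean_rate N l / ?t"
    unfolding mean_rate_def using t by (intro lprob_markov) auto
  also have "\<dots> \<le> (K / y powr (1 / 8)) / ?t" using F t by (intro divide_right_mono) auto
  also have "\<dots> = 1 / 2" using K y by simp
  finally have "lprob {N<..window 1000 N l} (\<lambda>S. \<not> ?h S \<ge> ?t) \<ge> 1 / 2"
    by (subst lprob_compl) auto
  also have "lprob {N<..window 1000 N l} (\<lambda>S. \<not> ?h S \<ge> ?t) \<le>
      lprob {N<..window 1000 N l} (\<lambda>S. real (card (set_mset (signed_sums N l S))) \<ge> y / spread_const)"
  proof (intro lprob_mono)
    fix S assume "\<not> ?h S \<ge> ?t"
    define M where "M = signed_sums N l S"
    have M: "M \<noteq> {#}" by (simp add: M_def signed_sums_nonempty)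
    have Q: "collision_rate M > 0" using M by (rule collision_rate_pos)
    have "(collision_rate M powr (1 / 8)) powr 8 < ?t powr 8"
      using \<open>\<not> ?h S \<ge> ?t\<close> by (intro powr_less_mono2) (auto simp: M_def)
    then have "collision_rate M < (2 * K) powr 8 / y"
      using Q K y powr_powr[of "collision_rate M" "1 / 8" 8] powr_powr[of y "1 / 8" 8]
      by (simp add: powr_divide)
    then have "collision_rate M < spread_const / y" by (simp add: spread_const_def K_def)
    then have "collisions M 0 * y < spread_const * real (size M) ^ 2"
      using y M by (simp add: collision_rate_def field_simps)
    also have "\<dots> \<le> spread_const * (real (card (set_mset M)) * collisions M 0)"
      using spread_const_pos size_squared_le[of M] by (intro mult_left_mono) auto
    finally have "y < spread_const * real (card (set_mset M))"
      using collisions_0_pos[OF M] by (simp add: mult_ac)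
    then show "real (card (set_mset (signed_sums N l S))) \<ge> y / spread_const"
      using spread_const_pos by (simp add: M_def field_simps)
  qed
  finally show ?thesis using that by (simp add: y_def)
qed

section \<open>Two equal sums with positive probability\<close>

lemma lprob_hit:
  assumes "X \<subseteq> {1..m}" "finite I" "X \<subseteq> I" "m \<ge> 1"
  shows "lprob I (\<lambda>S. S \<inter> X \<noteq> {}) \<ge> 1 - exp (- (real (card X) / real m))"
proof -
  have fX: "finite X" using assms finite_subset by auto
  have "(\<Prod>i\<in>X. 1 - 1 / real i) \<le> (\<Prod>i\<in>X. exp (- (1 / real m)))"
  proof (intro prod_mono conjI)
    fix i assume "i \<in> X"
    then have i: "1 \<le> i" "i \<le> m" using assms by auto
    then show "0 \<le> 1 - 1 / real i" by simp
    have "1 - 1 / real i \<le> 1 - 1 / real m" using i by (simp add: frac_le)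
    also have "\<dots> \<le> exp (- (1 / real m))" using exp_ge_add_one_self[of "- (1 / real m)"] by simp
    finally show "1 - 1 / real i \<le> exp (- (1 / real m))" .
  qed
  also have "\<dots> = exp (- (real (card X) / real m))"
    by (simp add: exp_of_nat_mult [symmetric])
  finally show ?thesis using assms by (subst lprob_compl) (auto simp: lprob_avoid)
qed

lemma lprob_superset:
  assumes "finite J" "I \<subseteq> J" "\<And>S T. P S \<Longrightarrow> S \<subseteq> T \<Longrightarrow> P T"
  shows "lprob I P \<le> lprob J P"
proof -
  have "lprob I P = lprob J (\<lambda>S. P (S \<inter> I))" using assms by (simp add: lprob_restrict)
  also have "\<dots> \<le> lprob J P" by (rule lprob_mono) (use assms(3) in blast)
  finally show ?thesis .
qed

lemma lexp_cmult_right: "lexp I (\<lambda>S. h S * c) = lexp I h * c"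
  unfolding lexp_def by (simp add: sum_distrib_left mult_ac)

text \<open>A signed sum h of the small elements turns into a relation \<open>b + d + h = c\<close> between sums
  of distinct elements; the disjoint ranges of b, d and c keep the choices independent.\<close>

lemma pair_prob:
  "\<exists>\<delta>>0. \<delta> \<le> 1 \<and> (\<forall>N. \<exists>M\<ge>N. lprob {N<..M} (has_equal_sums 2) \<ge> \<delta>)"
proof -
  \<comment> \<open>\<open>24000 = 12 * 2000\<close>: at least \<open>y / spread_const\<close>
    targets lie below \<open>12 * u\<close>, where \<open>u = 2000 * y\<close>. In \<delta> the
    factors 1/2, 1/5 and 1/6 are the chances of many signed sums, of some b and of some d.\<close>
  define \<delta>0 where "\<delta>0 = 1 - exp (- (1 / (24000 * spread_const)))"
  define \<delta> where "\<delta> = \<delta>0 * (1 / 6 * (1 / 5 * (1 / 2)))"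
  have \<delta>0: "\<delta>0 > 0" "\<delta>0 \<le> 1" using spread_const_pos by (auto simp: \<delta>0_def)
  have main: "\<exists>M\<ge>N. lprob {N<..M} (has_equal_sums 2) \<ge> \<delta>" if N: "10 ^ 6 \<le> N" for N
  proof -
    obtain l where l: "lprob {N<..window 1000 N l} (\<lambda>S. real (card (set_mset (signed_sums N l S))) \<ge> real (window 1000 N l) / spread_const) \<ge> 1 / 2"
      using many_signed_sums[OF N] by blast
    define y where "y = window 1000 N l"
    define u where "u = 2000 * y"
    have y: "y \<ge> N" "y \<ge> 1" using window_ge[of N 1000 l] N by (auto simp: y_def)
    define I where "I = {N<..y}"
    \<comment> \<open>\<open>b + d\<close> lies in \<open>{9 * u<..11 * u}\<close> and
      \<open>\<bar>h\<bar> \<le> u\<close>, so \<open>b + d + h\<close> falls into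
      \<open>IC\<close>. Two summands push the target clear of their own ranges; with b alone,
      \<open>h = 0\<close> would give the trivial relation \<open>c = b\<close>.\<close>
    define IB where "IB = {4 * u<..5 * u}"
    define ID where "ID = {5 * u<..6 * u}"
    define IC where "IC = {8 * u<..12 * u}"
    have fin: "finite I" "finite IB" "finite ID" "finite IC"
      by (auto simp: I_def IB_def ID_def IC_def)
    have disj: "I \<inter> IB = {}" "(I \<union> IB) \<inter> ID = {}" "(I \<union> IB \<union> ID) \<inter> IC = {}"
      by (auto simp: I_def IB_def ID_def IC_def u_def)
    let ?P0 = "\<lambda>S. real (card (set_mset (signed_sums N l S))) \<ge> real y / spread_const"
    let ?P1 = "\<lambda>S. ?P0 (S \<inter> I) \<and> S \<inter> IB \<noteq> {}"
    let ?P2 = "\<lambda>S. ?P1 (S \<inter> (I \<union> IB)) \<and> S \<inter> ID \<noteq> {}"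
    have hitB: "lprob IB (\<lambda>T. T \<inter> IB \<noteq> {}) = 1 / 5"
      using fin y by (subst lprob_compl) (auto simp: lprob_avoid IB_def prod_one_minus_inverse u_def)
    have hitD: "lprob ID (\<lambda>T. T \<inter> ID \<noteq> {}) = 1 / 6"
      using fin y by (subst lprob_compl) (auto simp: lprob_avoid ID_def prod_one_minus_inverse u_def)
    have s1: "1 / 5 * lprob I ?P0 \<le> lprob (I \<union> IB) ?P1"
    proof (rule lprob_union_ge)
      fix S assume S: "S \<subseteq> I" "?P0 S"
      have "1 / 5 \<le> lprob IB (\<lambda>T. T \<inter> IB \<noteq> {})" using hitB by simp
      also have "\<dots> \<le> lprob IB (\<lambda>T. ?P1 (S \<union> T))"
      proof (intro lprob_mono)
        fix T assume "T \<subseteq> IB" "T \<inter> IB \<noteq> {}"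
        moreover from this S have "(S \<union> T) \<inter> I = S" using disj by auto
        ultimately show "?P1 (S \<union> T)" using S by auto
      qed
      finally show "1 / 5 \<le> lprob IB (\<lambda>T. ?P1 (S \<union> T))" .
    qed (use fin disj in auto)
    have s2: "1 / 6 * lprob (I \<union> IB) ?P1 \<le> lprob (I \<union> IB \<union> ID) ?P2"
    proof (rule lprob_union_ge)
      fix S assume S: "S \<subseteq> I \<union> IB" "?P1 S"
      have "1 / 6 \<le> lprob ID (\<lambda>T. T \<inter> ID \<noteq> {})" using hitD by simp
      also have "\<dots> \<le> lprob ID (\<lambda>T. ?P2 (S \<union> T))"
      proof (intro lprob_mono)
        fix T assume "T \<subseteq> ID" "T \<inter> ID \<noteq> {}"
        moreover from this S have "(S \<union> T) \<inter> (I \<union> IB) = S" using disj by auto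
        ultimately show "?P2 (S \<union> T)" using S by auto
      qed
      finally show "1 / 6 \<le> lprob ID (\<lambda>T. ?P2 (S \<union> T))" .
    qed (use fin disj in auto)
    have s3: "\<delta>0 * lprob (I \<union> IB \<union> ID) ?P2 \<le> lprob (I \<union> IB \<union> ID \<union> IC) (has_equal_sums 2)"
    proof (rule lprob_union_ge)
      fix S assume S: "S \<subseteq> I \<union> IB \<union> ID" "?P2 S"
      define S0 where "S0 = S \<inter> I"
      have "S \<inter> (I \<union> IB) \<inter> I = S0" by (auto simp: S0_def)
      then have c0: "real (card (set_mset (signed_sums N l S0))) \<ge> real y / spread_const" using S by auto
      from S obtain b d where b: "b \<in> S" "b \<in> IB" and d: "d \<in> S" "d \<in> ID" by blast
      define X where "X = (\<lambda>h. nat (int b + int d + h)) ` set_mset (signed_sums N l S0)"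
      have bd: "4 * u < b" "b \<le> 5 * u" "5 * u < d" "d \<le> 6 * u" using b d by (auto simp: IB_def ID_def)
      have hb: "\<bar>h\<bar> \<le> int u" if "h \<in># signed_sums N l S0" for h
        using signed_sums_elem(1)[OF N that] by (simp add: u_def y_def)
      have "inj_on (\<lambda>h. nat (int b + int d + h)) (set_mset (signed_sums N l S0))"
      proof (rule inj_onI)
        fix h h' assume "h \<in># signed_sums N l S0" "h' \<in># signed_sums N l S0"
          "nat (int b + int d + h) = nat (int b + int d + h')"
        then show "h = h'" using hb[of h] hb[of h'] bd by linarith
      qed
      then have cX: "card X = card (set_mset (signed_sums N l S0))" by (simp add: X_def card_image)
      have XIC: "X \<subseteq> IC"
      proof
        fix x assume "x \<in> X"
        then obtain h where h: "h \<in># signed_sums N l S0" "x = nat (int b + int d + h)" by (auto simp: X_def)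
        then show "x \<in> IC" using hb[OF h(1)] bd by (auto simp: IC_def)
      qed
      have "\<delta>0 \<le> 1 - exp (- (real (card X) / real (12 * u)))"
      proof -
        have "1 / (24000 * spread_const) = (real y / spread_const) / real (12 * u)"
          using y by (simp add: u_def)
        also have "\<dots> \<le> real (card X) / real (12 * u)"
          using c0 cX by (intro divide_right_mono) auto
        finally show ?thesis by (simp add: \<delta>0_def)
      qed
      also have "\<dots> \<le> lprob IC (\<lambda>T. T \<inter> X \<noteq> {})"
        using XIC fin y by (intro lprob_hit) (auto simp: IC_def u_def)
      also have "\<dots> \<le> lprob IC (\<lambda>T. has_equal_sums 2 (S \<union> T))"
      proof (intro lprob_mono)
        fix T assume T: "T \<subseteq> IC" "T \<inter> X \<noteq> {}"
        then obtain c where c: "c \<in> T" "c \<in> X" by auto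
        then obtain h where h: "h \<in># signed_sums N l S0" "c = nat (int b + int d + h)" by (auto simp: X_def)
        obtain A B where AB: "A \<subseteq> S0 \<inter> {N<..y}" "B \<subseteq> S0 \<inter> {N<..y}" "h = int (\<Sum>A) - int (\<Sum>B)"
          using signed_sums_elem(2)[OF N h(1)] by (auto simp: y_def)
        have AB': "finite A" "finite B" "A \<subseteq> I" "B \<subseteq> I" "A \<subseteq> S" "B \<subseteq> S"
          using AB finite_subset[of _ "{N<..y}"] by (auto simp: I_def S0_def)
        have cI: "c \<in> IC" using c T by auto
        have nin: "b \<notin> A" "d \<notin> A" "c \<notin> A" "c \<notin> B" "b \<noteq> d" "c \<noteq> b" "c \<noteq> d"
          using AB' b d cI disj by auto
        have "int c = int b + int d + h" using h hb[OF h(1)] bd by auto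
        then have eq: "b + d + \<Sum>A = c + \<Sum>B" using AB(3) by linarith
        show "has_equal_sums 2 (S \<union> T)"
        proof (rule has_equal_sumsI[of "{insert b (insert d A), insert c B}" _ "c + \<Sum>B"])
          \<comment> \<open>The sets differ because c exceeds b, d and all of A; A and B may
            overlap.\<close>
          have "insert b (insert d A) \<noteq> insert c B" using nin by blast
          then show "2 \<le> card {insert b (insert d A), insert c B}" by simp
          show "{insert b (insert d A), insert c B} \<subseteq> Pow (S \<union> T)" using AB' b d c by auto
        qed (use eq nin AB' in auto)
      qed
      finally show "\<delta>0 \<le> lprob IC (\<lambda>T. has_equal_sums 2 (S \<union> T))" .
    qed (use fin disj \<delta>0 in auto)
    have "\<delta> \<le> \<delta>0 * (1 / 6 * (1 / 5 * lprob I ?P0))"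
      unfolding \<delta>_def using l \<delta>0 by (intro mult_left_mono) (auto simp: y_def I_def)
    also have "\<dots> \<le> \<delta>0 * (1 / 6 * lprob (I \<union> IB) ?P1)"
      using s1 \<delta>0 by (intro mult_left_mono) auto
    also have "\<dots> \<le> \<delta>0 * lprob (I \<union> IB \<union> ID) ?P2"
      using s2 \<delta>0 by (intro mult_left_mono) auto
    also have "\<dots> \<le> lprob (I \<union> IB \<union> ID \<union> IC) (has_equal_sums 2)" by (rule s3)
    also have "\<dots> \<le> lprob {N<..12 * u} (has_equal_sums 2)"
      using y by (intro lprob_superset)
        (auto simp: I_def IB_def ID_def IC_def u_def intro: has_equal_sums_mono)
    finally show ?thesis using y by (intro exI[of _ "12 * u"]) (auto simp: u_def)
  qed
  show ?thesis
  proof (intro exI[of _ \<delta>] conjI allI)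
    fix N
    obtain M where M: "M \<ge> max N (10 ^ 6)" "lprob {max N (10 ^ 6)<..M} (has_equal_sums 2) \<ge> \<delta>"
      using main[of "max N (10 ^ 6)"] by auto
    moreover have "lprob {max N (10 ^ 6)<..M} (has_equal_sums 2) \<le> lprob {N<..M} (has_equal_sums 2)"
      by (intro lprob_superset) (auto intro: has_equal_sums_mono)
    ultimately show "\<exists>M\<ge>N. lprob {N<..M} (has_equal_sums 2) \<ge> \<delta>"
      by (intro exI[of _ M]) auto
  qed (use \<delta>0 in \<open>auto simp: \<delta>_def\<close>)
qed

section \<open>Amplification to probability near 1 and to many equal sums\<close>

text \<open>Failures on successive disjoint ranges multiply, so n ranges all fail with probability
  at most \<open>(1 - \<delta>) ^ n\<close>. Each range starts where the previous one ends.\<close>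

lemma lprob_pair_near_1:
  assumes "\<eta> > 0"
  shows "\<exists>M\<ge>N. lprob {N<..M} (has_equal_sums 2) \<ge> 1 - \<eta>"
proof -
  obtain \<delta> where \<delta>: "\<delta> > 0" "\<delta> \<le> 1" "\<And>N. \<exists>M\<ge>N. lprob {N<..M} (has_equal_sums 2) \<ge> \<delta>"
    using pair_prob by blast
  have *: "\<exists>M\<ge>N. lprob {N<..M} (\<lambda>S. \<not> has_equal_sums 2 S) \<le> (1 - \<delta>) ^ n" for n
  proof (induction n)
    case 0
    show ?case by (intro exI[of _ N]) (auto simp: lprob_def)
  next
    case (Suc n)
    then obtain M where M: "M \<ge> N" "lprob {N<..M} (\<lambda>S. \<not> has_equal_sums 2 S) \<le> (1 - \<delta>) ^ n" by auto
    obtain M' where M': "M' \<ge> M" "lprob {M<..M'} (has_equal_sums 2) \<ge> \<delta>" using \<delta> by blast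
    have "lprob {N<..M'} (\<lambda>S. \<not> has_equal_sums 2 S) =
      lexp ({N<..M} \<union> {M<..M'}) (\<lambda>S. of_bool (\<not> has_equal_sums 2 S))"
      using M M' by (simp add: lprob_def ivl_disj_un)
    also have "\<dots> = lexp {N<..M} (\<lambda>S. lexp {M<..M'} (\<lambda>T. of_bool (\<not> has_equal_sums 2 (S \<union> T))))"
      by (intro lexp_union) auto
    also have "\<dots> \<le> lexp {N<..M} (\<lambda>S. lexp {M<..M'} (\<lambda>T. of_bool (\<not> has_equal_sums 2 S) *
        of_bool (\<not> has_equal_sums 2 T)))"
    proof (intro lexp_mono)
      fix S T :: "nat set"
      have "has_equal_sums 2 S \<or> has_equal_sums 2 T \<Longrightarrow> has_equal_sums 2 (S \<union> T)"
        using has_equal_sums_mono[of 2 S "S \<union> T" 2] has_equal_sums_mono[of 2 T "S \<union> T" 2] by auto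
      then show "of_bool (\<not> has_equal_sums 2 (S \<union> T)) \<le>
        of_bool (\<not> has_equal_sums 2 S) * (of_bool (\<not> has_equal_sums 2 T) :: real)" by auto
    qed
    also have "\<dots> = lprob {N<..M} (\<lambda>S. \<not> has_equal_sums 2 S) * lprob {M<..M'} (\<lambda>S. \<not> has_equal_sums 2 S)"
      by (simp only: lexp_cmult lexp_cmult_right lprob_def)
    also have "\<dots> \<le> (1 - \<delta>) ^ n * (1 - \<delta>)"
      using M M' \<delta> by (intro mult_mono lprob_nonneg) (auto simp: lprob_compl)
    finally show ?case using M M' by (intro exI[of _ M']) (auto simp: mult.commute)
  qed
  obtain n where "(1 - \<delta>) ^ n < \<eta>"
    using real_arch_pow_inv[of \<eta> "1 - \<delta>"] \<delta> assms by auto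
  moreover obtain M where "M \<ge> N" "lprob {N<..M} (\<lambda>S. \<not> has_equal_sums 2 S) \<le> (1 - \<delta>) ^ n"
    using * by blast
  ultimately show ?thesis by (intro exI[of _ M]) (auto simp: lprob_compl)
qed

text \<open>A further range with a pair doubles the multiplicity; the two ranges share the error
  \<eta> equally.\<close>

lemma lprob_equal_sums_near_1:
  assumes "\<eta> > 0"
  shows "\<exists>M\<ge>N. lprob {N<..M} (has_equal_sums (2 ^ m)) \<ge> 1 - \<eta>"
  using assms
proof (induction m arbitrary: N \<eta>)
  case 0
  then show ?case by (intro exI[of _ N]) (auto simp: has_equal_sums_1 lprob_def)
next
  case (Suc m)
  obtain M where M: "M \<ge> N" "lprob {N<..M} (has_equal_sums (2 ^ m)) \<ge> 1 - \<eta> / 2"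
    using Suc.IH[of "\<eta> / 2"] Suc.prems by auto
  obtain M' where M': "M' \<ge> M" "lprob {M<..M'} (has_equal_sums 2) \<ge> 1 - \<eta> / 2"
    using lprob_pair_near_1[of "\<eta> / 2"] Suc.prems by auto
  have "lprob {N<..M'} (\<lambda>S. \<not> has_equal_sums (2 ^ Suc m) S) \<le>
    lprob {N<..M'} (\<lambda>S. \<not> has_equal_sums (2 ^ m) (S \<inter> {N<..M}) \<or>
      \<not> has_equal_sums 2 (S \<inter> {M<..M'}))"
  proof (intro lprob_mono)
    fix S assume "S \<subseteq> {N<..M'}" "\<not> has_equal_sums (2 ^ Suc m) S"
    moreover have "S = (S \<inter> {N<..M}) \<union> (S \<inter> {M<..M'})" if "S \<subseteq> {N<..M'}"
      using that by auto
    ultimately show "\<not> has_equal_sums (2 ^ m) (S \<inter> {N<..M}) \<or> \<not> has_equal_sums 2 (S \<inter> {M<..M'})"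
      using has_equal_sums_Un[of "2 ^ m" "S \<inter> {N<..M}" 2 "S \<inter> {M<..M'}"]
      by (auto simp: mult.commute disjoint_iff)
  qed
  also have "\<dots> \<le> lprob {N<..M'} (\<lambda>S. \<not> has_equal_sums (2 ^ m) (S \<inter> {N<..M})) +
      lprob {N<..M'} (\<lambda>S. \<not> has_equal_sums 2 (S \<inter> {M<..M'}))" by (rule lprob_disj)
  also have "\<dots> = lprob {N<..M} (\<lambda>S. \<not> has_equal_sums (2 ^ m) S) +
      lprob {M<..M'} (\<lambda>S. \<not> has_equal_sums 2 S)"
    using M M' lprob_restrict[of "{N<..M'}" "{N<..M}" "\<lambda>S. \<not> has_equal_sums (2 ^ m) S"]
      lprob_restrict[of "{N<..M'}" "{M<..M'}" "\<lambda>S. \<not> has_equal_sums 2 S"]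
    by (simp add: subset_iff)
  also have "\<dots> \<le> \<eta>" using M M' by (simp add: lprob_compl)
  finally show ?case using M M' by (intro exI[of _ M']) (auto simp: lprob_compl)
qed

text \<open>For \<open>c = 0\<close> the lower end of the block stays at 1, so a fixed good range
  eventually lies inside. \<open>2 ^ k\<close> serves as a power of 2 above k.\<close>

lemma equal_sums_prob_0_tendsto: "(equal_sums_prob k 0 \<longlongrightarrow> 1) at_top"
proof (rule order_tendstoI)
  fix a :: real assume "a < 1"
  obtain M where M: "lprob {0<..M} (has_equal_sums (2 ^ k)) \<ge> 1 - (1 - a) / 2"
    using lprob_equal_sums_near_1[of "(1 - a) / 2" 0 k] \<open>a < 1\<close> by auto
  show "eventually (\<lambda>D. a < equal_sums_prob k 0 D) at_top"
    using eventually_ge_at_top[of "real (max 1 M)"]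
  proof eventually_elim
    case (elim D)
    let ?I = "{a. 1 \<le> a \<and> D powr 0 \<le> real a \<and> real a \<le> D}"
    have "finite ?I" by (rule finite_subset[of _ "{..nat \<lceil>D\<rceil>}"]) (auto simp: le_nat_iff, linarith)
    have "a < 1 - (1 - a) / 2" using \<open>a < 1\<close> by (simp add: field_simps)
    also have "\<dots> \<le> lprob {0<..M} (has_equal_sums (2 ^ k))" by (rule M)
    also have "\<dots> \<le> lprob ?I (has_equal_sums (2 ^ k))"
      using \<open>finite ?I\<close> elim by (intro lprob_superset) (auto intro: has_equal_sums_mono)
    also have "\<dots> \<le> lprob ?I (has_equal_sums k)"
      by (intro lprob_mono) (auto intro: has_equal_sums_mono less_imp_le less_exp)
    finally show ?case by (simp only: equal_sums_prob_eq)
  qed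
next
  fix a :: real assume "a > 1"
  show "eventually (\<lambda>D. equal_sums_prob k 0 D < a) at_top"
  proof (rule always_eventually, rule allI)
    fix D :: real
    have "finite {a. 1 \<le> a \<and> D powr 0 \<le> real a \<and> real a \<le> D}"
      by (rule finite_subset[of _ "{..nat \<lceil>D\<rceil>}"]) (auto simp: le_nat_iff, linarith)
    then show "equal_sums_prob k 0 D < a"
      using lprob_le_1[of _ "has_equal_sums k"] \<open>a > 1\<close> unfolding equal_sums_prob_eq
      by (meson le_less_trans)
  qed
qed

section \<open>Multiplicities of subset sums\<close>

text \<open>Targets are integers so that \<open>z - int a\<close> is not truncated when an element
  is removed.\<close>

definition repr_count :: "nat set \<Rightarrow> int \<Rightarrow> nat" where
  "repr_count S z = card {X \<in> Pow S. int (\<Sum>X) = z}"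

definition subset_sums :: "nat set \<Rightarrow> int set" where
  "subset_sums S = (\<lambda>X. int (\<Sum>X)) ` Pow S"

text \<open>For positive q and finite S, the number of q-tuples of subsets with a common
  sum.\<close>

definition sum_moment :: "nat \<Rightarrow> nat set \<Rightarrow> real" where
  "sum_moment q S = (\<Sum>z\<in>subset_sums S. real (repr_count S z) ^ q)"

definition max_mult :: "nat set \<Rightarrow> nat" where
  "max_mult S = Max (repr_count S ` subset_sums S)"

lemma finite_subset_sums: "finite S \<Longrightarrow> finite (subset_sums S)"
  by (simp add: subset_sums_def)

lemma subset_sums_nonempty: "subset_sums S \<noteq> {}"
  by (auto simp: subset_sums_def)

lemma card_subset_sums_le: "finite S \<Longrightarrow> card (subset_sums S) \<le> 2 ^ card S"
  unfolding subset_sums_def using card_image_le[of "Pow S"] by (simp add: card_Pow)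

lemma repr_count_eq_0_iff: "finite S \<Longrightarrow> repr_count S z = 0 \<longleftrightarrow> z \<notin> subset_sums S"
  by (auto simp: repr_count_def subset_sums_def)

lemma repr_count_le_max_mult: "finite S \<Longrightarrow> repr_count S z \<le> max_mult S"
  unfolding max_mult_def using repr_count_eq_0_iff[of S z]
  by (cases "z \<in> subset_sums S") (auto intro!: Max_ge simp: finite_subset_sums)

lemma max_mult_attained: "finite S \<Longrightarrow> \<exists>z. repr_count S z = max_mult S"
  using Max_in[of "repr_count S ` subset_sums S"] subset_sums_nonempty finite_subset_sums by (fastforce simp: max_mult_def)

lemma max_mult_pos: "finite S \<Longrightarrow> max_mult S \<ge> 1"
  using repr_count_le_max_mult[of S 0] repr_count_eq_0_iff[of S 0] by (force simp: subset_sums_def)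

lemma max_mult_mono: "S \<subseteq> T \<Longrightarrow> finite T \<Longrightarrow> max_mult S \<le> max_mult T"
proof -
  assume ST: "S \<subseteq> T" "finite T"
  then have "finite S" using finite_subset by auto
  then obtain z where "repr_count S z = max_mult S" using max_mult_attained by blast
  moreover have "repr_count S z \<le> repr_count T z" unfolding repr_count_def using ST by (intro card_mono) auto
  ultimately show ?thesis using repr_count_le_max_mult[OF ST(2), of z] by simp
qed

lemma max_mult_empty: "max_mult {} = 1"
proof -
  have "{X. X = {} \<and> int (\<Sum>X) = 0} = {{}}" by auto
  then show ?thesis by (simp add: max_mult_def subset_sums_def repr_count_def)
qed

lemma has_equal_sums_le_max_mult:
  assumes "finite S" "has_equal_sums k S"
  shows "k \<le> max_mult S"
proof -
  obtain F s where F: "finite F" "F \<subseteq> Pow S" "\<And>X. X \<in> F \<Longrightarrow> \<Sum>X = s" "card F = k"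
    using has_equal_sumsE[OF assms(2)] by blast
  have "k \<le> repr_count S (int s)"
    unfolding repr_count_def F(4)[symmetric] using F assms
    by (intro card_mono) (auto simp del: of_nat_sum)
  then show ?thesis using repr_count_le_max_mult[OF assms(1), of "int s"] by simp
qed

lemma repr_count_insert:
  assumes "finite S" "a \<notin> S"
  shows "repr_count (insert a S) z = repr_count S z + repr_count S (z - int a)"
proof -
  let ?A = "{X \<in> Pow S. int (\<Sum>X) = z}"
  let ?B = "{X \<in> Pow S. int (\<Sum>X) = z - int a}"
  have sum: "\<Sum>(insert a X) = a + \<Sum>X" if "X \<subseteq> S" for X
    using that assms finite_subset[of X S] by (subst sum.insert) auto
  have eq: "{X \<in> Pow (insert a S). int (\<Sum>X) = z} = ?A \<union> insert a ` ?B"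
  proof (intro equalityI subsetI)
    fix X assume X: "X \<in> {X \<in> Pow (insert a S). int (\<Sum>X) = z}"
    show "X \<in> ?A \<union> insert a ` ?B"
    proof (cases "a \<in> X")
      case True
      then have "X = insert a (X - {a})" "X - {a} \<subseteq> S" using X by auto
      then have "X - {a} \<in> ?B" using X sum[of "X - {a}"] by (auto simp del: of_nat_sum)
      then show ?thesis using \<open>X = insert a (X - {a})\<close> by blast
    qed (use X in auto)
  next
    fix X assume "X \<in> ?A \<union> insert a ` ?B"
    then show "X \<in> {X \<in> Pow (insert a S). int (\<Sum>X) = z}"
      using sum by (auto simp del: of_nat_sum)
  qed
  have "inj_on (insert a) ?B" using assms by (auto intro!: inj_onI simp: insert_ident subset_iff)
  moreover have "?A \<inter> insert a ` ?B = {}" using assms by auto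
  ultimately show ?thesis
    unfolding repr_count_def eq using assms by (subst card_Un_disjoint) (auto simp: card_image)
qed

lemma sum_moment_1: "finite S \<Longrightarrow> sum_moment 1 S = 2 ^ card S"
proof -
  assume "finite S"
  have "(\<Sum>z\<in>subset_sums S. \<Sum>X\<in>{X \<in> Pow S. int (\<Sum>X) = z}. 1) = (\<Sum>X\<in>Pow S. (1::nat))"
    unfolding subset_sums_def by (rule sum.group) (use \<open>finite S\<close> in auto)
  then have "(\<Sum>z\<in>subset_sums S. repr_count S z) = 2 ^ card S"
    using \<open>finite S\<close> by (simp add: repr_count_def card_Pow)
  then have "real (\<Sum>z\<in>subset_sums S. repr_count S z) = 2 ^ card S" by simp
  then show ?thesis by (simp add: sum_moment_def)
qed

lemma sum_moment_nonneg: "sum_moment q S \<ge> 0"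
  by (simp add: sum_moment_def sum_nonneg)

text \<open>Together with \<open>max_mult_power_le\<close> this ties the moment to powers of the
  maximum, up to a factor \<open>2 ^ card S\<close>. With q comparable to \<open>card S\<close>, a
  q-th root makes this factor a constant.\<close>

lemma sum_moment_le: "finite S \<Longrightarrow> sum_moment (Suc q) S \<le> real (max_mult S) ^ q * 2 ^ card S"
proof -
  assume S: "finite S"
  have "sum_moment (Suc q) S \<le> (\<Sum>z\<in>subset_sums S. real (max_mult S) ^ q * real (repr_count S z) ^ 1)"
    unfolding sum_moment_def using repr_count_le_max_mult[OF S]
    by (intro sum_mono) (auto simp: mult.commute intro!: mult_left_mono power_mono)
  also have "\<dots> = real (max_mult S) ^ q * sum_moment 1 S" by (simp only: sum_moment_def sum_distrib_left)
  finally show ?thesis using sum_moment_1[OF S] by simp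
qed

lemma max_mult_power_le: "finite S \<Longrightarrow> real (max_mult S) ^ q \<le> sum_moment q S"
proof -
  assume S: "finite S"
  then obtain z where z: "repr_count S z = max_mult S" using max_mult_attained by blast
  then have "z \<in> subset_sums S" using max_mult_pos[OF S] repr_count_eq_0_iff[OF S, of z] by auto
  then have "real (repr_count S z) ^ q \<le> sum_moment q S"
    unfolding sum_moment_def using finite_subset_sums[OF S] by (intro member_le_sum) auto
  then show ?thesis by (simp add: z)
qed

section \<open>Growth of moments when elements are added\<close>

text \<open>The costly factor \<open>2 ^ q\<close> is charged only when both terms are positive,
  that is, at sums attainable both with and without the new element; these are rare on
  average.\<close>

lemma power_add_le:
  fixes x y :: real
  assumes "x \<ge> 0" "y \<ge> 0" "q \<ge> 1"
  shows "(x + y) ^ q \<le> x ^ q + y ^ q + (if x > 0 \<and> y > 0 then 2 ^ q * (x ^ q + y ^ q) else 0)"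
proof (cases "x > 0 \<and> y > 0")
  case True
  have "(x + y) ^ q \<le> (2 * max x y) ^ q" using assms by (intro power_mono) auto
  also have "\<dots> = 2 ^ q * max x y ^ q" by (simp add: power_mult_distrib)
  also have "max x y ^ q \<le> x ^ q + y ^ q" using assms by (auto simp: max_def)
  finally have "(x + y) ^ q \<le> 2 ^ q * (x ^ q + y ^ q)" by simp
  moreover have "x ^ q + y ^ q \<ge> 0" using assms by (intro add_nonneg_nonneg) auto
  ultimately have "(x + y) ^ q \<le> x ^ q + y ^ q + 2 ^ q * (x ^ q + y ^ q)" by linarith
  then show ?thesis using True by (simp only: if_True simp_thms)
next
  case False
  then have "x = 0 \<or> y = 0" using assms by auto
  then show ?thesis using assms by auto
qed

text \<open>The extra terms that a new element a contributes to the q-th moment; averaged over a window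
  at height v they are small because distinct a give distinct shifts.\<close>

definition shifted_moment :: "nat \<Rightarrow> nat set \<Rightarrow> int \<Rightarrow> real" where
  "shifted_moment q S a = (\<Sum>z\<in>subset_sums S. of_bool (z - a \<in> subset_sums S) * real (repr_count S z) ^ q)"

lemma sum_repr_count_shift:
  assumes "finite S" "finite Z" "q \<ge> 1"
  shows "(\<Sum>z\<in>Z. real (repr_count S (z - a)) ^ q) \<le> sum_moment q S"
proof -
  have "(\<Sum>z\<in>Z. real (repr_count S (z - a)) ^ q) = (\<Sum>w\<in>(\<lambda>z. z - a) ` Z. real (repr_count S w) ^ q)"
    by (subst sum.reindex) (auto simp: inj_on_def)
  also have "\<dots> = (\<Sum>w\<in>(\<lambda>z. z - a) ` Z \<inter> subset_sums S. real (repr_count S w) ^ q)"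
    using assms by (intro sum.mono_neutral_right) (auto simp: repr_count_eq_0_iff)
  also have "\<dots> \<le> sum_moment q S"
    unfolding sum_moment_def using finite_subset_sums[OF assms(1)] by (intro sum_mono2) auto
  finally show ?thesis .
qed

text \<open>The multiplicity function is added to its shift by a. Each copy contributes one full
  moment, and this factor 2 is what \<open>norm_moment\<close> divides out; the overlaps give the
  shifted moments.\<close>

lemma sum_moment_insert:
  assumes S: "finite S" "a \<notin> S" and q: "q \<ge> 1"
  shows "sum_moment q (insert a S) \<le> 2 * sum_moment q S + 2 ^ q * (shifted_moment q S (int a) + shifted_moment q S (- int a))"
proof -
  let ?a = "int a"
  let ?Z = "subset_sums (insert a S)"
  let ?c = "\<lambda>z. real (repr_count S z)"
  have fZ: "finite ?Z" using S by (simp add: finite_subset_sums)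
  have pos: "?c z > 0 \<longleftrightarrow> z \<in> subset_sums S" for z using repr_count_eq_0_iff[OF S(1), of z] by auto
  have "sum_moment q (insert a S) = (\<Sum>z\<in>?Z. (?c z + ?c (z - ?a)) ^ q)"
    by (simp add: sum_moment_def repr_count_insert S)
  also have "\<dots> \<le> (\<Sum>z\<in>?Z. ?c z ^ q + ?c (z - ?a) ^ q +
      2 ^ q * (of_bool (z \<in> subset_sums S \<and> z - ?a \<in> subset_sums S) * (?c z ^ q + ?c (z - ?a) ^ q)))"
  proof (intro sum_mono)
    fix z
    show "(?c z + ?c (z - ?a)) ^ q \<le> ?c z ^ q + ?c (z - ?a) ^ q +
      2 ^ q * (of_bool (z \<in> subset_sums S \<and> z - ?a \<in> subset_sums S) * (?c z ^ q + ?c (z - ?a) ^ q))"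
      using power_add_le[of "?c z" "?c (z - ?a)" q] q pos[of z] pos[of "z - ?a"]
      by (cases "z \<in> subset_sums S \<and> z - ?a \<in> subset_sums S") auto
  qed
  also have "\<dots> = (\<Sum>z\<in>?Z. ?c (z - 0) ^ q) + (\<Sum>z\<in>?Z. ?c (z - ?a) ^ q) +
     2 ^ q * ((\<Sum>z\<in>?Z. of_bool (z \<in> subset_sums S \<and> z - ?a \<in> subset_sums S) * ?c z ^ q) +
       (\<Sum>z\<in>?Z. of_bool (z \<in> subset_sums S \<and> z - ?a \<in> subset_sums S) * ?c (z - ?a) ^ q))"
    by (simp only: sum.distrib distrib_left sum_distrib_left diff_0_right)
  also have "\<dots> \<le> sum_moment q S + sum_moment q S + 2 ^ q * (shifted_moment q S ?a + shifted_moment q S (- ?a))"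
  proof (intro add_mono mult_left_mono sum_repr_count_shift)
    have "(\<Sum>z\<in>?Z. of_bool (z \<in> subset_sums S \<and> z - ?a \<in> subset_sums S) * ?c z ^ q) =
      (\<Sum>z\<in>?Z \<inter> subset_sums S. of_bool (z - ?a \<in> subset_sums S) * ?c z ^ q)"
      using fZ by (intro sum.mono_neutral_cong_right) auto
    also have "\<dots> \<le> shifted_moment q S ?a"
      unfolding shifted_moment_def using finite_subset_sums[OF S(1)] by (intro sum_mono2) auto
    finally show "(\<Sum>z\<in>?Z. of_bool (z \<in> subset_sums S \<and> z - ?a \<in> subset_sums S) * ?c z ^ q) \<le> shifted_moment q S ?a" .
    have "(\<Sum>z\<in>?Z. of_bool (z \<in> subset_sums S \<and> z - ?a \<in> subset_sums S) * ?c (z - ?a) ^ q) =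
      (\<Sum>w\<in>(\<lambda>z. z - ?a) ` ?Z. of_bool (w + ?a \<in> subset_sums S \<and> w \<in> subset_sums S) * ?c w ^ q)"
      by (subst sum.reindex) (auto simp: inj_on_def)
    also have "\<dots> = (\<Sum>w\<in>(\<lambda>z. z - ?a) ` ?Z \<inter> subset_sums S. of_bool (w - - ?a \<in> subset_sums S) * ?c w ^ q)"
      using fZ by (intro sum.mono_neutral_cong_right) auto
    also have "\<dots> \<le> shifted_moment q S (- ?a)"
      unfolding shifted_moment_def using finite_subset_sums[OF S(1)] by (intro sum_mono2) auto
    finally show "(\<Sum>z\<in>?Z. of_bool (z \<in> subset_sums S \<and> z - ?a \<in> subset_sums S) * ?c (z - ?a) ^ q) \<le> shifted_moment q S (- ?a)" .
  qed (use S q fZ in auto)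
  finally show ?thesis by simp
qed

text \<open>For fixed z at most \<open>2 ^ card S\<close> shifts lead back to a subset sum.\<close>

lemma sum_shifted_moment_le:
  assumes S: "finite S" and V: "finite V" "inj_on f V"
  shows "(\<Sum>a\<in>V. shifted_moment q S (f a)) \<le> 2 ^ card S * sum_moment q S"
proof -
  have "(\<Sum>a\<in>V. shifted_moment q S (f a)) =
      (\<Sum>z\<in>subset_sums S. real (repr_count S z) ^ q * (\<Sum>a\<in>V. of_bool (z - f a \<in> subset_sums S)))"
    unfolding shifted_moment_def by (subst sum.swap) (simp add: sum_distrib_left mult.commute)
  also have "\<dots> \<le> (\<Sum>z\<in>subset_sums S. real (repr_count S z) ^ q * 2 ^ card S)"
  proof (intro sum_mono mult_left_mono)
    fix z
    have "(\<Sum>a\<in>V. of_bool (z - f a \<in> subset_sums S)) = real (card {a\<in>V. z - f a \<in> subset_sums S})"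
      using V by (simp add: of_bool_def sum.If_cases Int_def)
    also have "card {a\<in>V. z - f a \<in> subset_sums S} \<le> card (subset_sums S)"
      by (rule card_inj_on_le[where f = "\<lambda>a. z - f a"])
        (use V finite_subset_sums[OF S] in \<open>auto simp: inj_on_def\<close>)
    also have "card (subset_sums S) \<le> 2 ^ card S" using S by (rule card_subset_sums_le)
    finally show "(\<Sum>a\<in>V. of_bool (z - f a \<in> subset_sums S)) \<le> (2 ^ card S :: real)"
      by simp
  qed auto
  also have "\<dots> = 2 ^ card S * sum_moment q S" by (simp add: sum_moment_def sum_distrib_left mult.commute)
  finally show ?thesis .
qed

text \<open>For positive q, the mean of the (q-1)-st power of the multiplicity at the sum of a
  uniformly chosen subset.\<close>

definition norm_moment :: "nat \<Rightarrow> nat set \<Rightarrow> real" where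
  "norm_moment q S = sum_moment q S / 2 ^ card S"

lemma norm_moment_nonneg: "norm_moment q S \<ge> 0"
  by (simp add: norm_moment_def sum_moment_nonneg)

text \<open>A single new element keeps the normalized moment up to overlaps. These, averaged over
  its position with weight at most \<open>1 / v\<close>, give the relative error.\<close>

lemma norm_moment_step:
  assumes S: "finite S" "S \<inter> {v<..v'} = {}" and q: "q \<ge> 1" and v: "v \<ge> 1"
  shows "lexp {v<..v'} (\<lambda>T. of_bool (card T \<le> 1) * norm_moment q (S \<union> T)) \<le>
    norm_moment q S * (1 + 2 ^ q * 2 ^ card S / real v)"
proof -
  let ?V = "{v<..v'}"
  let ?cr = "\<lambda>a. shifted_moment q S (int a) + shifted_moment q S (- int a)"
  have cr: "?cr a \<ge> 0" for a unfolding shifted_moment_def by (intro add_nonneg_nonneg sum_nonneg) auto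
  have ins: "norm_moment q (insert a S) - norm_moment q S \<le> 2 ^ q * ?cr a / (2 * 2 ^ card S)" if "a \<in> ?V" for a
  proof -
    have "a \<notin> S" using that S by auto
    then have "norm_moment q (insert a S) \<le> (2 * sum_moment q S + 2 ^ q * ?cr a) / (2 * 2 ^ card S)"
      unfolding norm_moment_def using sum_moment_insert[OF S(1) \<open>a \<notin> S\<close> q] S by (simp add: divide_right_mono)
    then show ?thesis by (simp add: norm_moment_def add_divide_distrib)
  qed
  have "lexp ?V (\<lambda>T. of_bool (card T \<le> 1) * norm_moment q (S \<union> T)) \<le>
    lexp ?V (\<lambda>T. if \<exists>a. T = {a} then norm_moment q (insert (the_elem T) S) else norm_moment q S)"
  proof (intro lexp_mono)
    fix T assume "T \<subseteq> ?V"
    then have "finite T" using finite_subset by auto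
    then have "card T \<le> 1 \<longleftrightarrow> T = {} \<or> (\<exists>a. T = {a})"
      by (auto simp: le_Suc_eq card_1_singleton_iff)
    then show "of_bool (card T \<le> 1) * norm_moment q (S \<union> T) \<le>
      (if \<exists>a. T = {a} then norm_moment q (insert (the_elem T) S) else norm_moment q S)"
      using norm_moment_nonneg by auto
  qed
  also have "\<dots> = norm_moment q S + (\<Sum>a\<in>?V. log_weight ?V {a} * (norm_moment q (insert a S) - norm_moment q S))"
    by (rule lexp_at_most_single) simp
  also have "\<dots> \<le> norm_moment q S + (\<Sum>a\<in>?V. 1 / real v * (2 ^ q * ?cr a / (2 * 2 ^ card S)))"
  proof (intro add_left_mono sum_mono)
    fix a assume a: "a \<in> ?V"
    have "log_weight ?V {a} * (norm_moment q (insert a S) - norm_moment q S) \<le> log_weight ?V {a} * (2 ^ q * ?cr a / (2 * 2 ^ card S))"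
      using ins[OF a] log_weight_nonneg by (intro mult_left_mono) auto
    also have "\<dots> \<le> 1 / real v * (2 ^ q * ?cr a / (2 * 2 ^ card S))"
      using log_weight_singleton_le[OF a v] cr[of a] by (intro mult_right_mono) auto
    finally show "log_weight ?V {a} * (norm_moment q (insert a S) - norm_moment q S) \<le>
      1 / real v * (2 ^ q * ?cr a / (2 * 2 ^ card S))" .
  qed
  also have "(\<Sum>a\<in>?V. 1 / real v * (2 ^ q * ?cr a / (2 * 2 ^ card S))) =
    2 ^ q / (real v * 2 * 2 ^ card S) * ((\<Sum>a\<in>?V. shifted_moment q S (int a)) + (\<Sum>a\<in>?V. shifted_moment q S (- int a)))"
    unfolding sum.distrib [symmetric] sum_distrib_left by (intro sum.cong) (auto simp: field_simps)
  also have "\<dots> \<le> 2 ^ q / (real v * 2 * 2 ^ card S) * (2 ^ card S * sum_moment q S + 2 ^ card S * sum_moment q S)"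
    using S by (intro mult_left_mono add_mono sum_shifted_moment_le) (auto simp: inj_on_def)
  also have "\<dots> = norm_moment q S * (2 ^ q * 2 ^ card S / real v)"
    using v by (simp add: norm_moment_def field_simps)
  finally show ?thesis by (simp add: algebra_simps)
qed

section \<open>Regular sets and exceptional events\<close>

text \<open>The exponent 19/20 makes the relative error of \<open>norm_moment_step\<close> at most
  \<open>2 ^ q * v powr (- 1 / 20)\<close>. The second condition looks only below the window, so it
  is decided before the window is revealed.\<close>

definition regular_upto :: "nat \<Rightarrow> nat \<Rightarrow> nat \<Rightarrow> nat \<Rightarrow> nat set \<Rightarrow> bool" where
  "regular_upto t x y l S \<longleftrightarrow> (\<forall>j<l. card (S \<inter> {window t y j<..window t y (Suc j)}) \<le> 1 \<and>
     2 ^ card (S \<inter> {x<..window t y j}) \<le> real (window t y j) powr (19 / 20))"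

text \<open>Iterates \<open>norm_moment_step\<close>, revealing one window at a time; once
  regularity is lost, the integrand is 0 for good.\<close>

lemma norm_moment_bound:
  assumes S0: "S0 \<subseteq> {x<..y}" and x: "x \<le> y" "1 \<le> y" and q: "q \<ge> 1"
  shows "lexp {y<..window t y l} (\<lambda>T. of_bool (regular_upto t x y l (S0 \<union> T)) * norm_moment q (S0 \<union> T)) \<le>
    (1 + 2 ^ q * real y powr (- 1 / 20)) ^ l * norm_moment q S0"
proof (induction l)
  case 0
  then show ?case by (simp add: regular_upto_def)
next
  case (Suc l)
  define v where "v = window t y l"
  define v' where "v' = window t y (Suc l)"
  have vy: "y \<le> v" "v \<le> v'" by (auto simp: v_def v'_def window_ge)
  have fS0: "finite S0" using S0 finite_subset by auto
  have split: "{y<..v'} = {y<..v} \<union> {v<..v'}" using vy by auto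
  let ?e = "2 ^ q * real y powr (- 1 / 20)"
  have "lexp {y<..v'} (\<lambda>T. of_bool (regular_upto t x y (Suc l) (S0 \<union> T)) * norm_moment q (S0 \<union> T)) =
    lexp {y<..v} (\<lambda>T. lexp {v<..v'} (\<lambda>T'. of_bool (regular_upto t x y (Suc l) (S0 \<union> (T \<union> T'))) * norm_moment q (S0 \<union> (T \<union> T'))))"
    unfolding split by (intro lexp_union) auto
  also have "\<dots> \<le> lexp {y<..v} (\<lambda>T. (1 + ?e) * (of_bool (regular_upto t x y l (S0 \<union> T)) * norm_moment q (S0 \<union> T)))"
  proof (intro lexp_mono)
    fix T assume T: "T \<subseteq> {y<..v}"
    define S where "S = S0 \<union> T"
    have fS: "finite S" using fS0 T finite_subset[of T] by (auto simp: S_def)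
    have Sv: "S \<subseteq> {x<..v}" using S0 T x vy by (auto simp: S_def)
    have gdl: "regular_upto t x y l (S \<union> T') \<longleftrightarrow> regular_upto t x y l S" if "T' \<subseteq> {v<..v'}" for T'
    proof -
      have "window t y j \<le> v" "window t y (Suc j) \<le> v" if "j < l" for j
        unfolding v_def using that by (auto intro: window_mono simp del: window.simps)
      then have "(S \<union> T') \<inter> {window t y j<..window t y (Suc j)} = S \<inter> {window t y j<..window t y (Suc j)}"
        "(S \<union> T') \<inter> {x<..window t y j} = S \<inter> {x<..window t y j}" if "j < l" for j
        using \<open>T' \<subseteq> {v<..v'}\<close> that by fastforce+
      then show ?thesis unfolding regular_upto_def by auto
    qed
    have gdS: "regular_upto t x y (Suc l) (S \<union> T') \<longleftrightarrow>
       regular_upto t x y l S \<and> card T' \<le> 1 \<and> 2 ^ card S \<le> real v powr (19 / 20)" if T': "T' \<subseteq> {v<..v'}" for T'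
    proof -
      have "(S \<union> T') \<inter> {v<..v'} = T'" "(S \<union> T') \<inter> {x<..v} = S" using T' Sv by auto
      moreover have "regular_upto t x y (Suc l) (S \<union> T') \<longleftrightarrow> regular_upto t x y l (S \<union> T') \<and>
         card ((S \<union> T') \<inter> {v<..v'}) \<le> 1 \<and> 2 ^ card ((S \<union> T') \<inter> {x<..v}) \<le> real v powr (19 / 20)"
        unfolding regular_upto_def v_def v'_def less_Suc_eq by blast
      ultimately show ?thesis using gdl[OF T'] by simp
    qed
    show "lexp {v<..v'} (\<lambda>T'. of_bool (regular_upto t x y (Suc l) (S0 \<union> (T \<union> T'))) * norm_moment q (S0 \<union> (T \<union> T'))) \<le>
       (1 + ?e) * (of_bool (regular_upto t x y l (S0 \<union> T)) * norm_moment q (S0 \<union> T))"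
    proof (cases "regular_upto t x y l S \<and> 2 ^ card S \<le> real v powr (19 / 20)")
      case True
      have "lexp {v<..v'} (\<lambda>T'. of_bool (regular_upto t x y (Suc l) (S0 \<union> (T \<union> T'))) * norm_moment q (S0 \<union> (T \<union> T'))) =
         lexp {v<..v'} (\<lambda>T'. of_bool (card T' \<le> 1) * norm_moment q (S \<union> T'))"
        using True by (intro lexp_cong) (simp add: gdS S_def [symmetric] Un_assoc [symmetric])
      also have "\<dots> \<le> norm_moment q S * (1 + 2 ^ q * 2 ^ card S / real v)"
        using fS Sv q vy x by (intro norm_moment_step) auto
      also have "\<dots> \<le> norm_moment q S * (1 + ?e)"
      proof (intro mult_left_mono add_left_mono norm_moment_nonneg)
        have "2 ^ card S / real v \<le> real v powr (19 / 20) / real v powr 1"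
          using True vy x by (simp add: divide_right_mono)
        also have "\<dots> = real v powr (- 1 / 20)" unfolding powr_diff [symmetric] by simp
        also have "\<dots> \<le> real y powr (- 1 / 20)" using vy x by (intro powr_mono2') auto
        finally have "2 ^ q * (2 ^ card S / real v) \<le> 2 ^ q * real y powr (- 1 / 20)"
          by (intro mult_left_mono) auto
        then show "2 ^ q * 2 ^ card S / real v \<le> ?e" by simp
      qed
      finally show ?thesis using True by (simp add: S_def mult.commute)
    next
      case False
      have "lexp {v<..v'} (\<lambda>T'. of_bool (regular_upto t x y (Suc l) (S0 \<union> (T \<union> T'))) * norm_moment q (S0 \<union> (T \<union> T'))) =
         lexp {v<..v'} (\<lambda>T'. 0)"
        using False by (intro lexp_cong) (auto simp: gdS S_def [symmetric] Un_assoc [symmetric])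
      then show ?thesis using norm_moment_nonneg[of q "S0 \<union> T"] by (simp add: lexp_const)
    qed
  qed
  also have "\<dots> = (1 + ?e) * lexp {y<..v} (\<lambda>T. of_bool (regular_upto t x y l (S0 \<union> T)) * norm_moment q (S0 \<union> T))"
    by (rule lexp_cmult)
  also have "\<dots> \<le> (1 + ?e) * ((1 + ?e) ^ l * norm_moment q S0)"
    using Suc.IH unfolding v_def by (intro mult_left_mono) auto
  finally show ?case by (simp add: v'_def mult.assoc)
qed

text \<open>With \<rho> the chance of an empty window, exactly one element has chance at least
  \<open>\<rho> * (1 - \<rho>)\<close>, which leaves at most
  \<open>(1 - \<rho>) ^ 2\<close>.\<close>

lemma lprob_two_in_window:
  assumes "1 \<le> v" "v \<le> v'" "real t * (real v' - real v) \<le> real v" "t \<ge> 1"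
  shows "lprob {v<..v'} (\<lambda>S. \<not> card S \<le> 1) \<le> 1 / real t ^ 2"
proof -
  let ?V = "{v<..v'}"
  define \<rho> where "\<rho> = real v / real v'"
  have \<rho>: "\<rho> \<ge> 0" by (simp add: \<rho>_def)
  have "lprob ?V (\<lambda>S. S = {}) = \<rho>"
  proof -
    have "lprob ?V (\<lambda>S. S = {}) = lprob ?V (\<lambda>S. S \<inter> ?V = {})"
      unfolding lprob_def by (intro lexp_cong) (auto simp: Int_absorb2)
    then show ?thesis using assms by (simp add: lprob_avoid prod_one_minus_inverse \<rho>_def)
  qed
  moreover have "lexp ?V (\<lambda>S. if \<exists>a. S = {a} then 1 else 0) \<ge> \<rho> * (1 - \<rho>)"
  proof -
    have "lexp ?V (\<lambda>S. if \<exists>a. S = {a} then 1 else 0) = (\<Sum>a\<in>?V. log_weight ?V {a})"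
      using lexp_at_most_single[of ?V "\<lambda>_. 1" 0] by simp
    also have "\<dots> \<ge> (\<Sum>a\<in>?V. \<rho> / real v')"
    proof (intro sum_mono)
      fix a assume a: "a \<in> ?V"
      then have "log_weight ?V {a} = \<rho> / (real a - 1)"
        using assms by (subst log_weight_singleton) (auto simp: prod_one_minus_inverse \<rho>_def)
      then show "\<rho> / real v' \<le> log_weight ?V {a}" using a assms \<rho> by (auto intro!: divide_left_mono)
    qed
    also have "(\<Sum>a\<in>?V. \<rho> / real v') = \<rho> * (1 - \<rho>)"
    proof -
      have "1 - \<rho> = (real v' - real v) / real v'" using assms by (simp add: \<rho>_def field_simps)
      then show ?thesis using assms by (simp add: of_nat_diff)
    qed
    finally show ?thesis .
  qed
  moreover have "lprob ?V (\<lambda>S. card S \<le> 1) \<ge>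
    lprob ?V (\<lambda>S. S = {}) + lexp ?V (\<lambda>S. if \<exists>a. S = {a} then 1 else 0)"
    unfolding lprob_def lexp_add [symmetric] by (intro lexp_mono) auto
  ultimately have "lprob ?V (\<lambda>S. card S \<le> 1) \<ge> \<rho> + \<rho> * (1 - \<rho>)" by linarith
  then have "lprob ?V (\<lambda>S. \<not> card S \<le> 1) \<le> (1 - \<rho>) ^ 2"
    by (subst lprob_compl) (auto simp: power2_eq_square algebra_simps)
  also have "\<dots> \<le> (1 / real t) ^ 2"
  proof (intro power_mono)
    have "real t * (real v' - real v) \<le> real v'" using assms by linarith
    then show "1 - \<rho> \<le> 1 / real t" using assms by (simp add: \<rho>_def field_simps)
    show "0 \<le> 1 - \<rho>" using assms by (simp add: \<rho>_def)
  qed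
  finally show ?thesis by (simp add: power_divide)
qed

text \<open>Typically \<open>card S\<close> is near \<open>ln v\<close>, and
  \<open>2 ^ card S\<close> near \<open>v powr 0.69\<close>. The exponential moment with base 3/2 is
  of order at most \<open>v powr (1 / 2)\<close>, and Markov's inequality at
  \<open>v powr (11 / 20)\<close> leaves the exponent -1/20.\<close>

lemma lprob_many_elements:
  assumes "1 \<le> v"
  shows "lprob {x<..v} (\<lambda>S. real v powr (19 / 20) < 2 ^ card S) \<le> 2 * real v powr (- 1 / 20)"
proof -
  let ?I = "{x<..v}"
  have "lexp ?I (\<lambda>S. (3 / 2) ^ card S) = lexp ?I (\<lambda>S. \<Prod>i\<in>?I. if i \<in> S then 3 / 2 else 1)"
    by (intro lexp_cong) (simp add: prod.If_cases Int_absorb1 Int_absorb2)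
  also have "\<dots> = (\<Prod>i\<in>?I. 1 + 1 / 2 * (1 / real i))"
    by (subst lexp_prod) (auto intro!: prod.cong simp: field_simps)
  also have "\<dots> \<le> (\<Prod>i\<in>?I. exp (1 / 2 * (1 / real i)))"
    by (intro prod_mono) (auto intro!: exp_ge_add_one_self)
  also have "\<dots> = exp (1 / 2 * (\<Sum>i\<in>?I. 1 / real i))"
    by (simp add: exp_sum [symmetric] sum_distrib_left)
  also have "\<dots> \<le> exp (1 / 2 * (1 + ln (real v)))"
  proof -
    have "(\<Sum>i\<in>?I. 1 / real i) \<le> (\<Sum>i=1..v. 1 / real i)" by (intro sum_mono2) auto
    also have "\<dots> = harm v" by (simp add: harm_def inverse_eq_divide)
    also have "\<dots> \<le> ln (real v) + 1"
      using assms decseqD[OF decseq_harm_diff_ln, of 0 "v - 1"] by (simp add: harm_expand)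
    finally show ?thesis by simp
  qed
  also have "\<dots> = exp (1 / 2) * real v powr (1 / 2)"
    using assms by (simp add: powr_def exp_add [symmetric] algebra_simps)
  also have "exp (1 / 2) \<le> (2 :: real)"
    using exp_bound_half[of "1 / 2 :: real"] by simp
  finally have E: "lexp ?I (\<lambda>S. (3 / 2) ^ card S) \<le> 2 * real v powr (1 / 2)"
    by (simp add: mult_right_mono)
  \<comment> \<open>\<open>2 ^ 7 = 128\<close> is just below \<open>(3 / 2) ^ 12\<close>, about
    129.7.\<close>
  have base: "2 powr (7 / 12) \<le> (3 / 2 :: real)"
  proof -
    have "(2 powr (7 / 12)) = ((2 :: real) ^ 7) powr (1 / 12)"
      using powr_powr[of 2 7 "1 / 12 :: real"] by simp
    also have "\<dots> \<le> ((3 / 2) ^ 12) powr (1 / 12)" by (intro powr_mono2) (auto simp: power_divide)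
    also have "\<dots> = 3 / 2" using powr_powr[of "3 / 2" 12 "1 / 12 :: real"] by simp
    finally show ?thesis .
  qed
  have "lprob ?I (\<lambda>S. real v powr (19 / 20) < 2 ^ card S) \<le>
    lprob ?I (\<lambda>S. (3 / 2) ^ card S \<ge> real v powr (11 / 20))"
  proof (intro lprob_mono)
    fix S assume S: "real v powr (19 / 20) < 2 ^ card S"
    \<comment> \<open>\<open>19 / 20 * (7 / 12) = 133 / 240\<close>, just above
      \<open>11 / 20 = 132 / 240\<close>.\<close>
    have "real v powr (11 / 20) \<le> real v powr (19 / 20 * (7 / 12))"
      using assms by (intro powr_mono) auto
    also have "\<dots> = (real v powr (19 / 20)) powr (7 / 12)" by (simp add: powr_powr)
    also have "\<dots> \<le> (2 ^ card S) powr (7 / 12)" using S by (intro powr_mono2) auto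
    also have "\<dots> = (2 powr (7 / 12)) ^ card S"
      by (simp add: powr_powr powr_realpow [symmetric] mult.commute)
    also have "\<dots> \<le> (3 / 2) ^ card S" using base by (intro power_mono) auto
    finally show "(3 / 2) ^ card S \<ge> real v powr (11 / 20)" .
  qed
  also have "\<dots> \<le> lexp ?I (\<lambda>S. (3 / 2) ^ card S) / real v powr (11 / 20)"
    using assms by (intro lprob_markov) auto
  also have "\<dots> \<le> 2 * real v powr (1 / 2) / real v powr (11 / 20)"
    using E by (intro divide_right_mono) auto
  also have "\<dots> = 2 * (real v powr (1 / 2) / real v powr (11 / 20))" by simp
  also have "\<dots> = 2 * real v powr (- 1 / 20)" unfolding powr_diff [symmetric] by simp
  finally show ?thesis .
qed

text \<open>Rounding down loses at most half of \<open>v / t\<close> as soon as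
  \<open>t \<le> v\<close>.\<close>

lemma window_lower:
  assumes "1 \<le> t" "t \<le> N"
  shows "real N * (1 + 1 / (2 * real t)) ^ l \<le> real (window t N l)"
proof (induction l)
  case (Suc l)
  define v where "v = window t N l"
  have "t \<le> v" using assms window_ge[of N t l] by (simp add: v_def)
  then have "v div t \<ge> 1" using assms by (simp add: div_greater_zero_iff Suc_le_eq)
  then have "t * 1 \<le> t * (v div t)" by (rule mult_left_mono) simp
  moreover have "v = t * (v div t) + v mod t" by simp
  moreover have "v mod t < t" using assms by simp
  ultimately have "v \<le> 2 * (t * (v div t))" by linarith
  then have "real v \<le> real (2 * (t * (v div t)))" by (simp only: of_nat_le_iff)
  then have "real v / (2 * real t) \<le> real (v div t)" using assms by (simp add: field_simps)
  have "real N * (1 + 1 / (2 * real t)) ^ Suc l \<le> real v * (1 + 1 / (2 * real t))"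
    using Suc by (simp add: v_def mult.assoc[symmetric] mult_right_mono mult.commute[of "1 + _"])
  also have "\<dots> \<le> real v + real (v div t)"
    using \<open>real v / (2 * real t) \<le> real (v div t)\<close> by (simp add: algebra_simps)
  finally show ?case by (simp add: v_def)
qed simp

lemma window_upper: "real (window t N l) \<le> real N * (1 + 1 / real t) ^ l"
proof (induction l)
  case (Suc l)
  define v where "v = window t N l"
  have "real (window t N (Suc l)) \<le> real v + real v / real t"
    by (simp add: v_def of_nat_div_le_of_nat)
  also have "\<dots> = real v * (1 + 1 / real t)" by (simp add: algebra_simps)
  also have "\<dots> \<le> (real N * (1 + 1 / real t) ^ l) * (1 + 1 / real t)"
    using Suc by (intro mult_right_mono) (auto simp: v_def)
  finally show ?case by (simp add: algebra_simps)
qed simp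

section \<open>Multiplicities between y and its square\<close>

text \<open>The exponent satisfies \<open>5 * n + 4 \<le> 480 * q\<close> for
  \<open>q = n div 40\<close> and \<open>n \<ge> 80\<close>; the left side collects
  \<open>A\<close>, the final scale and the number of subsets.\<close>

definition mult_const :: nat where "mult_const = 2 ^ 480"

text \<open>With q a small multiple of ln y, the normalized q-th moment hardly grows between y and
  \<open>y ^ 2\<close>, whereas the number of subsets of all elements up to \<open>y ^ 2\<close> is at most a constant
  to the power q.\<close>

lemma max_mult_block:
  fixes x y n :: nat
  assumes xy: "x \<le> y" and n: "2 ^ n \<le> y" "y < 2 ^ (n + 1)" "n \<ge> 80" "n ^ 2 \<le> 2 ^ n"
    and A: "A > 0" "A \<le> 2 ^ n"
    and e: "real (2 * n ^ 2 * (n + 1)) * (2 powr (real n / 40) * 2 powr (- real n / 20)) \<le> 1"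
  shows "lprob {x<..y ^ 2} (\<lambda>S. \<not> max_mult S \<le> mult_const * max_mult (S \<inter> {x<..y})) \<le>
    2 * (real n + 1) / real n ^ 2 +
    (real (2 * n ^ 2 * (n + 1)) + 1) * (2 * 2 powr (- real n / 20)) + 3 / A"
proof -
  \<comment> \<open>Windows of relative width \<open>1 / n ^ 2\<close>: there are of order
    \<open>n ^ 3\<close> of them, and each holds two elements with chance at most
    \<open>1 / n ^ 4\<close>.\<close>
  define t where "t = n ^ 2"
  \<comment> \<open>\<open>2 * t\<close> windows at least double the scale, and \<open>n + 1\<close>
    doublings lead from y beyond \<open>y ^ 2\<close>, since \<open>y < 2 ^ (n + 1)\<close>.\<close>
  define W where "W = 2 * n ^ 2 * (n + 1)"
  \<comment> \<open>\<open>2 ^ q\<close> must stay well below the saving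
    \<open>2 powr (n / 20)\<close> per window; with n/40 the remaining
    \<open>2 powr (- n / 40)\<close> still beats the number of windows.\<close>
  define q where "q = n div 40"
  define v where "v l = window t y l" for l
  define V where "V = v W"
  define J where "J = {x<..V}"
  have n0: "n \<ge> 1" using n by simp
  have t: "t \<ge> 1" "t \<le> y" using n by (auto simp: t_def intro: order_trans)
  have y1: "y \<ge> 1" using t by simp
  have vy: "y \<le> v l" for l by (simp add: v_def window_ge)
  have vmono: "l \<le> m \<Longrightarrow> v l \<le> v m" for l m by (simp add: v_def window_mono)
  have vSuc: "v (Suc l) = v l + v l div t" for l by (simp add: v_def)
  have q40: "40 * q \<le> n" "n \<le> 40 * q + 39" by (auto simp: q_def)
  have q1: "q \<ge> 1" using q40 n by linarith
  have ypow: "real y powr (- 1 / 20) \<le> 2 powr (- real n / 20)"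
  proof -
    have "real y powr (- 1 / 20) \<le> real (2 ^ n) powr (- 1 / 20)"
      using n by (intro powr_mono2') auto
    also have "\<dots> = 2 powr (- real n / 20)" by (simp add: powr_realpow [symmetric] powr_powr)
    finally show ?thesis .
  qed
  have y2V: "y ^ 2 \<le> V"
  proof -
    have "(2::real) \<le> (1 + 1 / (2 * real t)) ^ (2 * t)"
      using Bernoulli_inequality[of "1 / (2 * real t)" "2 * t"] t by (simp add: order_trans[of "-1" 0])
    then have "(2::real) ^ (n + 1) \<le> ((1 + 1 / (2 * real t)) ^ (2 * t)) ^ (n + 1)"
      by (intro power_mono) auto
    also have "\<dots> = (1 + 1 / (2 * real t)) ^ W"
      unfolding W_def t_def by (simp only: power_mult [symmetric])
    finally have *: "(2::real) ^ (n + 1) \<le> (1 + 1 / (2 * real t)) ^ W" .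
    have "real y < real (2 ^ (n + 1))" using n(2) by (simp only: of_nat_less_iff)
    then have "real y * real y \<le> real y * 2 ^ (n + 1)" by (intro mult_left_mono) auto
    also have "\<dots> \<le> real y * (1 + 1 / (2 * real t)) ^ W" using * by (intro mult_left_mono) auto
    also have "\<dots> \<le> real V" unfolding V_def v_def using t by (intro window_lower) auto
    finally have "real (y ^ 2) \<le> real V" by (simp add: power2_eq_square)
    then show ?thesis by (simp only: of_nat_le_iff)
  qed
  \<comment> \<open>The windows may overshoot \<open>y ^ 2\<close>, but only to a scale of order
    \<open>y ^ 4\<close>.\<close>
  have VU: "real V \<le> 2 ^ (4 * n + 4)"
  proof -
    have "exp 1 \<le> (272 / 100 :: real)" using e_less_272 by simp
    then have "exp 1 * exp 1 \<le> (272 / 100 :: real) * (272 / 100)" by (intro mult_mono) auto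
    then have e2: "exp 2 \<le> (8::real)" by (simp add: exp_add [symmetric])
    have "(1 + 1 / real t) ^ W \<le> exp (1 / real t) ^ W"
      by (intro power_mono exp_ge_add_one_self) auto
    also have "\<dots> = exp 2 ^ (n + 1)"
    proof -
      have "real W * (1 / real t) = real (n + 1) * 2" 
        unfolding W_def t_def [symmetric] using t by (simp add: field_simps)
      then show ?thesis by (simp only: exp_of_nat_mult [symmetric])
    qed
    also have "\<dots> \<le> 8 ^ (n + 1)" using e2 by (intro power_mono) auto
    finally have *: "(1 + 1 / real t) ^ W \<le> 8 ^ (n + 1)" .
    have "real y < real (2 ^ (n + 1))" using n(2) by (simp only: of_nat_less_iff)
    have "real V \<le> real y * (1 + 1 / real t) ^ W" unfolding V_def v_def by (rule window_upper)
    also have "\<dots> \<le> 2 ^ (n + 1) * 8 ^ (n + 1)"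
      using * \<open>real y < real (2 ^ (n + 1))\<close> by (intro mult_mono) auto
    also have "\<dots> = 2 ^ (4 * n + 4)"
      by (simp add: power_mult_distrib [symmetric] power_add power_mult)
    finally show ?thesis .
  qed
  \<comment> \<open>The exceptional events: a crowded window, too many elements below some endpoint,
    and a large moment on a regular set. The second includes the last endpoint, which bounds the
    number of subsets at the end.\<close>
  let ?B1 = "\<lambda>S. \<exists>l\<in>{..<W}. \<not> card (S \<inter> {v l<..v (Suc l)}) \<le> 1"
  let ?B2 = "\<lambda>S. \<exists>l\<in>{..W}. real (v l) powr (19 / 20) < 2 ^ card (S \<inter> {x<..v l})"
  let ?B3 = "\<lambda>S. regular_upto t x y W S \<and> norm_moment q S \<ge> A * real (max_mult (S \<inter> {x<..y})) ^ (q - 1)"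
  have P1: "lprob J ?B1 \<le> 2 * (real n + 1) / real n ^ 2"
  proof -
    have "lprob J ?B1 \<le> (\<Sum>l<W. lprob J (\<lambda>S. \<not> card (S \<inter> {v l<..v (Suc l)}) \<le> 1))"
      by (rule lprob_Bex) simp
    also have "\<dots> \<le> (\<Sum>l<W. 1 / real t ^ 2)"
    proof (intro sum_mono)
      fix l assume l: "l \<in> {..<W}"
      have "v (Suc l) \<le> V" unfolding V_def using l by (intro vmono) auto
      then have "{v l<..v (Suc l)} \<subseteq> J" using xy vy[of l] by (auto simp: J_def)
      then have "lprob J (\<lambda>S. \<not> card (S \<inter> {v l<..v (Suc l)}) \<le> 1) =
         lprob {v l<..v (Suc l)} (\<lambda>S. \<not> card S \<le> 1)"
        using lprob_restrict[of J "{v l<..v (Suc l)}" "\<lambda>S. \<not> card S \<le> 1"] by (simp add: J_def)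
      also have "\<dots> \<le> 1 / real t ^ 2"
      proof (rule lprob_two_in_window)
        have "real (t * (v l div t)) \<le> real (v l)" by (simp only: of_nat_le_iff) simp
        then show "real t * (real (v (Suc l)) - real (v l)) \<le> real (v l)" by (simp add: vSuc)
      qed (use vy[of l] y1 t vSuc in auto)
      finally show "lprob J (\<lambda>S. \<not> card (S \<inter> {v l<..v (Suc l)}) \<le> 1) \<le> 1 / real t ^ 2" .
    qed
    also have "\<dots> = real W / real t ^ 2" by simp
    also have "\<dots> = 2 * (real n + 1) / real n ^ 2"
      using n0 by (simp add: W_def t_def power2_eq_square field_simps)
    finally show ?thesis .
  qed
  have P2: "lprob J ?B2 \<le> (real W + 1) * (2 * 2 powr (- real n / 20))"
  proof -
    have "lprob J ?B2 \<le> (\<Sum>l\<le>W. lprob J (\<lambda>S. real (v l) powr (19 / 20) < 2 ^ card (S \<inter> {x<..v l})))"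
      by (rule lprob_Bex) simp
    also have "\<dots> \<le> (\<Sum>l\<le>W. 2 * 2 powr (- real n / 20))"
    proof (intro sum_mono)
      fix l assume l: "l \<in> {..W}"
      have "v l \<le> V" unfolding V_def using l by (intro vmono) auto
      then have "{x<..v l} \<subseteq> J" by (auto simp: J_def)
      then have "lprob J (\<lambda>S. real (v l) powr (19 / 20) < 2 ^ card (S \<inter> {x<..v l})) =
         lprob {x<..v l} (\<lambda>S. real (v l) powr (19 / 20) < 2 ^ card S)"
        using lprob_restrict[of J "{x<..v l}" "\<lambda>S. real (v l) powr (19 / 20) < 2 ^ card S"]
        by (simp add: J_def)
      also have "\<dots> \<le> 2 * real (v l) powr (- 1 / 20)"
        using vy[of l] y1 by (intro lprob_many_elements) auto
      also have "real (v l) powr (- 1 / 20) \<le> real y powr (- 1 / 20)"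
        using vy[of l] y1 by (intro powr_mono2') auto
      finally show "lprob J (\<lambda>S. real (v l) powr (19 / 20) < 2 ^ card (S \<inter> {x<..v l})) \<le>
        2 * 2 powr (- real n / 20)" using ypow by simp
    qed
    finally show ?thesis by (simp add: add.commute)
  qed
  have P3: "lprob J ?B3 \<le> 3 / A"
  proof -
    have J: "J = {x<..y} \<union> {y<..V}" using xy vy[of W] by (auto simp: J_def V_def)
    have "lprob J ?B3 = lexp {x<..y} (\<lambda>S0. lprob {y<..V} (\<lambda>T. ?B3 (S0 \<union> T)))"
      unfolding lprob_def J by (intro lexp_union) auto
    also have "\<dots> \<le> lexp {x<..y} (\<lambda>_. 3 / A)"
    proof (intro lexp_mono)
      fix S0 assume S0: "S0 \<subseteq> {x<..y}"
      then have f: "finite S0" using finite_subset by auto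
      define \<tau> where "\<tau> = A * real (max_mult S0) ^ (q - 1)"
      have \<tau>: "\<tau> > 0" using A max_mult_pos[OF f] by (auto simp: \<tau>_def)
      let ?h = "\<lambda>T. of_bool (regular_upto t x y W (S0 \<union> T)) * norm_moment q (S0 \<union> T)"
      have "lprob {y<..V} (\<lambda>T. ?B3 (S0 \<union> T)) \<le> lprob {y<..V} (\<lambda>T. ?h T \<ge> \<tau>)"
      proof (intro lprob_mono)
        fix T assume T: "T \<subseteq> {y<..V}" "?B3 (S0 \<union> T)"
        then have "(S0 \<union> T) \<inter> {x<..y} = S0" using S0 by auto
        then show "?h T \<ge> \<tau>" using T by (simp add: \<tau>_def)
      qed
      also have "\<dots> \<le> lexp {y<..V} ?h / \<tau>"
        using \<tau> norm_moment_nonneg by (intro lprob_markov) auto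
      also have "\<dots> \<le> (3 * real (max_mult S0) ^ (q - 1)) / \<tau>"
      proof (intro divide_right_mono)
        let ?e = "2 ^ q * real y powr (- 1 / 20)"
        have "lexp {y<..V} ?h \<le> (1 + ?e) ^ W * norm_moment q S0"
          unfolding V_def v_def using S0 xy y1 q1 by (intro norm_moment_bound) auto
        also have "\<dots> \<le> 3 * real (max_mult S0) ^ (q - 1)"
        proof (intro mult_mono)
          have "2 ^ q = (2::real) powr real q" by (simp add: powr_realpow)
          also have "\<dots> \<le> 2 powr (real n / 40)" using q40 by (intro powr_mono) auto
          finally have "?e \<le> 2 powr (real n / 40) * 2 powr (- real n / 20)"
            using ypow by (intro mult_mono) auto
          then have "real W * ?e \<le> 1"
            using e mult_left_mono[of ?e _ "real W"] unfolding W_def by fastforce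
          have "(1 + ?e) ^ W \<le> exp ?e ^ W" by (intro power_mono exp_ge_add_one_self) auto
          also have "\<dots> = exp (real W * ?e)" by (simp add: exp_of_nat_mult [symmetric])
          also have "\<dots> \<le> exp 1" using \<open>real W * ?e \<le> 1\<close> by simp
          also have "\<dots> \<le> 3" using e_less_272 by simp
          finally show "(1 + ?e) ^ W \<le> 3" .
          show "norm_moment q S0 \<le> real (max_mult S0) ^ (q - 1)"
            using sum_moment_le[OF f, of "q - 1"] q1 by (simp add: norm_moment_def divide_le_eq)
        qed (auto simp: norm_moment_nonneg)
        finally show "lexp {y<..V} ?h \<le> 3 * real (max_mult S0) ^ (q - 1)" .
      qed (use \<tau> in auto)
      also have "\<dots> = 3 / A" using A max_mult_pos[OF f] by (simp add: \<tau>_def)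
      finally show "lprob {y<..V} (\<lambda>T. ?B3 (S0 \<union> T)) \<le> 3 / A" .
    qed
    also have "\<dots> = 3 / A" by (simp add: lexp_const)
    finally show ?thesis .
  qed
  have imp: "max_mult S \<le> mult_const * max_mult (S \<inter> {x<..y})"
    if S: "S \<subseteq> J" and nB: "\<not> ?B1 S" "\<not> ?B2 S" "\<not> ?B3 S" for S
  proof -
    have f: "finite S" using S finite_subset by (auto simp: J_def)
    define m0 where "m0 = max_mult (S \<inter> {x<..y})"
    have m0: "m0 \<ge> 1" using f max_mult_pos by (simp add: m0_def)
    have good: "card (S \<inter> {v l<..v (Suc l)}) \<le> 1" if "l < W" for l using nB(1) that by auto
    have few: "2 ^ card (S \<inter> {x<..v l}) \<le> real (v l) powr (19 / 20)" if "l \<le> W" for l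
      using nB(2) that by (auto simp: not_less)
    have "regular_upto t x y W S" unfolding regular_upto_def
    proof (intro allI impI conjI)
      fix j assume "j < W"
      then show "card (S \<inter> {window t y j<..window t y (Suc j)}) \<le> 1"
        "2 ^ card (S \<inter> {x<..window t y j}) \<le> real (window t y j) powr (19 / 20)"
        using good[of j] few[of j] unfolding v_def by auto
    qed
    then have nm: "norm_moment q S < A * real m0 ^ (q - 1)" using nB(3) by (auto simp: m0_def not_le)
    have "S \<inter> {x<..v W} = S" using S by (auto simp: J_def V_def)
    then have "2 ^ card S \<le> real V powr (19 / 20)" using few[of W] by (simp add: V_def)
    also have "\<dots> \<le> real V powr 1" using vy[of W] y1 by (intro powr_mono) (auto simp: V_def)
    finally have cS: "2 ^ card S \<le> real V" using vy[of W] y1 by (simp add: V_def)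
    \<comment> \<open>All factors other than the power of \<open>m0\<close> are at most
      \<open>2 ^ (480 * q)\<close>, so a q-th root costs only \<open>mult_const\<close>.\<close>
    have "real (max_mult S) ^ q \<le> sum_moment q S" by (rule max_mult_power_le[OF f])
    also have "\<dots> = norm_moment q S * 2 ^ card S" by (simp add: norm_moment_def)
    also have "\<dots> \<le> (A * real m0 ^ (q - 1)) * real V"
      using nm cS norm_moment_nonneg A by (intro mult_mono) auto
    also have "\<dots> \<le> (2 ^ n * real m0 ^ q) * 2 ^ (4 * n + 4)"
      using A VU m0 by (intro mult_mono power_increasing) auto
    also have "\<dots> = 2 ^ (n + (4 * n + 4)) * real m0 ^ q" by (simp only: power_add mult_ac)
    also have "\<dots> \<le> 2 ^ (480 * q) * real m0 ^ q"
      using q40 n(3) by (intro mult_right_mono power_increasing) auto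
    also have "\<dots> = (2 ^ 480 * real m0) ^ q" by (simp only: power_mult_distrib power_mult)
    finally have "real (max_mult S) ^ Suc (q - 1) \<le> (2 ^ 480 * real m0) ^ Suc (q - 1)" using q1 by simp
    then have "real (max_mult S) \<le> 2 ^ 480 * real m0" by (rule power_le_imp_le_base) simp
    then have "real (max_mult S) \<le> real (mult_const * m0)" by (simp only: mult_const_def of_nat_mult of_nat_power of_nat_numeral)
    then show ?thesis unfolding m0_def by (simp only: of_nat_le_iff)
  qed
  let ?I = "{x<..y ^ 2}"
  have IJ: "?I \<subseteq> J" "finite J" using y2V by (auto simp: J_def)
  have yy: "y \<le> y ^ 2" using y1 by (simp add: power2_eq_square)
  have "lprob ?I (\<lambda>S. \<not> max_mult S \<le> mult_const * max_mult (S \<inter> {x<..y})) =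
    lprob J (\<lambda>S. \<not> max_mult (S \<inter> ?I) \<le> mult_const * max_mult (S \<inter> ?I \<inter> {x<..y}))"
    using lprob_restrict[OF IJ(2,1), of "\<lambda>S. \<not> max_mult S \<le> mult_const * max_mult (S \<inter> {x<..y})"] by simp
  also have "\<dots> \<le> lprob J (\<lambda>S. ?B1 S \<or> ?B2 S \<or> ?B3 S)"
  proof (rule lprob_mono, rule ccontr)
    fix S assume S: "S \<subseteq> J" "\<not> max_mult (S \<inter> ?I) \<le> mult_const * max_mult (S \<inter> ?I \<inter> {x<..y})"
      "\<not> (?B1 S \<or> ?B2 S \<or> ?B3 S)"
    have "S \<inter> ?I \<inter> {x<..y} = S \<inter> {x<..y}" using yy by auto
    moreover have "max_mult (S \<inter> ?I) \<le> max_mult S"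
      using S(1) IJ(2) finite_subset by (intro max_mult_mono) auto
    moreover have "max_mult S \<le> mult_const * max_mult (S \<inter> {x<..y})" by (rule imp[OF S(1)]) (use S(3) in blast)+
    ultimately show False using S(2) by (metis order_trans)
  qed
  also have "\<dots> \<le> lprob J ?B1 + (lprob J ?B2 + lprob J ?B3)"
    by (intro order_trans[OF lprob_disj] add_left_mono lprob_disj)
  finally show ?thesis using P1 P2 P3 unfolding W_def by linarith
qed

text \<open>Here n is the integer part of the binary logarithm of y, and
  \<open>A = 6 / \<eta>\<close> spends \<eta>/2 on the moment bound. The threshold is uniform in the
  lower end x, as the iteration demands.\<close>

lemma max_mult_square:
  assumes "\<eta> > 0"
  shows "\<exists>Y. \<forall>x y. Y \<le> y \<longrightarrow> x \<le> y \<longrightarrow>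
    lprob {x<..y ^ 2} (\<lambda>S. \<not> max_mult S \<le> mult_const * max_mult (S \<inter> {x<..y})) \<le> \<eta>"
proof -
  have e1: "eventually (\<lambda>n. 2 * (real n + 1) / real n ^ 2 < \<eta> / 4) sequentially"
    using assms by (intro order_tendstoD[where y = "0::real"]) (real_asymp, simp)
  have e2: "eventually (\<lambda>n. (real (2 * n ^ 2 * (n + 1)) + 1) * (2 * 2 powr (- real n / 20)) < \<eta> / 4) sequentially"
    using assms by (intro order_tendstoD[where y = "0::real"]) (real_asymp, simp)
  have e3: "eventually (\<lambda>n. real (2 * n ^ 2 * (n + 1)) * (2 powr (real n / 40) * 2 powr (- real n / 20)) < 1) sequentially"
    by (intro order_tendstoD[where y = "0::real"]) (real_asymp, simp)
  have e4: "eventually (\<lambda>n. real n ^ 2 \<le> 2 ^ n) sequentially" by real_asymp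
  have e5: "eventually (\<lambda>n. 6 / \<eta> \<le> 2 ^ n) sequentially" by real_asymp
  have "eventually (\<lambda>n. 2 * (real n + 1) / real n ^ 2 < \<eta> / 4 \<and>
    (real (2 * n ^ 2 * (n + 1)) + 1) * (2 * 2 powr (- real n / 20)) < \<eta> / 4 \<and>
    real (2 * n ^ 2 * (n + 1)) * (2 powr (real n / 40) * 2 powr (- real n / 20)) < 1 \<and>
    real n ^ 2 \<le> 2 ^ n \<and> 6 / \<eta> \<le> 2 ^ n \<and> n \<ge> 80) sequentially"
    by (intro eventually_conj e1 e2 e3 e4 e5 eventually_ge_at_top)
  then obtain N where N: "\<And>n. n \<ge> N \<Longrightarrow> 2 * (real n + 1) / real n ^ 2 < \<eta> / 4 \<and>
    (real (2 * n ^ 2 * (n + 1)) + 1) * (2 * 2 powr (- real n / 20)) < \<eta> / 4 \<and>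
    real (2 * n ^ 2 * (n + 1)) * (2 powr (real n / 40) * 2 powr (- real n / 20)) < 1 \<and>
    real n ^ 2 \<le> 2 ^ n \<and> 6 / \<eta> \<le> 2 ^ n \<and> n \<ge> 80"
    unfolding eventually_sequentially by blast
  show ?thesis
  proof (intro exI[of _ "2 ^ N"] allI impI)
    fix x y :: nat assume y: "2 ^ N \<le> y" "x \<le> y"
    have "(1::nat) \<le> 2 ^ N" by simp
    then have "1 \<le> y" using y(1) by (rule order_trans)
    then obtain n where n: "2 ^ n \<le> y" "y < 2 ^ (n + 1)"
      using ex_power_ivl1[of 2 y] by auto
    have "(2::nat) ^ N < 2 ^ (n + 1)" using y n by linarith
    then have "N < n + 1" by (rule power_less_imp_less_exp[rotated]) simp
    then have "n \<ge> N" by simp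
    note N' = N[OF this]
    have "real (n ^ 2) \<le> real (2 ^ n)" using N' by simp
    then have "n ^ 2 \<le> 2 ^ n" by (simp only: of_nat_le_iff)
    then have "lprob {x<..y ^ 2} (\<lambda>S. \<not> max_mult S \<le> mult_const * max_mult (S \<inter> {x<..y})) \<le>
       2 * (real n + 1) / real n ^ 2 +
      (real (2 * n ^ 2 * (n + 1)) + 1) * (2 * 2 powr (- real n / 20)) + 3 / (6 / \<eta>)"
      using y n N' assms by (intro max_mult_block) auto
    also have "\<dots> \<le> \<eta> / 4 + \<eta> / 4 + \<eta> / 2" using N' assms by (intro add_mono) auto
    finally show "lprob {x<..y ^ 2} (\<lambda>S. \<not> max_mult S \<le> mult_const * max_mult (S \<inter> {x<..y})) \<le> \<eta>" by simp
  qed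
qed

text \<open>The start is the empty range, of multiplicity 1; the upper end is then squared i times,
  at a cost of \<eta> each time.\<close>

lemma max_mult_iterate:
  assumes "\<eta> > 0"
  shows "\<exists>Y. \<forall>x\<ge>Y. \<forall>i. lprob {x<..x ^ (2 ^ i)} (\<lambda>S. \<not> max_mult S \<le> mult_const ^ i) \<le> real i * \<eta>"
proof -
  obtain Y where Y: "\<And>x y. Y \<le> y \<Longrightarrow> x \<le> y \<Longrightarrow>
    lprob {x<..y ^ 2} (\<lambda>S. \<not> max_mult S \<le> mult_const * max_mult (S \<inter> {x<..y})) \<le> \<eta>"
    using max_mult_square[OF assms] by blast
  have "lprob {x<..x ^ (2 ^ i)} (\<lambda>S. \<not> max_mult S \<le> mult_const ^ i) \<le> real i * \<eta>"
    if x: "x \<ge> max Y 1" for x i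
  proof (induction i)
    case 0
    show ?case by (simp add: lprob_def max_mult_empty)
  next
    case (Suc i)
    define y where "y = x ^ (2 ^ i)"
    have xy: "x \<le> y" using x self_le_power[of x "2 ^ i"] by (simp add: y_def)
    have y2: "x ^ (2 ^ Suc i) = y ^ 2" by (simp add: y_def power_mult [symmetric] mult.commute)
    have yy: "y \<le> y ^ 2" using xy x self_le_power[of y 2] by simp
    have "lprob {x<..y ^ 2} (\<lambda>S. \<not> max_mult S \<le> mult_const ^ Suc i) \<le>
      lprob {x<..y ^ 2} (\<lambda>S. \<not> max_mult S \<le> mult_const * max_mult (S \<inter> {x<..y}) \<or> \<not> max_mult (S \<inter> {x<..y}) \<le> mult_const ^ i)"
    proof (rule lprob_mono, rule ccontr)
      fix S
      assume S: "\<not> max_mult S \<le> mult_const ^ Suc i"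
        "\<not> (\<not> max_mult S \<le> mult_const * max_mult (S \<inter> {x<..y}) \<or> \<not> max_mult (S \<inter> {x<..y}) \<le> mult_const ^ i)"
      have "mult_const * max_mult (S \<inter> {x<..y}) \<le> mult_const * mult_const ^ i"
        using S(2) by (intro mult_left_mono) auto
      then show False using S by (metis order_trans power_Suc)
    qed
    also have "\<dots> \<le> lprob {x<..y ^ 2} (\<lambda>S. \<not> max_mult S \<le> mult_const * max_mult (S \<inter> {x<..y})) +
       lprob {x<..y ^ 2} (\<lambda>S. \<not> max_mult (S \<inter> {x<..y}) \<le> mult_const ^ i)" by (rule lprob_disj)
    also have "lprob {x<..y ^ 2} (\<lambda>S. \<not> max_mult (S \<inter> {x<..y}) \<le> mult_const ^ i) =
      lprob {x<..y} (\<lambda>S. \<not> max_mult S \<le> mult_const ^ i)"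
      using yy by (intro lprob_restrict[where P = "\<lambda>S. \<not> max_mult S \<le> mult_const ^ i"]) auto
    also have "lprob {x<..y ^ 2} (\<lambda>S. \<not> max_mult S \<le> mult_const * max_mult (S \<inter> {x<..y})) +
      lprob {x<..y} (\<lambda>S. \<not> max_mult S \<le> mult_const ^ i) \<le> \<eta> + real i * \<eta>"
      using Y[of y x] xy x Suc.IH by (intro add_mono) (auto simp: y_def)
    finally show ?case unfolding y2 by (simp add: algebra_simps)
  qed
  then show ?thesis by blast
qed

text \<open>About \<open>log 2 (1 / c)\<close> squarings lead from \<open>D powr c\<close> to D. The
  2 in \<open>2 / c\<close> absorbs the rounding of \<open>D powr c\<close> to an integer, which
  stays above \<open>D powr (c / 2)\<close>.\<close>

lemma equal_sums_bound:
  assumes c: "0 < c" and lim: "(equal_sums_prob k c \<longlongrightarrow> 1) at_top"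
    and i: "2 / c \<le> 2 ^ i"
  shows "k \<le> mult_const ^ i"
proof (rule ccontr)
  assume k: "\<not> k \<le> mult_const ^ i"
  define \<eta> :: real where "\<eta> = 1 / (2 * (real i + 1))"
  have "\<eta> > 0" by (simp add: \<eta>_def)
  then obtain Y where Y: "\<And>x. x \<ge> Y \<Longrightarrow>
    lprob {x<..x ^ (2 ^ i)} (\<lambda>S. \<not> max_mult S \<le> mult_const ^ i) \<le> real i * \<eta>"
    using max_mult_iterate by blast
  have "eventually (\<lambda>D. 1 / 2 < equal_sums_prob k c D) at_top"
    using lim by (rule order_tendstoD) simp
  moreover have "eventually (\<lambda>D::real. D powr (c / 2) \<le> D powr c - 1) at_top"
    using c by real_asymp
  moreover have "eventually (\<lambda>D. real Y + 1 \<le> D powr c) at_top"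
    using c by real_asymp
  ultimately have "eventually (\<lambda>D::real. False) at_top"
    using eventually_gt_at_top[of 1]
  proof eventually_elim
    case (elim D)
    \<comment> \<open>The largest integer strictly below \<open>D powr c\<close>, since the range
      \<open>{x<..}\<close> is open on the left.\<close>
    define x where "x = nat \<lceil>D powr c\<rceil> - 1"
    have Dc: "D powr c \<ge> 1" using elim by auto
    have "real x \<ge> D powr c - 1" using Dc unfolding x_def by linarith
    have "real Y \<le> real x" using \<open>real x \<ge> D powr c - 1\<close> elim by linarith
    then have xY: "x \<ge> Y" by simp
    have "D = D powr 1" using elim by simp
    also have "\<dots> \<le> D powr (c / 2 * 2 ^ i)" using elim i c by (intro powr_mono) (auto simp: field_simps)
    also have "\<dots> = (D powr (c / 2)) ^ (2 ^ i)"
      using elim by (simp add: powr_realpow [symmetric] powr_powr)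
    also have "\<dots> \<le> real x ^ (2 ^ i)"
      using elim \<open>real x \<ge> D powr c - 1\<close> by (intro power_mono) auto
    finally have Dx: "D \<le> real (x ^ (2 ^ i))" by simp
    let ?I = "{a. 1 \<le> a \<and> D powr c \<le> real a \<and> real a \<le> D}"
    have sub: "?I \<subseteq> {x<..x ^ (2 ^ i)}"
    proof
      fix a assume a: "a \<in> ?I"
      have "real a \<le> real (x ^ (2 ^ i))" using a order_trans[OF _ Dx, of "real a"] by blast
      then have "a \<le> x ^ (2 ^ i)" by (simp only: of_nat_le_iff)
      moreover have "x < a" using a Dc unfolding x_def by simp linarith
      ultimately show "a \<in> {x<..x ^ (2 ^ i)}" by simp
    qed
    have "equal_sums_prob k c D = lprob ?I (has_equal_sums k)" by (rule equal_sums_prob_eq)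
    also have "\<dots> = lprob {x<..x ^ (2 ^ i)} (\<lambda>S. has_equal_sums k (S \<inter> ?I))"
      using sub by (intro lprob_restrict [symmetric]) auto
    also have "\<dots> \<le> lprob {x<..x ^ (2 ^ i)} (\<lambda>S. \<not> max_mult S \<le> mult_const ^ i)"
    proof (intro lprob_mono)
      fix S assume S: "S \<subseteq> {x<..x ^ (2 ^ i)}" "has_equal_sums k (S \<inter> ?I)"
      then have f: "finite S" using finite_subset by auto
      have "k \<le> max_mult (S \<inter> ?I)" using S f by (intro has_equal_sums_le_max_mult) auto
      also have "\<dots> \<le> max_mult S" using f by (intro max_mult_mono) auto
      finally show "\<not> max_mult S \<le> mult_const ^ i" using k by linarith
    qed
    also have "\<dots> \<le> real i * \<eta>" by (rule Y[OF xY])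
    also have "\<dots> \<le> 1 / 2" by (simp add: \<eta>_def field_simps)
    finally show False using elim by linarith
  qed
  then show False by simp
qed

section \<open>Cycle lengths of random permutations\<close>

definition cycle_type :: "nat \<Rightarrow> (nat \<Rightarrow> nat) \<Rightarrow> nat multiset" where
  "cycle_type n \<sigma> = image_mset card (mset_set (perm_cycles n \<sigma>))"

definition permE :: "nat \<Rightarrow> (nat multiset \<Rightarrow> real) \<Rightarrow> real" where
  "permE n F = (\<Sum>\<sigma> | \<sigma> permutes {1..n}. F (cycle_type n \<sigma>)) / fact n"

lemma orbit_in_cycle:
  assumes "permutation p" "y \<in> orbit p x"
  shows "orbit p y = orbit p x"
  using orbit_cyclic_eq3[OF cyclic_on_orbit'[OF assms(1)] assms(2)] by simp

lemma perm_cycle_facts: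
  assumes p: "p permutes {1..n}"
  shows "permutation p" "x \<in> orbit p x" "x \<in> {1..n} \<Longrightarrow> orbit p x \<subseteq> {1..n}"
    "finite (perm_cycles n p)" "{} \<notin> perm_cycles n p"
    "C \<in> perm_cycles n p \<Longrightarrow> {x\<in>{1..n}. orbit p x = C} = C"
    "C \<in> perm_cycles n p \<Longrightarrow> finite C"
proof -
  show perm: "permutation p" using p permutation_permutes by blast
  show self: "x \<in> orbit p x" for x using perm by (rule permutation_self_in_orbit)
  show sub: "x \<in> {1..n} \<Longrightarrow> orbit p x \<subseteq> {1..n}" for x
    using p by (rule permutes_orbit_subset)
  show "finite (perm_cycles n p)" by (simp add: perm_cycles_def)
  show "{} \<notin> perm_cycles n p" using self by (auto simp: perm_cycles_def)
  show eq: "C \<in> perm_cycles n p \<Longrightarrow> {x\<in>{1..n}. orbit p x = C} = C"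
    using self sub orbit_in_cycle[OF perm] by (fastforce simp: perm_cycles_def)
  show "C \<in> perm_cycles n p \<Longrightarrow> finite C"
    using sub finite_subset by (fastforce simp: perm_cycles_def)
qed

text \<open>A cycle of length i is seen from its i points; this size bias is the source of the
  weight \<open>real i\<close> in the recursions below.\<close>

lemma sum_orbit:
  fixes G :: "nat \<Rightarrow> real"
  assumes p: "p permutes {1..n}"
  shows "(\<Sum>b\<in>{1..n}. G (card (orbit p b))) = (\<Sum>i\<in>#cycle_type n p. real i * G i)"
proof -
  have "(\<Sum>b\<in>{1..n}. G (card (orbit p b))) =
    (\<Sum>C\<in>perm_cycles n p. \<Sum>b\<in>{x\<in>{1..n}. orbit p x = C}. G (card (orbit p b)))"
    by (rule sum.group [symmetric]) (auto simp: perm_cycles_def)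
  also have "\<dots> = (\<Sum>C\<in>perm_cycles n p. real (card C) * G (card C))"
  proof (intro sum.cong refl)
    fix C assume C: "C \<in> perm_cycles n p"
    have "(\<Sum>b\<in>{x\<in>{1..n}. orbit p x = C}. G (card (orbit p b))) =
        (\<Sum>b\<in>{x\<in>{1..n}. orbit p x = C}. G (card C))" by (intro sum.cong) auto
    then show "(\<Sum>b\<in>{x\<in>{1..n}. orbit p x = C}. G (card (orbit p b))) = real (card C) * G (card C)"
      unfolding perm_cycle_facts(6)[OF p C] by simp
  qed
  also have "\<dots> = (\<Sum>i\<in>#cycle_type n p. real i * G i)"
    by (simp add: cycle_type_def multiset.map_comp o_def sum_unfold_sum_mset)
  finally show ?thesis .
qed

lemma of_nat_sum_mset: "real (\<Sum>\<^sub># M) = (\<Sum>i\<in>#M. real i)"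
  by (induction M) auto

lemma cycle_type_facts:
  assumes p: "p permutes {1..n}"
  shows "\<Sum>\<^sub># (cycle_type n p) = n" "0 \<notin># cycle_type n p"
proof -
  have "real n = (\<Sum>i\<in>#cycle_type n p. real i)" using sum_orbit[OF p, of "\<lambda>_. 1"] by simp
  also have "\<dots> = real (\<Sum>\<^sub># (cycle_type n p))" by (rule of_nat_sum_mset [symmetric])
  finally show "\<Sum>\<^sub># (cycle_type n p) = n" by (simp only: of_nat_eq_iff)
  show "0 \<notin># cycle_type n p"
    using perm_cycle_facts[OF p] by (auto simp: cycle_type_def card_eq_0_iff)
qed

lemma permE_mono:
  "(\<And>M. \<Sum>\<^sub># M = n \<Longrightarrow> 0 \<notin># M \<Longrightarrow> F M \<le> G M) \<Longrightarrow> permE n F \<le> permE n G"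
  unfolding permE_def by (intro divide_right_mono sum_mono) (auto simp: cycle_type_facts)

lemma permE_cong:
  "(\<And>M. \<Sum>\<^sub># M = n \<Longrightarrow> 0 \<notin># M \<Longrightarrow> F M = G M) \<Longrightarrow> permE n F = permE n G"
  by (intro antisym permE_mono) auto

lemma permE_add: "permE n (\<lambda>M. F M + G M) = permE n F + permE n G"
  by (simp add: permE_def sum.distrib add_divide_distrib)

lemma permE_cmult: "permE n (\<lambda>M. c * F M) = c * permE n F"
  by (simp add: permE_def sum_distrib_left)

lemma permE_sum: "finite A \<Longrightarrow> permE n (\<lambda>M. \<Sum>a\<in>A. F a M) = (\<Sum>a\<in>A. permE n (F a))"
  by (induction A rule: finite_induct) (auto simp: permE_add, simp add: permE_def)

lemma permE_nonneg: "(\<And>M. F M \<ge> 0) \<Longrightarrow> permE n F \<ge> 0"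
  unfolding permE_def by (intro divide_nonneg_pos sum_nonneg) auto

lemma permE_const: "permE n (\<lambda>_. c) = c"
  by (simp add: permE_def card_permutations)

section \<open>Inserting a new point into a permutation\<close>

lemma perm_cycles_insert_new:
  assumes q: "q permutes {1..n}"
  shows "cycle_type (Suc n) q = add_mset 1 (cycle_type n q)"
proof -
  have "q (Suc n) = Suc n" using q by (simp add: permutes_not_in)
  then have "orbit q (Suc n) = {Suc n}" by (simp add: orbit_eq_singleton_iff)
  moreover have "{1..Suc n} = insert (Suc n) {1..n}" by auto
  ultimately have eq: "perm_cycles (Suc n) q = insert {Suc n} (perm_cycles n q)"
    by (simp add: perm_cycles_def)
  have "{Suc n} \<notin> perm_cycles n q"
    using perm_cycle_facts(3)[OF q] by (fastforce simp: perm_cycles_def)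
  then show ?thesis using perm_cycle_facts(4)[OF q] by (simp add: cycle_type_def eq)
qed

text \<open>Composition with the transposition puts a into the cycle of b, between the preimage of b
  and b itself; the other cycles survive unchanged.\<close>

lemma perm_cycles_insert_cycle:
  assumes q: "q permutes {1..n}" and b: "b \<in> {1..n}"
  defines "a \<equiv> Suc n"
  defines "s \<equiv> Transposition.transpose a b \<circ> q"
  defines "C \<equiv> orbit q b"
  shows "perm_cycles (Suc n) s = insert (insert a C) (perm_cycles n q - {C})"
proof -
  note q' = perm_cycle_facts[OF q]
  have ab: "a \<noteq> b" using b by (simp add: a_def)
  have qa: "q a = a" using q by (simp add: permutes_not_in a_def)
  have C: "C \<subseteq> {1..n}" "b \<in> C" using q'(2,3) b by (auto simp: C_def)
  have aC: "a \<notin> C" using C by (auto simp: a_def)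
  have "q permutes {1..Suc n}" using q by (rule permutes_subset) auto
  then have sp: "s permutes {1..Suc n}"
    unfolding s_def using b by (intro permutes_compose permutes_swap_id) (auto simp: a_def)
  note s' = perm_cycle_facts[OF sp]
  have s_a: "s a = b" by (simp add: s_def qa)
  have s_other: "s y = q y" if "y \<noteq> a" "q y \<noteq> b" for y
  proof -
    have "q y \<noteq> a" using that q qa by (metis permutes_inj injD)
    then show ?thesis using that by (simp add: s_def)
  qed
  have s_b: "s y = a" if "q y = b" for y using that by (simp add: s_def)
  have qC: "q y \<in> C \<longleftrightarrow> y \<in> C" for y
  proof
    assume "y \<in> C" then show "q y \<in> C" unfolding C_def by (rule orbit.step)
  next
    assume "q y \<in> C"
    then have "orbit q (q y) = C" using orbit_in_cycle[OF q'(1), of "q y" b] by (simp add: C_def)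
    moreover have "orbit q (q y) = orbit q y" using q'(1) by (rule permutation_orbit_step)
    ultimately show "y \<in> C" using q'(2)[of y] by simp
  qed
  have orb_a: "orbit s a = insert a C"
  proof
    show "orbit s a \<subseteq> insert a C"
    proof
      fix y assume "y \<in> orbit s a"
      then show "y \<in> insert a C"
      proof induction
        case base then show ?case using C by (simp add: s_a)
      next
        case (step y)
        then show ?case
        proof (cases "y = a")
          case True then show ?thesis using C s_a by simp
        next
          case False
          then show ?thesis using step s_b s_other qC by (cases "q y = b") auto
        qed
      qed
    qed
    have "b \<in> orbit s a" using orbit.base[of s a] by (simp add: s_a)
    have "y \<in> orbit s a" if "y \<in> orbit q b" for y
      using that
    proof induction
      case base
      show ?case
      proof (cases "q b = b")
        case False
        then have "q b = s b" using s_other[of b] ab by simp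
        then show ?thesis using \<open>b \<in> orbit s a\<close> by (simp add: orbit.step)
      qed (use \<open>b \<in> orbit s a\<close> in simp)
    next
      case (step y)
      show ?case
      proof (cases "q y = b")
        case False
        have "y \<noteq> a" using step aC by (auto simp: C_def)
        then have "q y = s y" using s_other[of y] False by simp
        then show ?thesis using step by (simp add: orbit.step)
      qed (use \<open>b \<in> orbit s a\<close> in simp)
    qed
    then show "insert a C \<subseteq> orbit s a" using s'(2)[of a] by (auto simp: C_def)
  qed
  have orb_C: "orbit s x = insert a C" if "x \<in> insert a C" for x
    using that orb_a orbit_in_cycle[OF s'(1), of x a] by auto
  have orb_o: "orbit s x = orbit q x" if "x \<in> {1..n}" "x \<notin> C" for x
  proof -
    have notC: "y \<notin> C" if "y \<in> orbit q x" for y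
      using that \<open>x \<notin> C\<close> by induction (auto simp: qC)
    have "orbit q x \<subseteq> {1..n}" using q'(3) that by auto
    then have na: "y \<noteq> a" if "y \<in> orbit q x" for y using that by (auto simp: a_def)
    have xq: "x \<in> orbit q x" by (rule q'(2))
    have same: "s y = q y" if "y \<in> orbit q x" for y
      using that notC[of "q y"] C na s_other orbit.step[of y q x] by blast
    have "y \<in> orbit s x \<longleftrightarrow> y \<in> orbit q x" for y
    proof
      assume "y \<in> orbit s x" then show "y \<in> orbit q x"
        by induction (use same xq in \<open>auto intro: orbit.intros\<close>)
    next
      assume "y \<in> orbit q x" then show "y \<in> orbit s x"
      proof induction
        case base then show ?case using same[OF xq] orbit.base[of s x] by simp
      next
        case (step y) then show ?case using same[of y] orbit.step[of y s x] by simp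
      qed
    qed
    then show ?thesis by blast
  qed
  have split: "{1..Suc n} = insert a C \<union> ({1..n} - C)" using C by (auto simp: a_def)
  have "perm_cycles (Suc n) s = orbit s ` (insert a C) \<union> orbit s ` ({1..n} - C)"
    unfolding perm_cycles_def split image_Un ..
  also have "orbit s ` (insert a C) = {insert a C}" using orb_C by auto
  also have "orbit s ` ({1..n} - C) = orbit q ` ({1..n} - C)" using orb_o by (intro image_cong) auto
  also have "\<dots> = perm_cycles n q - {C}"
  proof -
    have "orbit q x = C \<longleftrightarrow> x \<in> C" for x
      using q'(2)[of x] orbit_in_cycle[OF q'(1), of x b] by (auto simp: C_def)
    then show ?thesis by (auto simp: perm_cycles_def)
  qed
  finally show ?thesis by simp
qed

lemma cycle_type_insert_cycle:
  assumes q: "q permutes {1..n}" and b: "b \<in> {1..n}"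
  shows "cycle_type (Suc n) (Transposition.transpose (Suc n) b \<circ> q) =
    add_mset (Suc (card (orbit q b))) (cycle_type n q - {#card (orbit q b)#})"
proof -
  note q' = perm_cycle_facts[OF q]
  define C where "C = orbit q b"
  have C: "C \<in> perm_cycles n q" using b by (auto simp: perm_cycles_def C_def)
  have sub: "D \<subseteq> {1..n}" if "D \<in> perm_cycles n q" for D using that q'(3) unfolding perm_cycles_def by blast
  have new: "Suc n \<notin> D" if "D \<in> perm_cycles n q" for D using sub[OF that] by auto
  have "cycle_type n q = add_mset (card C) (image_mset card (mset_set (perm_cycles n q - {C})))"
    unfolding cycle_type_def using q'(4) C by (subst mset_set.remove[of _ C]) auto
  moreover have "cycle_type (Suc n) (Transposition.transpose (Suc n) b \<circ> q) =
    add_mset (card (insert (Suc n) C)) (image_mset card (mset_set (perm_cycles n q - {C})))"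
    unfolding cycle_type_def perm_cycles_insert_cycle[OF q b] C_def [symmetric]
    using q'(4) new by (subst mset_set.insert) auto
  moreover have "card (insert (Suc n) C) = Suc (card C)"
    using new[OF C] q'(7)[OF C] by simp
  ultimately show ?thesis by (simp add: C_def)
qed

text \<open>The Chinese restaurant process: the new point becomes a fixed point or is placed before
  one of the n old points, all \<open>n + 1\<close> options being equally likely. A cycle of length
  j offers j places.\<close>

lemma permE_Suc:
  "real (Suc n) * permE (Suc n) F = permE n (\<lambda>M. F (add_mset 1 M) +
     (\<Sum>j\<in>#M. real j * F (add_mset (Suc j) (M - {#j#}))))"
proof -
  have ins: "{1..Suc n} = insert (Suc n) {1..n}" by auto
  have "(\<Sum>\<sigma> | \<sigma> permutes {1..Suc n}. F (cycle_type (Suc n) \<sigma>)) =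
    (\<Sum>b\<in>insert (Suc n) {1..n}. \<Sum>q | q permutes {1..n}. F (cycle_type (Suc n) (Transposition.transpose (Suc n) b \<circ> q)))"
    unfolding ins by (rule sum_over_permutations_insert) auto
  \<comment> \<open>The term \<open>b = Suc n\<close> has the identity as its transposition and
    yields the new fixed point.\<close>
  also have "\<dots> = (\<Sum>q | q permutes {1..n}. F (cycle_type (Suc n) q)) +
    (\<Sum>b\<in>{1..n}. \<Sum>q | q permutes {1..n}. F (cycle_type (Suc n) (Transposition.transpose (Suc n) b \<circ> q)))"
    by (subst sum.insert) auto
  also have "(\<Sum>q | q permutes {1..n}. F (cycle_type (Suc n) q)) = (\<Sum>q | q permutes {1..n}. F (add_mset 1 (cycle_type n q)))"
    by (intro sum.cong) (auto simp: perm_cycles_insert_new)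
  also have "(\<Sum>b\<in>{1..n}. \<Sum>q | q permutes {1..n}. F (cycle_type (Suc n) (Transposition.transpose (Suc n) b \<circ> q))) =
    (\<Sum>q | q permutes {1..n}. \<Sum>b\<in>{1..n}. F (cycle_type (Suc n) (Transposition.transpose (Suc n) b \<circ> q)))"
    by (rule sum.swap)
  also have "\<dots> = (\<Sum>q | q permutes {1..n}. \<Sum>j\<in>#cycle_type n q. real j * F (add_mset (Suc j) (cycle_type n q - {#j#})))"
  proof (intro sum.cong refl)
    fix q assume "q \<in> {q. q permutes {1..n}}"
    then have q: "q permutes {1..n}" by simp
    have "(\<Sum>b\<in>{1..n}. F (cycle_type (Suc n) (Transposition.transpose (Suc n) b \<circ> q))) =
      (\<Sum>b\<in>{1..n}. F (add_mset (Suc (card (orbit q b))) (cycle_type n q - {#card (orbit q b)#})))"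
      by (intro sum.cong refl) (simp add: cycle_type_insert_cycle[OF q])
    then show "(\<Sum>b\<in>{1..n}. F (cycle_type (Suc n) (Transposition.transpose (Suc n) b \<circ> q))) =
      (\<Sum>j\<in>#cycle_type n q. real j * F (add_mset (Suc j) (cycle_type n q - {#j#})))"
      using sum_orbit[OF q, of "\<lambda>j. F (add_mset (Suc j) (cycle_type n q - {#j#}))"] by simp
  qed
  finally show ?thesis
    by (simp add: permE_def sum.distrib)
qed

section \<open>Marking and removing cycles\<close>

text \<open>Both sides run over ordered pairs of distinct occurrences in \<open>M\<close>, that is,
  over all pairs minus the diagonal.\<close>

lemma sum_mset_pairs_swap:
  fixes h :: "'a \<Rightarrow> 'a \<Rightarrow> real"
  shows "(\<Sum>j\<in>#M. \<Sum>i\<in>#M - {#j#}. h j i) = (\<Sum>i\<in>#M. \<Sum>j\<in>#M - {#i#}. h j i)"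
proof -
  have rem: "(\<Sum>i\<in>#M - {#j#}. g i) = (\<Sum>i\<in>#M. g i) - g j" if "j \<in># M" for j and g :: "'a \<Rightarrow> real"
    using arg_cong[OF insert_DiffM[OF that], of "\<lambda>M. \<Sum>i\<in>#M. g i"] by simp
  have 1: "(\<Sum>i\<in>#M - {#j#}. h j i) = (\<Sum>i\<in>#M. h j i) - h j j" if "j \<in># M" for j
    by (rule rem[OF that])
  have 2: "(\<Sum>j\<in>#M - {#i#}. h j i) = (\<Sum>j\<in>#M. h j i) - h i i" if "i \<in># M" for i
    by (rule rem[OF that])
  have sub: "(\<Sum>i\<in>#M. f i - g i) = (\<Sum>i\<in>#M. f i) - (\<Sum>i\<in>#M. g i)" for f g :: "'a \<Rightarrow> real"
    by (induction M) auto
  have "(\<Sum>j\<in>#M. \<Sum>i\<in>#M - {#j#}. h j i) = (\<Sum>j\<in>#M. (\<Sum>i\<in>#M. h j i) - h j j)"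
    using 1 by (intro arg_cong[where f = sum_mset] image_mset_cong) auto
  also have "\<dots> = (\<Sum>i\<in>#M. (\<Sum>j\<in>#M. h j i) - h i i)"
    unfolding sub by (subst sum_mset.swap) simp
  also have "\<dots> = (\<Sum>i\<in>#M. \<Sum>j\<in>#M - {#i#}. h j i)"
    using 2 by (intro arg_cong[where f = sum_mset] image_mset_cong) auto
  finally show ?thesis .
qed

text \<open>The cycle of a random point of a uniform random permutation has uniformly distributed length, and
  removing it leaves a uniform random permutation. Inducting with the insertion step
  \<open>permE_Suc\<close> avoids Cauchy's formula for the cycle type.\<close>

lemma permE_marked_cycle:
  "permE n (\<lambda>M. \<Sum>i\<in>#M. real i * f i (M - {#i#})) = (\<Sum>i=1..n. permE (n - i) (f i))"
proof (induction n arbitrary: f)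
  case 0
  have "permE 0 (\<lambda>M. \<Sum>i\<in>#M. real i * f i (M - {#i#})) = permE 0 (\<lambda>_. 0)"
  proof (rule permE_cong)
    fix M :: "nat multiset" assume "\<Sum>\<^sub># M = 0" "0 \<notin># M"
    then have "M = {#}" by (metis multiset_nonemptyE sum_mset_0_iff)
    then show "(\<Sum>i\<in>#M. real i * f i (M - {#i#})) = 0" by simp
  qed
  then show ?case by (simp add: permE_const)
next
  case (Suc n)
  let ?F = "\<lambda>M. \<Sum>i\<in>#M. real i * f i (M - {#i#})"
  \<comment> \<open>The marked cycle is the new fixed point, giving \<open>f 1\<close>, or an old
    cycle while the new point joins the rest (\<open>?f1\<close>), or the cycle that grew from j to
    \<open>Suc j\<close> (\<open>?f2\<close>).\<close>
  let ?f1 = "\<lambda>i M. f i (add_mset 1 M) + (\<Sum>j\<in>#M. real j * f i (add_mset (Suc j) (M - {#j#})))"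
  let ?f2 = "\<lambda>j M. real (Suc j) * f (Suc j) M"
  define e where "e i = permE (Suc n - i) (f i)" for i
  have add: "?F (add_mset x M) = real x * f x M + (\<Sum>i\<in>#M. real i * f i (add_mset x (M - {#i#})))" for x M
  proof -
    have "(\<Sum>i\<in>#M. real i * f i (add_mset x M - {#i#})) = (\<Sum>i\<in>#M. real i * f i (add_mset x (M - {#i#})))"
      by (intro arg_cong[where f = sum_mset] image_mset_cong) (simp add: diff_union_swap2)
    then show ?thesis by simp
  qed
  have pw: "?F (add_mset 1 M) + (\<Sum>j\<in>#M. real j * ?F (add_mset (Suc j) (M - {#j#}))) =
    f 1 M + (\<Sum>i\<in>#M. real i * ?f1 i (M - {#i#})) + (\<Sum>j\<in>#M. real j * ?f2 j (M - {#j#}))" for M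
  proof -
    have comm: "M - {#j#} - {#i#} = M - {#i#} - {#j#}" for i j :: nat
      by (simp add: diff_diff_add_mset add.commute)
    have "(\<Sum>j\<in>#M. \<Sum>i\<in>#M - {#j#}. real j * (real i * f i (add_mset (Suc j) (M - {#j#} - {#i#})))) =
      (\<Sum>i\<in>#M. \<Sum>j\<in>#M - {#i#}. real j * (real i * f i (add_mset (Suc j) (M - {#i#} - {#j#}))))"
      by (subst sum_mset_pairs_swap) (simp only: comm)
    also have "\<dots> = (\<Sum>i\<in>#M. real i * (\<Sum>j\<in>#M - {#i#}. real j * f i (add_mset (Suc j) (M - {#i#} - {#j#}))))"
      by (simp only: sum_mset_distrib_left mult.left_commute)
    finally have sw: "(\<Sum>j\<in>#M. real j * (\<Sum>i\<in>#M - {#j#}. real i * f i (add_mset (Suc j) (M - {#j#} - {#i#})))) =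
      (\<Sum>i\<in>#M. real i * (\<Sum>j\<in>#M - {#i#}. real j * f i (add_mset (Suc j) (M - {#i#} - {#j#}))))"
      by (simp only: sum_mset_distrib_left)
    show ?thesis
      unfolding add by (simp only: distrib_left sum_mset.distrib sw add.assoc)
  qed
  have "real (Suc n) * permE (Suc n) ?F = permE n (f 1) + (\<Sum>i=1..n. permE (n - i) (?f1 i)) +
      (\<Sum>j=1..n. permE (n - j) (?f2 j))"
    unfolding permE_Suc pw permE_add[of n "\<lambda>M. _ M + _ M"] permE_add[of n "f 1"]
      Suc.IH[of ?f1] Suc.IH[of ?f2] ..
  also have "(\<Sum>i=1..n. permE (n - i) (?f1 i)) = (\<Sum>i=1..n. real (Suc n - i) * e i)"
  proof (intro sum.cong refl)
    fix i assume "i \<in> {1..n}"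
    then have "Suc n - i = Suc (n - i)" by auto
    then show "permE (n - i) (?f1 i) = real (Suc n - i) * e i"
      by (simp only: e_def permE_Suc [symmetric])
  qed
  also have "(\<Sum>j=1..n. permE (n - j) (?f2 j)) = (\<Sum>i=2..Suc n. real i * e i)"
    by (rule sum.reindex_bij_witness[where i = "\<lambda>i. i - 1" and j = Suc]) (auto simp: e_def permE_cmult)
  also have "(\<Sum>i=1..n. real (Suc n - i) * e i) = (\<Sum>i=1..Suc n. real (Suc n - i) * e i)"
    by simp
  also have "permE n (f 1) + (\<Sum>i=1..Suc n. real (Suc n - i) * e i) + (\<Sum>i=2..Suc n. real i * e i) =
     (\<Sum>i=1..Suc n. real (Suc n - i) * e i) + (\<Sum>i=1..Suc n. real i * e i)"
  proof -
    have "{1..Suc n} = insert 1 {2..Suc n}" by auto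
    then have "(\<Sum>i=1..Suc n. real i * e i) = e 1 + (\<Sum>i=2..Suc n. real i * e i)" by simp
    then show ?thesis by (simp add: e_def)
  qed
  \<comment> \<open>The weights \<open>Suc n - i\<close>, for a marked cycle that stayed, and
    \<open>i\<close>, for one that is new or grew, add up to \<open>Suc n\<close>.\<close>
  also have "\<dots> = (\<Sum>i=1..Suc n. real (Suc n) * e i)"
    unfolding sum.distrib [symmetric]
    by (intro sum.cong refl) (auto simp: of_nat_diff algebra_simps)
  finally have "real (Suc n) * permE (Suc n) ?F = real (Suc n) * (\<Sum>i=1..Suc n. e i)"
    by (simp only: sum_distrib_left)
  then show ?case by (simp only: e_def mult_cancel_left of_nat_eq_0_iff) simp
qed

text \<open>\<open>permE_marked_cycle\<close> with every length other than i switched off.\<close>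

lemma permE_count:
  assumes "i \<ge> 1"
  shows "permE n (\<lambda>M. real (count M i) * f (M - {#i#})) = (if i \<le> n then permE (n - i) f / real i else 0)"
proof -
  let ?f = "\<lambda>j M. of_bool (j = i) * f M"
  have eq: "(\<Sum>j\<in>#M. real j * ?f j (M - {#j#})) = real i * (real (count M i) * f (M - {#i#}))" for M
  proof -
    have "(\<Sum>j\<in>#M. real j * ?f j (M - {#j#})) =
       (\<Sum>j\<in>set_mset M. if j = i then real (count M i) * (real i * f (M - {#i#})) else 0)"
      unfolding sum_mset_eq_sum_count by (intro sum.cong) auto
    also have "\<dots> = real i * (real (count M i) * f (M - {#i#}))"
      by (simp add: sum.delta not_in_iff)
    finally show ?thesis .
  qed
  have "real i * permE n (\<lambda>M. real (count M i) * f (M - {#i#})) = (\<Sum>j=1..n. permE (n - j) (?f j))"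
    unfolding permE_cmult [symmetric] eq [symmetric] by (rule permE_marked_cycle)
  also have "\<dots> = (\<Sum>j=1..n. if j = i then permE (n - i) f else 0)"
    by (intro sum.cong) (auto simp: permE_cmult)
  finally show ?thesis using assms by (auto simp: field_simps split: if_splits)
qed

section \<open>Permutations with restricted cycle lengths\<close>

text \<open>The probability that all cycle lengths lie in T. Removing a cycle changes n, so bounds
  are proved for sums over n first and then returned to a single n by
  \<open>parts_in_rec\<close>.\<close>

definition parts_in :: "nat set \<Rightarrow> nat \<Rightarrow> real" where
  "parts_in T n = permE n (\<lambda>M. of_bool (set_mset M \<subseteq> T))"

lemma parts_in_nonneg: "parts_in T n \<ge> 0"
  unfolding parts_in_def by (rule permE_nonneg) simp

text \<open>Each of the n points marks its cycle: the length must lie in T, and the remaining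
  permutation is subject to the same restriction.\<close>

lemma parts_in_rec: "real n * parts_in T n = (\<Sum>i\<in>{1..n} \<inter> T. parts_in T (n - i))"
proof -
  have "real n * parts_in T n = permE n (\<lambda>M. \<Sum>i\<in>#M. real i * (of_bool (i \<in> T) * of_bool (set_mset (M - {#i#}) \<subseteq> T)))"
    unfolding parts_in_def permE_cmult [symmetric]
  proof (rule permE_cong)
    fix M :: "nat multiset" assume M: "\<Sum>\<^sub># M = n"
    have "real n * of_bool (set_mset M \<subseteq> T) = (\<Sum>i\<in>#M. real i * of_bool (set_mset M \<subseteq> T))"
      unfolding M [symmetric] by (simp add: of_nat_sum_mset sum_mset_distrib_right)
    also have "\<dots> = (\<Sum>i\<in>#M. real i * (of_bool (i \<in> T) * of_bool (set_mset (M - {#i#}) \<subseteq> T)))"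
    proof (intro arg_cong[where f = sum_mset] image_mset_cong)
      fix i assume "i \<in># M"
      then have "set_mset M = insert i (set_mset (M - {#i#}))"
        by (metis insert_DiffM set_mset_add_mset_insert)
      then show "real i * of_bool (set_mset M \<subseteq> T) =
         real i * (of_bool (i \<in> T) * of_bool (set_mset (M - {#i#}) \<subseteq> T))" by auto
    qed
    finally show "real n * of_bool (set_mset M \<subseteq> T) =
      (\<Sum>i\<in>#M. real i * (of_bool (i \<in> T) * of_bool (set_mset (M - {#i#}) \<subseteq> T)))" .
  qed
  also have "\<dots> = (\<Sum>i=1..n. of_bool (i \<in> T) * parts_in T (n - i))"
    by (subst permE_marked_cycle) (simp add: parts_in_def permE_cmult)
  also have "\<dots> = (\<Sum>i\<in>{1..n} \<inter> T. parts_in T (n - i))"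
    by (intro sum.mono_neutral_cong_right) auto
  finally show ?thesis .
qed

text \<open>Either no cycle has length i, or one such cycle is removed at the cost of a factor \<open>1 / i\<close>;
  the resulting term is absorbed into the left-hand side.\<close>

lemma parts_in_insert:
  assumes "i \<ge> 2"
  shows "(\<Sum>n<N. parts_in (insert i T) n) \<le> (\<Sum>n<N. parts_in T n) / (1 - 1 / real i)"
proof -
  let ?T = "insert i T"
  have le: "parts_in ?T n \<le> parts_in T n + (if i \<le> n then parts_in ?T (n - i) / real i else 0)" for n
  proof -
    have "parts_in ?T n \<le> permE n (\<lambda>M. of_bool (set_mset M \<subseteq> T) +
        real (count M i) * of_bool (set_mset (M - {#i#}) \<subseteq> ?T))"
      unfolding parts_in_def
    proof (rule permE_mono)
      fix M :: "nat multiset"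
      show "of_bool (set_mset M \<subseteq> ?T) \<le> of_bool (set_mset M \<subseteq> T) +
        real (count M i) * of_bool (set_mset (M - {#i#}) \<subseteq> ?T)"
      proof (cases "set_mset M \<subseteq> ?T \<and> i \<in># M")
        case True
        then have "count M i \<ge> 1" "set_mset (M - {#i#}) \<subseteq> ?T"
          using in_diffD[of _ M "{#i#}"] by (auto simp: Suc_le_eq)
        then show ?thesis by simp
      next
        case False
        then have "set_mset M \<subseteq> ?T \<Longrightarrow> set_mset M \<subseteq> T" by auto
        then show ?thesis by auto
      qed
    qed
    also have "\<dots> = parts_in T n + (if i \<le> n then parts_in ?T (n - i) / real i else 0)"
      unfolding permE_add using assms by (subst permE_count) (auto simp: parts_in_def)
    finally show ?thesis .
  qed
  have "(\<Sum>n<N. parts_in ?T n) \<le> (\<Sum>n<N. parts_in T n) + (\<Sum>n<N. if i \<le> n then parts_in ?T (n - i) / real i else 0)"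
    unfolding sum.distrib [symmetric] by (intro sum_mono le)
  also have "(\<Sum>n<N. if i \<le> n then parts_in ?T (n - i) / real i else 0) =
      (\<Sum>n\<in>{i..<N}. parts_in ?T (n - i) / real i)"
    by (intro sum.mono_neutral_cong_right) auto
  also have "\<dots> = (\<Sum>n<N - i. parts_in ?T n / real i)"
    by (rule sum.reindex_bij_witness[where i = "\<lambda>n. n + i" and j = "\<lambda>n. n - i"]) auto
  also have "\<dots> \<le> (\<Sum>n<N. parts_in ?T n / real i)"
    using parts_in_nonneg by (intro sum_mono2) auto
  also have "\<dots> = (\<Sum>n<N. parts_in ?T n) / real i" by (simp add: sum_divide_distrib)
  finally have "(\<Sum>n<N. parts_in ?T n) * (1 - 1 / real i) \<le> (\<Sum>n<N. parts_in T n)"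
    by (simp add: algebra_simps)
  then show ?thesis using assms by (subst pos_le_divide_eq) auto
qed

text \<open>Only the identity qualifies, so the sum is below e; a geometric bound from the recursion
  is enough.\<close>

lemma parts_in_1: "(\<Sum>n<N. parts_in {1} n) \<le> 4"
proof -
  have w: "parts_in {1} n \<le> 2 * (1 / 2) ^ n" for n
  proof (induction n)
    case 0
    have "parts_in {1} 0 \<le> permE 0 (\<lambda>_. 1)" unfolding parts_in_def by (rule permE_mono) simp
    then show ?case by (simp add: permE_const)
  next
    case (Suc n)
    have "{1..Suc n} \<inter> {1} = {1}" by auto
    then have eq: "real (Suc n) * parts_in {1} (Suc n) = parts_in {1} n"
      using parts_in_rec[of "Suc n" "{1}"] by simp
    show ?case
    proof (cases "n = 0")
      case True
      have "parts_in {1} 0 \<le> permE 0 (\<lambda>_. 1)" unfolding parts_in_def by (rule permE_mono) simp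
      then show ?thesis using eq True by (simp add: permE_const)
    next
      case False
      then have "2 * parts_in {1} (Suc n) \<le> real (Suc n) * parts_in {1} (Suc n)"
        by (intro mult_right_mono parts_in_nonneg) auto
      then show ?thesis using eq Suc by simp
    qed
  qed
  have "(\<Sum>n<N. parts_in {1} n) \<le> (\<Sum>n<N. 2 * (1 / 2) ^ n)" by (intro sum_mono w)
  also have "\<dots> = 2 * ((1 - (1 / 2) ^ N) / (1 - 1 / 2))"
    by (simp add: sum_distrib_left [symmetric] sum_gp_strict)
  also have "\<dots> \<le> 4" by simp
  finally show ?thesis .
qed

text \<open>Length 1 is the starting set because its own factor \<open>1 - 1 / 1\<close> would
  vanish.\<close>

lemma parts_in_le:
  assumes "finite T" "T \<subseteq> {2..}"
  shows "(\<Sum>n<N. parts_in (insert 1 T) n) \<le> 4 / (\<Prod>i\<in>T. 1 - 1 / real i)"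
  using assms
proof (induction T)
  case empty then show ?case using parts_in_1 by simp
next
  case (insert i T)
  have i: "i \<ge> 2" using insert by auto
  have "(\<Sum>n<N. parts_in (insert 1 (insert i T)) n) \<le> (\<Sum>n<N. parts_in (insert 1 T) n) / (1 - 1 / real i)"
    using parts_in_insert[OF i, of "insert 1 T" N] by (simp add: insert_commute)
  also have "\<dots> \<le> (4 / (\<Prod>i\<in>T. 1 - 1 / real i)) / (1 - 1 / real i)"
    using insert i by (intro divide_right_mono) auto
  finally show ?case using insert by (simp add: mult.commute)
qed

text \<open>The permitted lengths are the complement T of U. The summed bound costs the inverse
  product over T, and the telescoping product over \<open>{2..n}\<close> turns this into n times the
  product over U; the n cancels in \<open>parts_in_rec\<close>.\<close>

lemma permE_avoid:
  assumes "U \<subseteq> {2..n}" "n \<ge> 1"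
  shows "permE n (\<lambda>M. of_bool (set_mset M \<inter> U = {})) \<le> 4 * (\<Prod>i\<in>U. 1 - 1 / real i)"
proof -
  define T where "T = {2..n} - U"
  have fU: "finite U" using assms finite_subset by auto
  have memn: "x \<le> n" if "x \<in># M" "\<Sum>\<^sub># M = n" for x M
    using that by (metis le_add1 sum_mset.remove)
  have "permE n (\<lambda>M. of_bool (set_mset M \<inter> U = {})) \<le> parts_in (insert 1 T) n"
    unfolding parts_in_def
  proof (rule permE_mono)
    fix M :: "nat multiset" assume M: "\<Sum>\<^sub># M = n" "0 \<notin># M"
    have "x \<in> insert 1 T" if "x \<in># M" "set_mset M \<inter> U = {}" for x
    proof -
      have "x \<noteq> 0" using that M by metis
      then show ?thesis using that memn[OF that(1) M(1)] by (auto simp: T_def)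
    qed
    then show "of_bool (set_mset M \<inter> U = {}) \<le> (of_bool (set_mset M \<subseteq> insert 1 T) :: real)"
      by auto
  qed
  moreover have "real n * parts_in (insert 1 T) n \<le> real n * (4 * (\<Prod>i\<in>U. 1 - 1 / real i))"
  proof -
    have "real n * parts_in (insert 1 T) n \<le> (\<Sum>i\<in>{1..n}. parts_in (insert 1 T) (n - i))"
      unfolding parts_in_rec by (intro sum_mono2 parts_in_nonneg) auto
    also have "\<dots> = (\<Sum>m<n. parts_in (insert 1 T) m)"
      by (rule sum.reindex_bij_witness[where i = "\<lambda>m. n - m" and j = "\<lambda>i. n - i"]) auto
    also have "\<dots> \<le> 4 / (\<Prod>i\<in>T. 1 - 1 / real i)"
      by (rule parts_in_le) (auto simp: T_def)
    also have "(\<Prod>i\<in>T. 1 - 1 / real i) = 1 / (real n * (\<Prod>i\<in>U. 1 - 1 / real i))"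
    proof -
      have "{2..n} = {1<..n}" by auto
      then have "(\<Prod>i\<in>{2..n}. 1 - 1 / real i) = 1 / real n"
        using assms prod_one_minus_inverse[of 1 n] by simp
      moreover have "(\<Prod>i\<in>{2..n}. 1 - 1 / real i) = (\<Prod>i\<in>T. 1 - 1 / real i) * (\<Prod>i\<in>U. 1 - 1 / real i)"
        unfolding T_def using assms by (subst prod.subset_diff[of U]) auto
      moreover have "(\<Prod>i\<in>U. 1 - 1 / real i) \<noteq> 0"
        using assms fU by (auto simp: prod_zero_iff)
      ultimately show ?thesis by (metis divide_divide_eq_left eq_divide_eq)
    qed
    finally show ?thesis by simp
  qed
  ultimately show ?thesis using assms by simp
qed

section \<open>Comparison with the random set\<close>

text \<open>Removes one cycle of each length in S in turn. As S and U are disjoint, the removals do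
  not affect the avoidance of U.\<close>

lemma permE_prod_count:
  assumes "finite S" "0 \<notin> S" "S \<inter> U = {}"
  shows "permE n (\<lambda>M. (\<Prod>i\<in>S. real (count M i)) * of_bool (set_mset M \<inter> U = {})) =
    (if \<Sum>S \<le> n then (\<Prod>i\<in>S. 1 / real i) * permE (n - \<Sum>S) (\<lambda>M. of_bool (set_mset M \<inter> U = {})) else 0)"
  using assms
proof (induction S arbitrary: n)
  case (insert i S)
  have i: "i \<ge> 1" "i \<notin> U" using insert by (auto simp: Suc_le_eq intro: gr0I)
  have "permE n (\<lambda>M. (\<Prod>i\<in>insert i S. real (count M i)) * of_bool (set_mset M \<inter> U = {})) =
    permE n (\<lambda>M. real (count M i) * ((\<Prod>j\<in>S. real (count (M - {#i#}) j)) *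
      of_bool (set_mset (M - {#i#}) \<inter> U = {})))"
  proof (rule permE_cong)
    fix M :: "nat multiset"
    show "(\<Prod>i\<in>insert i S. real (count M i)) * of_bool (set_mset M \<inter> U = {}) =
      real (count M i) * ((\<Prod>j\<in>S. real (count (M - {#i#}) j)) * of_bool (set_mset (M - {#i#}) \<inter> U = {}))"
    proof (cases "i \<in># M")
      case True
      then have "set_mset M = insert i (set_mset (M - {#i#}))"
        by (metis insert_DiffM set_mset_add_mset_insert)
      then have "set_mset M \<inter> U = set_mset (M - {#i#}) \<inter> U" using i by auto
      moreover have "(\<Prod>j\<in>S. real (count (M - {#i#}) j)) = (\<Prod>j\<in>S. real (count M j))"
        using insert by (intro prod.cong) auto
      ultimately show ?thesis using insert by simp
    next
      case False
      then show ?thesis using insert by (simp add: not_in_iff)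
    qed
  qed
  also have "\<dots> = (if i \<le> n then permE (n - i) (\<lambda>M. (\<Prod>j\<in>S. real (count M j)) *
      of_bool (set_mset M \<inter> U = {})) / real i else 0)"
    using i(1) by (rule permE_count)
  also have "\<dots> = (if \<Sum>(insert i S) \<le> n then (\<Prod>i\<in>insert i S. 1 / real i) *
      permE (n - \<Sum>(insert i S)) (\<lambda>M. of_bool (set_mset M \<inter> U = {})) else 0)"
    using insert by (auto simp: insert.IH)
  finally show ?case .
qed auto

text \<open>A union bound over the possible traces S of the cycle lengths on B. Removing a cycle of
  each length in S costs the product of the \<open>1 / i\<close>, and avoiding \<open>B - S\<close>
  costs what it costs the random set, times 4.\<close>

lemma permE_transfer:
  assumes B: "B \<subseteq> {2..D}" and D: "D < n" "1 \<le> D"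
  shows "permE n (\<lambda>M. of_bool (P (set_mset M \<inter> B))) \<le> 4 * lprob B P + real (card B) / real (n - D)"
proof -
  have fB: "finite B" using B finite_subset by auto
  let ?F = "{S \<in> Pow B. P S \<and> \<Sum>S \<le> n - D}"
  let ?G = "\<lambda>S M. (\<Prod>i\<in>S. real (count M i)) * of_bool (set_mset M \<inter> (B - S) = {})"
  have fF: "finite ?F" using fB by auto
  have Gnn: "?G S M \<ge> 0" for S M by (intro mult_nonneg_nonneg prod_nonneg) auto
  \<comment> \<open>\<open>permE_avoid\<close> calls for at least D remaining points. Traces with a
    larger sum are covered by the second term: the mean number of points in cycles with length in B
    is at most \<open>card B\<close>.\<close>
  have "permE n (\<lambda>M. of_bool (P (set_mset M \<inter> B))) \<le>
     permE n (\<lambda>M. (\<Sum>S\<in>?F. ?G S M) + (\<Sum>i\<in>B. real i / real (n - D) * (real (count M i) * 1)))"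
  proof (rule permE_mono)
    fix M :: "nat multiset"
    define S where "S = set_mset M \<inter> B"
    have fS: "finite S" by (simp add: S_def)
    have nn1: "(\<Sum>S\<in>?F. ?G S M) \<ge> 0" by (intro sum_nonneg Gnn)
    have nn2: "(\<Sum>i\<in>B. real i / real (n - D) * (real (count M i) * 1)) \<ge> 0"
      by (intro sum_nonneg) auto
    show "of_bool (P (set_mset M \<inter> B)) \<le> (\<Sum>S\<in>?F. ?G S M) +
        (\<Sum>i\<in>B. real i / real (n - D) * (real (count M i) * 1))"
    proof (cases "P S")
      case True
      show ?thesis
      proof (cases "\<Sum>S \<le> n - D")
        case le: True
        then have SF: "S \<in> ?F" using True by (auto simp: S_def)
        have "1 \<le> (\<Prod>i\<in>S. real (count M i))"
          by (intro prod_ge_1) (auto simp: S_def Suc_le_eq)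
        moreover have "set_mset M \<inter> (B - S) = {}" by (auto simp: S_def)
        ultimately have "1 \<le> ?G S M" by simp
        also have "\<dots> \<le> (\<Sum>S\<in>?F. ?G S M)"
          using SF fF Gnn by (intro member_le_sum) auto
        finally show ?thesis using nn2 by (simp add: of_bool_def)
      next
        case False
        then have "real (n - D) \<le> (\<Sum>i\<in>S. real i)" by (simp flip: of_nat_sum)
        also have "\<dots> \<le> (\<Sum>i\<in>S. real i * real (count M i))"
          by (intro sum_mono) (auto simp: S_def Suc_le_eq mult_le_cancel_left1)
        also have "\<dots> \<le> (\<Sum>i\<in>B. real i * real (count M i))"
          using fB by (intro sum_mono2) (auto simp: S_def)
        finally have "1 \<le> (\<Sum>i\<in>B. real i * real (count M i)) / real (n - D)" using D by simp
        also have "\<dots> = (\<Sum>i\<in>B. real i / real (n - D) * (real (count M i) * 1))"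
          by (simp add: sum_divide_distrib)
        finally show ?thesis using nn1 by (simp add: of_bool_def)
      qed
    qed (use nn1 nn2 in \<open>auto simp: S_def\<close>)
  qed
  also have "\<dots> = (\<Sum>S\<in>?F. permE n (?G S)) + (\<Sum>i\<in>B. real i / real (n - D) * permE n (\<lambda>M. real (count M i) * 1))"
    using fF fB by (simp only: permE_add permE_sum permE_cmult)
  also have "(\<Sum>S\<in>?F. permE n (?G S)) \<le> (\<Sum>S\<in>?F. 4 * log_weight B S)"
  proof (intro sum_mono)
    fix S assume S: "S \<in> ?F"
    then have SB: "S \<subseteq> B" "\<Sum>S \<le> n - D" by auto
    have fS: "finite S" using SB fB finite_subset by auto
    have "permE n (?G S) = (\<Prod>i\<in>S. 1 / real i) * permE (n - \<Sum>S) (\<lambda>M. of_bool (set_mset M \<inter> (B - S) = {}))"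
      using SB B fS by (subst permE_prod_count) auto
    also have "\<dots> \<le> (\<Prod>i\<in>S. 1 / real i) * (4 * (\<Prod>i\<in>B - S. 1 - 1 / real i))"
    proof (intro mult_left_mono permE_avoid prod_nonneg)
      show "B - S \<subseteq> {2..n - \<Sum>S}" using SB(2) B D by force
    qed (use SB D in auto)
    also have "\<dots> = 4 * log_weight B S"
    proof -
      have "log_weight B S = (\<Prod>i\<in>B - S. if i \<in> S then 1 / real i else 1 - 1 / real i) *
          (\<Prod>i\<in>S. if i \<in> S then 1 / real i else 1 - 1 / real i)"
        unfolding log_weight_def using SB fB by (intro prod.subset_diff) auto
      also have "(\<Prod>i\<in>B - S. if i \<in> S then 1 / real i else 1 - 1 / real i) = (\<Prod>i\<in>B - S. 1 - 1 / real i)"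
        by (intro prod.cong) auto
      also have "(\<Prod>i\<in>S. if i \<in> S then 1 / real i else 1 - 1 / real i) = (\<Prod>i\<in>S. 1 / real i)"
        by (intro prod.cong) auto
      finally show ?thesis by simp
    qed
    finally show "permE n (?G S) \<le> 4 * log_weight B S" .
  qed
  also have "(\<Sum>S\<in>?F. 4 * log_weight B S) \<le> 4 * lprob B P"
  proof -
    have "(\<Sum>S\<in>?F. log_weight B S) \<le> (\<Sum>S\<in>Pow B. log_weight B S * of_bool (P S))"
      using fB log_weight_nonneg by (subst sum.mono_neutral_cong_right[of "Pow B" "{S \<in> Pow B. P S}"
          "\<lambda>S. log_weight B S * of_bool (P S)" "log_weight B"]) (auto intro!: sum_mono2)
    then show ?thesis by (simp add: lprob_def lexp_def sum_distrib_left [symmetric])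
  qed
  also have "(\<Sum>i\<in>B. real i / real (n - D) * permE n (\<lambda>M. real (count M i) * 1)) \<le> (\<Sum>i\<in>B. 1 / real (n - D))"
  proof (intro sum_mono)
    fix i assume "i \<in> B"
    then have "i \<ge> 1" using B by auto
    then have "real i * permE n (\<lambda>M. real (count M i) * 1) \<le> 1"
      by (subst permE_count) (auto simp: permE_const)
    then show "real i / real (n - D) * permE n (\<lambda>M. real (count M i) * 1) \<le> 1 / real (n - D)"
      by (simp add: divide_right_mono)
  qed
  finally show ?thesis by simp
qed

section \<open>Concentration of divisors\<close>

lemma beta_set_0: "0 \<in> {c. c < 1 \<and> (equal_sums_prob k c \<longlongrightarrow> 1) at_top}"
  using equal_sums_prob_0_tendsto by simp

lemma beta_set_bdd: "bdd_above {c :: real. c < 1 \<and> P c}"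
  by (rule bdd_aboveI[of _ 1]) auto

lemma beta_nonneg: "0 \<le> beta k"
  unfolding beta_def by (rule cSup_upper[OF beta_set_0 beta_set_bdd])

lemma beta_le:
  assumes "\<And>c. 0 < c \<Longrightarrow> c < 1 \<Longrightarrow> (equal_sums_prob k c \<longlongrightarrow> 1) at_top \<Longrightarrow> c \<le> b" "0 \<le> b"
  shows "beta k \<le> b"
  unfolding beta_def
proof (rule cSup_least)
  show "{c. c < 1 \<and> (equal_sums_prob k c \<longlongrightarrow> 1) at_top} \<noteq> {}" using beta_set_0 by blast
  fix c assume "c \<in> {c. c < 1 \<and> (equal_sums_prob k c \<longlongrightarrow> 1) at_top}"
  then show "c \<le> b" using assms by (cases "c > 0") auto
qed

lemma beta_le_1: "beta k \<le> 1"
  by (rule beta_le) auto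

text \<open>Solves \<open>equal_sums_bound\<close> for c: with the least admissible i it reads
  \<open>k \<le> (4 / c) ^ 480\<close>.\<close>

lemma beta_upper:
  assumes k: "k \<ge> 1"
  shows "beta k \<le> 4 * real k powr (- 1 / 480)"
proof (rule beta_le)
  fix c :: real
  assume c: "0 < c" "c < 1" and lim: "(equal_sums_prob k c \<longlongrightarrow> 1) at_top"
  define i where "i = nat \<lceil>log 2 (2 / c)\<rceil>"
  have pos: "log 2 (2 / c) \<ge> 0" using c by simp
  have i: "log 2 (2 / c) \<le> real i" "real i \<le> log 2 (2 / c) + 1"
    using pos unfolding i_def by linarith+
  have "2 / c = 2 powr (log 2 (2 / c))" using c by simp
  also have "\<dots> \<le> 2 powr real i" using i by (intro powr_mono) auto
  finally have "2 / c \<le> 2 ^ i" by (simp add: powr_realpow)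
  then have "k \<le> mult_const ^ i" using c lim by (intro equal_sums_bound) auto
  then have "real k \<le> real (mult_const ^ i)" by (simp only: of_nat_le_iff)
  also have "\<dots> = (2 ^ 480) ^ i" by (simp only: mult_const_def of_nat_power of_nat_numeral)
  also have "\<dots> = 2 powr (480 * real i)"
    using powr_realpow[of 2 "480 * i"] by (simp only: power_mult) simp
  also have "\<dots> \<le> 2 powr (480 * (log 2 (2 / c) + 1))" using i by (intro powr_mono) auto
  finally have "real k powr (1 / 480) \<le> (2 powr (480 * (log 2 (2 / c) + 1))) powr (1 / 480)"
    by (intro powr_mono2) auto
  also have "\<dots> = 2 powr (log 2 (2 / c) + 1)" 
  proof -
    have "(2 powr (480 * u)) powr (1 / 480) = 2 powr u" for u :: real by (simp add: powr_powr)
    then show ?thesis .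
  qed
  also have "\<dots> = 4 / c" using c by (simp add: powr_add)
  finally have "real k powr (1 / 480) * c \<le> 4" using c by (simp add: field_simps)
  then have "c \<le> 4 / real k powr (1 / 480)" using k by (simp add: field_simps)
  then show "c \<le> 4 * real k powr (- 1 / 480)" 
    using powr_minus_divide[of "real k" "1 / 480"] by simp
qed auto

text \<open>If \<open>beta k = 0\<close>, then the quotient in the definition of \<open>zeta\<close> is 0, by \<open>1 / 0 = 0\<close>
  and \<open>ln 0 = 0\<close>.\<close>

lemma zeta_real: "\<exists>z. zeta = ereal z"
proof -
  let ?r = "\<lambda>k. ereal (ln (real k) / ln (1 / beta k))"
  have "?r k \<ge> 0" for k
  proof (cases "k = 0 \<or> beta k = 0")
    case False
    then have "0 < beta k" using beta_nonneg[of k] by linarith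
    then have "1 / beta k \<ge> 1" using beta_le_1[of k] by (simp add: field_simps)
    then show ?thesis using False by auto
  qed auto
  then have lo: "0 \<le> zeta" unfolding zeta_def by (intro le_Limsup always_eventually) auto
  \<comment> \<open>Doubling 480 swallows the constant 4.\<close>
  have "eventually (\<lambda>k. 4 * real k powr (- 1 / 480) \<le> real k powr (- 1 / 960)) sequentially"
    by real_asymp
  then have "eventually (\<lambda>k. ?r k \<le> 960) sequentially"
    using eventually_ge_at_top[of 2]
  proof eventually_elim
    case (elim k)
    have lnk: "ln (real k) > 0" using elim by simp
    show ?case
    proof (cases "beta k = 0")
      case False
      then have b: "0 < beta k" using beta_nonneg[of k] by linarith
      have "beta k \<le> real k powr (- 1 / 960)" using beta_upper[of k] elim by linarith
      then have "ln (beta k) \<le> ln (real k powr (- 1 / 960))"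
        using b elim by (subst ln_le_cancel_iff) auto
      also have "\<dots> = - 1 / 960 * ln (real k)" using elim by (simp add: ln_powr)
      finally have "ln (1 / beta k) \<ge> ln (real k) / 960" using b by (simp add: ln_div)
      then have "ln (real k) / ln (1 / beta k) \<le> ln (real k) / (ln (real k) / 960)"
        using lnk by (intro divide_left_mono mult_pos_pos) auto
      then show ?thesis using lnk by simp
    qed auto
  qed
  then have hi: "zeta \<le> 960" unfolding zeta_def by (rule Limsup_bounded)
  show ?thesis using lo hi by (cases zeta) auto
qed

section \<open>From equal sums of cycle lengths to divisors\<close>

lemma has_equal_sums_blocks:
  assumes "finite G" "finite L" "\<And>j. j \<in> G \<Longrightarrow> has_equal_sums k (L \<inter> B j)"
    "\<And>i j. i \<in> G \<Longrightarrow> j \<in> G \<Longrightarrow> i \<noteq> j \<Longrightarrow> B i \<inter> B j = {}"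
  shows "has_equal_sums (k ^ card G) (L \<inter> (\<Union>j\<in>G. B j))"
  using assms
proof (induction G rule: finite_induct)
  case empty then show ?case by (simp add: has_equal_sums_1)
next
  case (insert j G)
  have "has_equal_sums (k * k ^ card G) ((L \<inter> B j) \<union> (L \<inter> (\<Union>j\<in>G. B j)))"
    using insert by (intro has_equal_sums_Un insert.IH) blast+
  moreover have "(L \<inter> B j) \<union> (L \<inter> (\<Union>j\<in>G. B j)) = L \<inter> (\<Union>j\<in>insert j G. B j)" by auto
  ultimately show ?case using insert by simp
qed

text \<open>The maximum is over all r, but every count is at most the number of divisors, so the set
  of values is finite and \<open>Max\<close> is meaningful.\<close>

lemma perm_Delta_ge:
  "card {d \<in> perm_divisors n \<sigma>. divisor_length d = r} \<le> perm_Delta n \<sigma>"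
proof -
  have fin: "finite (perm_divisors n \<sigma>)" by (simp add: perm_divisors_def perm_cycles_def)
  have "range (\<lambda>r. card {d \<in> perm_divisors n \<sigma>. divisor_length d = r}) \<subseteq> {..card (perm_divisors n \<sigma>)}"
    using fin by (auto intro!: card_mono)
  then have "finite (range (\<lambda>r. card {d \<in> perm_divisors n \<sigma>. divisor_length d = r}))"
    using finite_subset by blast
  then show ?thesis unfolding perm_Delta_def by (rule Max_ge) auto
qed

lemma perm_Delta_ge_1: "1 \<le> perm_Delta n \<sigma>"
proof -
  have "{} \<in> {d \<in> perm_divisors n \<sigma>. divisor_length d = 0}"
    by (simp add: perm_divisors_def divisor_length_def)
  moreover have "finite {d \<in> perm_divisors n \<sigma>. divisor_length d = 0}"
    by (simp add: perm_divisors_def perm_cycles_def)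
  ultimately have "card {d \<in> perm_divisors n \<sigma>. divisor_length d = 0} > 0"
    by (auto simp: card_gt_0_iff)
  then show ?thesis using perm_Delta_ge[of n \<sigma> 0] by linarith
qed

text \<open>Choosing one cycle of each occurring length maps sets of lengths injectively to divisors
  and sums to lengths of divisors.\<close>

lemma perm_Delta_ge_equal_sums:
  assumes p: "p permutes {1..n}" and K: "has_equal_sums K (set_mset (cycle_type n p))"
  shows "K \<le> perm_Delta n p"
proof -
  let ?L = "set_mset (cycle_type n p)"
  have L: "?L = card ` perm_cycles n p"
    using perm_cycle_facts(4)[OF p] by (simp add: cycle_type_def)
  obtain F s where F: "finite F" "F \<subseteq> Pow ?L" "\<And>X. X \<in> F \<Longrightarrow> \<Sum>X = s" "card F = K"
    using has_equal_sumsE[OF K] by blast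
  define f where "f = inv_into (perm_cycles n p) card"
  have f: "f a \<in> perm_cycles n p" "card (f a) = a" if "a \<in> ?L" for a
    using that unfolding L f_def by (auto intro: inv_into_into f_inv_into_f)
  have inj: "inj_on f ?L" using f(2) by (metis inj_onI)
  have injF: "inj_on ((`) f) F"
    using inj F(2) by (intro inj_onI) (meson PowD inj_on_image_eq_iff subsetD)
  have "(`) f ` F \<subseteq> {d \<in> perm_divisors n p. divisor_length d = s}"
  proof
    fix d assume "d \<in> (`) f ` F"
    then obtain X where X: "X \<in> F" "d = f ` X" by auto
    then have XL: "X \<subseteq> ?L" using F by auto
    have "divisor_length d = (\<Sum>a\<in>X. card (f a))"
      unfolding divisor_length_def X using inj_on_subset[OF inj XL] by (subst sum.reindex) auto
    also have "\<dots> = \<Sum>X" using XL f by (intro sum.cong) auto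
    finally show "d \<in> {d \<in> perm_divisors n p. divisor_length d = s}"
      using F X XL f by (auto simp: perm_divisors_def)
  qed
  moreover have "finite {d \<in> perm_divisors n p. divisor_length d = s}"
    by (simp add: perm_divisors_def perm_cycles_def)
  ultimately have "card ((`) f ` F) \<le> card {d \<in> perm_divisors n p. divisor_length d = s}"
    by (intro card_mono)
  then show ?thesis using perm_Delta_ge[of n p s] injF F(4) by (simp add: card_image)
qed

lemma card_perm_le_permE:
  assumes "\<And>p. p permutes {1..n} \<Longrightarrow> P p \<Longrightarrow> 1 \<le> F (cycle_type n p)" "\<And>M. 0 \<le> F M"
  shows "real (card {p. p permutes {1..n} \<and> P p}) / fact n \<le> permE n F"
proof -
  have fin: "finite {p. p permutes {1..n}}" by (simp add: finite_permutations)
  have "real (card {p. p permutes {1..n} \<and> P p}) = (\<Sum>p | p permutes {1..n} \<and> P p. 1)" by simp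
  also have "\<dots> \<le> (\<Sum>p | p permutes {1..n} \<and> P p. F (cycle_type n p))"
    using assms by (intro sum_mono) auto
  also have "\<dots> \<le> (\<Sum>p | p permutes {1..n}. F (cycle_type n p))"
    using assms fin by (intro sum_mono2) auto
  finally show ?thesis unfolding permE_def by (intro divide_right_mono) auto
qed

section \<open>One block, then many blocks\<close>

definition log_block :: "real \<Rightarrow> real \<Rightarrow> nat set" where
  "log_block c D = {a. 1 \<le> a \<and> D powr c \<le> real a \<and> real a \<le> D}"

text \<open>\<open>2 \<le> D powr c\<close> keeps the length 1 out of the block, as
  \<open>permE_transfer\<close> demands. The common bound m will be \<open>sqrt n\<close>, which
  makes the error term vanish uniformly over the blocks.\<close>

lemma permE_block_fails:
  assumes prob: "1 - \<delta> \<le> equal_sums_prob k c D" and D: "2 \<le> D powr c" "D \<le> m" and m: "1 \<le> m" "m < real n"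
  shows "permE n (\<lambda>M. of_bool (\<not> has_equal_sums k (set_mset M \<inter> log_block c D))) \<le> 4 * \<delta> + m / (real n - m)"
proof -
  define N where "N = nat \<lfloor>m\<rfloor>"
  have N: "real N \<le> m" "1 \<le> N" "N < n" using m unfolding N_def by linarith+
  have sub: "log_block c D \<subseteq> {2..N}"
  proof
    fix a assume a: "a \<in> log_block c D"
    have "real a \<ge> 2" "real a \<le> m" using a D by (auto simp: log_block_def)
    then show "a \<in> {2..N}" unfolding N_def by (simp add: le_nat_floor)
  qed
  have fin: "finite (log_block c D)" using sub finite_subset by auto
  have "permE n (\<lambda>M. of_bool (\<not> has_equal_sums k (set_mset M \<inter> log_block c D))) \<le>
     4 * lprob (log_block c D) (\<lambda>S. \<not> has_equal_sums k S) + real (card (log_block c D)) / real (n - N)"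
    using permE_transfer[OF sub N(3,2), of "\<lambda>S. \<not> has_equal_sums k S"] .
  also have "lprob (log_block c D) (\<lambda>S. \<not> has_equal_sums k S) \<le> \<delta>"
    using prob fin by (simp add: lprob_compl equal_sums_prob_eq log_block_def)
  also have "real (card (log_block c D)) / real (n - N) \<le> m / (real n - m)"
  proof (rule frac_le)
    have "card (log_block c D) \<le> card {2..N}" using sub by (intro card_mono) auto
    then show "real (card (log_block c D)) \<le> m" using N by simp
    show "real n - m \<le> real (n - N)" using N by simp
  qed (use m in auto)
  finally show ?thesis by simp
qed

text \<open>Equal sums are collected separately in the blocks \<open>[D\<^sub>j powr c, D\<^sub>j]\<close> with
  \<open>D\<^sub>j = sqrt n powr (c' ^ j)\<close>; choosing \<open>c' < c\<close> makes consecutive blocks disjoint. By Markov's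
  inequality all but a proportion \<open>\<theta>\<close> of the blocks succeed for most permutations.\<close>

lemma Delta_large_density:
  assumes c: "0 < c'" "c' < c" "c < 1" and k: "2 \<le> k"
    and lim: "(equal_sums_prob k c \<longlongrightarrow> 1) at_top"
    and a: "0 < a" "a * ln (1 / c') < ln (real k)"
  shows "(\<lambda>n. real (card {\<sigma>. \<sigma> permutes {1..n} \<and>
      \<not> ln (real n) powr a \<le> real (perm_Delta n \<sigma>)}) / fact n) \<longlonglongrightarrow> 0"
proof (rule LIMSEQ_I)
  fix r :: real assume r: "r > 0"
  define lc where "lc = ln (1 / c')"
  define lk where "lk = ln (real k)"
  have lc: "lc > 0" using c by (simp add: lc_def ln_div)
  have lk: "lk > 0" using k by (simp add: lk_def)
  have alk: "a * lc < lk" using a by (simp add: lc_def lk_def)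
  \<comment> \<open>Spends half of the slack: \<kappa> becomes the midpoint of a and
    \<open>lk / lc\<close>. About \<open>ln (ln n) / lc\<close> blocks, of which a proportion
    \<open>1 - \<theta>\<close> each give a factor k, yield \<open>ln n\<close> to a power near
    \<kappa>.\<close>
  define \<theta> where "\<theta> = (1 - a * lc / lk) / 2"
  have "a * lc > 0" using a lc by simp
  then have \<theta>: "0 < \<theta>" "\<theta> < 1" using alk lk by (auto simp: \<theta>_def field_simps)
  define \<kappa> where "\<kappa> = (1 - \<theta>) * lk / lc"
  have \<kappa>: "a < \<kappa>"
  proof -
    have "\<kappa> = (lk + a * lc) / (2 * lc)" using lk lc by (simp add: \<kappa>_def \<theta>_def field_simps)
    moreover have "a * (2 * lc) < lk + a * lc" using alk by simp
    ultimately show ?thesis using lc by (simp add: pos_less_divide_eq)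
  qed
  \<comment> \<open>A block fails with probability at most \<open>5 * \<delta>\<close> and Markov's
    inequality divides by \<theta>, so the total is \<open>5 * r / 12\<close>.\<close>
  define \<delta> where "\<delta> = r * \<theta> / 12"
  have \<delta>: "\<delta> > 0" using r \<theta> by (simp add: \<delta>_def)
  have "eventually (\<lambda>D. 1 - \<delta> < equal_sums_prob k c D) at_top"
    using lim \<delta> by (intro order_tendstoD) auto
  moreover have "eventually (\<lambda>D::real. 2 \<le> D powr c) at_top" using c by real_asymp
  ultimately have "eventually (\<lambda>D. 1 - \<delta> \<le> equal_sums_prob k c D \<and> 2 \<le> D powr c) at_top"
    by eventually_elim auto
  then obtain D1 where D1: "\<And>D. D \<ge> D1 \<Longrightarrow> 1 - \<delta> \<le> equal_sums_prob k c D \<and> 2 \<le> D powr c"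
    unfolding eventually_at_top_linorder by blast
  define D0 where "D0 = max D1 2"
  define l0 where "l0 = ln D0"
  have l0: "l0 > 0" by (simp add: l0_def D0_def)
  \<comment> \<open>\<open>D j \<ge> D0\<close> means \<open>c' ^ j * ln m \<ge> l0\<close>, that
    is, \<open>j \<le> ln (ln m / l0) / lc\<close>.\<close>
  define J where "J n = nat \<lfloor>ln (ln (sqrt (real n)) / l0) / lc\<rfloor>" for n
  have ev1: "eventually (\<lambda>n. sqrt (real n) / (real n - sqrt (real n)) < \<delta>) sequentially"
    using \<delta> by (intro order_tendstoD[where y = "0::real"]) (real_asymp, simp)
  \<comment> \<open>The subtracted \<open>(1 - \<theta>) * lk\<close> pays for rounding down in
    \<open>J\<close>; the gap \<open>\<kappa> - a\<close> absorbs this and the constants.\<close>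
  have ev2: "eventually (\<lambda>n. \<kappa> * ln (ln (sqrt (real n)) / l0) - (1 - \<theta>) * lk \<ge> a * ln (ln (real n))) sequentially"
  proof -
    have ev: "eventually (\<lambda>n. ln (ln (real n)) \<ge> (\<kappa> * ln (2 * l0) + (1 - \<theta>) * lk) / (\<kappa> - a)) sequentially"
      by real_asymp
    show ?thesis using ev eventually_gt_at_top[of 3]
    proof eventually_elim
      case (elim n)
      have "ln (real n) > 0" using elim by simp
      then have eq: "ln (ln (sqrt (real n)) / l0) = ln (ln (real n)) - ln (2 * l0)"
        using elim l0 by (simp add: ln_sqrt ln_div ln_mult)
      have "(\<kappa> - a) * ln (ln (real n)) \<ge> \<kappa> * ln (2 * l0) + (1 - \<theta>) * lk"
        using elim \<kappa> by (simp add: pos_divide_le_eq mult.commute)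
      then show ?case unfolding eq right_diff_distrib left_diff_distrib by linarith
    qed
  qed
  have ev3: "eventually (\<lambda>n. l0 * exp (2 * lc) \<le> ln (sqrt (real n))) sequentially" by real_asymp
  have "eventually (\<lambda>n. real (card {\<sigma>. \<sigma> permutes {1..n} \<and>
      \<not> ln (real n) powr a \<le> real (perm_Delta n \<sigma>)}) / fact n < r) sequentially"
    using ev1 ev2 ev3 eventually_gt_at_top[of 3]
  proof eventually_elim
    case (elim n)
    define m where "m = sqrt (real n)"
    define D where "D j = m powr (c' ^ j)" for j :: nat
    define B where "B j = log_block c (D j)" for j
    define bad where "bad j M \<longleftrightarrow> \<not> has_equal_sums k (set_mset M \<inter> B j)" for j M
    have "sqrt (real n) < sqrt (real n * real n)" using elim by (intro real_sqrt_less_mono) auto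
    then have m: "1 < m" "m < real n" using elim by (auto simp: m_def)
    have lnm: "ln m > 0" using m by simp
    have D1m: "1 < D j" for j using m c by (simp add: D_def)
    have J1: "real (J n) \<le> ln (ln m / l0) / lc" "ln (ln m / l0) / lc < real (J n) + 1" "1 \<le> J n"
    proof -
      have "exp (2 * lc) \<le> ln m / l0" using elim l0 by (simp add: m_def field_simps)
      then have "ln (exp (2 * lc)) \<le> ln (ln m / l0)" by (subst ln_le_cancel_iff) (auto intro: less_le_trans[OF exp_gt_zero])
      then have "2 \<le> ln (ln m / l0) / lc" using lc by (simp add: field_simps)
      then show "real (J n) \<le> ln (ln m / l0) / lc" "ln (ln m / l0) / lc < real (J n) + 1" "1 \<le> J n"
        unfolding J_def m_def [symmetric] by linarith+
    qed
    have DD: "D0 \<le> D j" "D j \<le> m" if "j \<le> J n" for j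
    proof -
      have "real j * lc \<le> real (J n) * lc" using that lc by (intro mult_right_mono) auto
      also have "\<dots> \<le> ln (ln m / l0)" using J1(1) lc by (simp add: pos_le_divide_eq)
      finally have "exp (real j * lc) \<le> exp (ln (ln m / l0))" by simp
      then have "exp (real j * lc) \<le> ln m / l0" using lnm l0 by simp
      moreover have "exp (real j * lc) = (1 / c') ^ j"
        using c by (simp add: lc_def exp_of_nat_mult)
      ultimately have "(1 / c') ^ j * l0 \<le> ln m" using l0 by (simp add: pos_le_divide_eq)
      then have "c' ^ j * ((1 / c') ^ j * l0) \<le> c' ^ j * ln m" using c by (intro mult_left_mono) auto
      moreover have "c' ^ j * (1 / c') ^ j = 1" using c by (simp flip: power_mult_distrib)
      ultimately have "l0 \<le> c' ^ j * ln m" by (simp flip: mult.assoc)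
      then have "exp l0 \<le> exp (c' ^ j * ln m)" by simp
      then show "D0 \<le> D j" using m by (simp add: l0_def D0_def D_def powr_def)
      have "c' ^ j \<le> 1" using c by (intro power_le_one) auto
      then have "D j \<le> m powr 1" unfolding D_def using m by (intro powr_mono) auto
      then show "D j \<le> m" using m by simp
    qed
    have disj: "B i \<inter> B j = {}" if "i < j" for i j
    proof -
      have "D j \<le> D (Suc i)" unfolding D_def using that m c by (intro powr_mono power_decreasing) auto
      also have "\<dots> = D i powr c'" by (simp add: D_def powr_powr mult.commute)
      also have "\<dots> < D i powr c" using D1m[of i] c by (intro powr_less_mono) auto
      finally show ?thesis by (auto simp: B_def log_block_def)
    qed
    have each: "permE n (\<lambda>M. of_bool (bad j M)) \<le> 5 * \<delta>" if "j < J n" for j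
    proof -
      have Dj: "D0 \<le> D j" "D j \<le> m" using DD[of j] that by auto
      then have "D1 \<le> D j" by (simp add: D0_def)
      then have "permE n (\<lambda>M. of_bool (bad j M)) \<le> 4 * \<delta> + m / (real n - m)"
        unfolding bad_def B_def using D1[of "D j"] Dj m by (intro permE_block_fails) auto
      then show ?thesis using elim by (simp add: m_def)
    qed
    let ?F = "\<lambda>M. 1 / (\<theta> * real (J n)) * (\<Sum>j<J n. of_bool (bad j M))"
    have "real (card {\<sigma>. \<sigma> permutes {1..n} \<and> \<not> ln (real n) powr a \<le> real (perm_Delta n \<sigma>)}) / fact n \<le> permE n ?F"
    proof (rule card_perm_le_permE)
      fix p assume p: "p permutes {1..n}" and small: "\<not> ln (real n) powr a \<le> real (perm_Delta n p)"
      show "1 \<le> ?F (cycle_type n p)"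
      proof (rule ccontr)
        assume neg: "\<not> 1 \<le> ?F (cycle_type n p)"
        let ?M = "cycle_type n p"
        define G where "G = {j \<in> {..<J n}. \<not> bad j ?M}"
        have "(\<Sum>j<J n. of_bool (bad j ?M)) = real (card {j \<in> {..<J n}. bad j ?M})"
          by (simp add: of_bool_def sum.If_cases Int_def)
        then have "real (card {j \<in> {..<J n}. bad j ?M}) < \<theta> * real (J n)"
          using neg \<theta> J1(3) by (simp add: field_simps)
        moreover have "card {j \<in> {..<J n}. bad j ?M} + card G = J n"
        proof -
          have "card ({j \<in> {..<J n}. bad j ?M} \<union> G) = card {j \<in> {..<J n}. bad j ?M} + card G"
            by (rule card_Un_disjoint) (auto simp: G_def)
          moreover have "{j \<in> {..<J n}. bad j ?M} \<union> G = {..<J n}" by (auto simp: G_def)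
          ultimately show ?thesis by simp
        qed
        ultimately have cG: "(1 - \<theta>) * real (J n) \<le> real (card G)" by (simp add: algebra_simps)
        have "has_equal_sums (k ^ card G) (set_mset ?M \<inter> (\<Union>j\<in>G. B j))"
        proof (rule has_equal_sums_blocks)
          show "has_equal_sums k (set_mset ?M \<inter> B j)" if "j \<in> G" for j
            using that by (simp add: G_def bad_def)
          show "B i \<inter> B j = {}" if "i \<noteq> j" for i j
            using disj[of i j] disj[of j i] that by (cases "i < j") auto
        qed (auto simp: G_def)
        then have "has_equal_sums (k ^ card G) (set_mset ?M)"
          by (rule has_equal_sums_mono) auto
        then have "k ^ card G \<le> perm_Delta n p" by (rule perm_Delta_ge_equal_sums[OF p])
        then have "real k ^ card G \<le> real (perm_Delta n p)" by (metis of_nat_le_iff of_nat_power)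
        moreover have "ln (real n) powr a \<le> real k ^ card G"
        proof -
          have lnn: "ln (real n) > 0" using elim by simp
          have "a * ln (ln (real n)) \<le> \<kappa> * ln (ln m / l0) - (1 - \<theta>) * lk"
            using elim by (simp add: m_def)
          also have "\<dots> = (1 - \<theta>) * lk * (ln (ln m / l0) / lc - 1)"
            by (simp add: \<kappa>_def algebra_simps)
          also have "\<dots> \<le> (1 - \<theta>) * lk * real (J n)"
            using J1 \<theta> lk by (intro mult_left_mono) auto
          also have "\<dots> \<le> real (card G) * lk"
            using cG lk mult_right_mono[OF cG, of lk] by (simp add: algebra_simps)
          finally have "exp (a * ln (ln (real n))) \<le> exp (real (card G) * lk)" by simp
          then show ?thesis using lnn k by (simp add: powr_def exp_of_nat_mult lk_def)
        qed
        ultimately show False using small by linarith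
      qed
    qed (use \<theta> in \<open>auto intro!: mult_nonneg_nonneg sum_nonneg\<close>)
    also have "permE n ?F = 1 / (\<theta> * real (J n)) * (\<Sum>j<J n. permE n (\<lambda>M. of_bool (bad j M)))"
      by (simp only: permE_cmult permE_sum finite_lessThan)
    also have "\<dots> \<le> 1 / (\<theta> * real (J n)) * (\<Sum>j<J n. 5 * \<delta>)"
      using each \<theta> by (intro mult_left_mono sum_mono) auto
    also have "\<dots> = 5 * \<delta> / \<theta>" using J1(3) by simp
    also have "\<dots> < r" using \<theta> r by (simp add: \<delta>_def)
    finally show ?case .
  qed
  then obtain N where N: "\<And>n. n \<ge> N \<Longrightarrow> real (card {\<sigma>. \<sigma> permutes {1..n} \<and>
      \<not> ln (real n) powr a \<le> real (perm_Delta n \<sigma>)}) / fact n < r"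
    unfolding eventually_sequentially by blast
  show "\<exists>no. \<forall>n\<ge>no. norm (real (card {\<sigma>. \<sigma> permutes {1..n} \<and>
      \<not> ln (real n) powr a \<le> real (perm_Delta n \<sigma>)}) / fact n - 0) < r"
    using N by (intro exI[of _ N]) auto
qed

text \<open>A limsup above a supplies one k with quotient above a, hence admissible c and a smaller
  c' that still satisfy the inequality of \<open>Delta_large_density\<close>.\<close>

lemma Delta_density:
  assumes "ereal a < zeta"
  shows "(\<lambda>n. real (card {\<sigma>. \<sigma> permutes {1..n} \<and>
      \<not> ln (real n) powr a \<le> real (perm_Delta n \<sigma>)}) / fact n) \<longlonglongrightarrow> 0"
proof (cases "a > 0")
  case False
  have "eventually (\<lambda>n. real (card {\<sigma>. \<sigma> permutes {1..n} \<and>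
      \<not> ln (real n) powr a \<le> real (perm_Delta n \<sigma>)}) / fact n = 0) sequentially"
    using eventually_ge_at_top[of 3]
  proof eventually_elim
    case (elim n)
    have "exp 1 \<le> real n" using elim e_less_272 by linarith
    then have "1 \<le> ln (real n)" using elim by (subst ln_ge_iff) auto
    then have "ln (real n) powr a \<le> ln (real n) powr 0" using False by (intro powr_mono) auto
    also have "\<dots> \<le> 1" by simp
    finally have "ln (real n) powr a \<le> real (perm_Delta n \<sigma>)" for \<sigma>
      using perm_Delta_ge_1[of n \<sigma>] by linarith
    then have eq: "{\<sigma>. \<sigma> permutes {1..n} \<and> \<not> ln (real n) powr a \<le> real (perm_Delta n \<sigma>)} = {}" by auto
    show ?case unfolding eq by simp
  qed
  then show ?thesis by (rule tendsto_eventually)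
next
  case a: True
  have "\<not> (\<forall>k. ln (real k) / ln (1 / beta k) \<le> a)"
  proof
    assume "\<forall>k. ln (real k) / ln (1 / beta k) \<le> a"
    then have "zeta \<le> ereal a" unfolding zeta_def by (intro Limsup_bounded always_eventually) auto
    then show False using assms by simp
  qed
  then obtain k where k: "a < ln (real k) / ln (1 / beta k)" by (auto simp: not_le)
  \<comment> \<open>A nonzero quotient excludes the default values of division and logarithm: k is
    at least 2, and \<open>beta k\<close> is neither 0 nor 1.\<close>
  then have "ln (real k) / ln (1 / beta k) \<noteq> 0" using a by linarith
  then have nz: "ln (real k) \<noteq> 0" "ln (1 / beta k) \<noteq> 0" by auto
  have k2: "k \<ge> 2"
  proof (rule ccontr)
    assume "\<not> k \<ge> 2"
    then have "k = 0 \<or> k = 1" by auto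
    then show False using nz by auto
  qed
  then have lk: "ln (real k) > 0" by simp
  have b: "0 < beta k" using beta_nonneg[of k] nz by (cases "beta k = 0") auto
  then have "1 / beta k \<ge> 1" using beta_le_1[of k] by (simp add: field_simps)
  then have "ln (1 / beta k) \<ge> 0" by (rule ln_ge_zero)
  then have "ln (1 / beta k) > 0" using nz(2) by linarith
  then have "a * ln (1 / beta k) < ln (real k)" using k by (subst (asm) pos_less_divide_eq)
  then have "- ln (real k) < ln (beta k) * a" using b by (simp add: ln_div mult.commute)
  then have "- ln (real k) / a < ln (beta k)" using a by (simp only: pos_divide_less_eq)
  \<comment> \<open>The left side is \<open>k powr (- 1 / a)\<close>, the value of
    \<open>beta k\<close> for which the quotient would equal a.\<close>
  then have "exp (- ln (real k) / a) < beta k" using b by (metis exp_less_cancel_iff exp_ln)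
  then have "exp (- ln (real k) / a) < Sup {c. c < 1 \<and> (equal_sums_prob k c \<longlongrightarrow> 1) at_top}"
    by (simp only: beta_def)
  moreover have "{c. c < 1 \<and> (equal_sums_prob k c \<longlongrightarrow> 1) at_top} \<noteq> {}"
    using beta_set_0[of k] by (metis empty_iff)
  ultimately obtain c where "c \<in> {c. c < 1 \<and> (equal_sums_prob k c \<longlongrightarrow> 1) at_top}"
    and c3: "exp (- ln (real k) / a) < c" by (rule less_cSupE)
  then have c: "c < 1" "(equal_sums_prob k c \<longlongrightarrow> 1) at_top" "exp (- ln (real k) / a) < c"
    by simp_all
  obtain c' where c': "exp (- ln (real k) / a) < c'" "c' < c" using dense[OF c(3)] by blast
  have c'0: "0 < c'" using c'(1) exp_gt_zero[of "- ln (real k) / a"] by linarith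
  have "- ln (real k) / a < ln c'" using c' c'0 by (metis exp_less_cancel_iff exp_ln)
  then have "- ln (real k) < ln c' * a" using a by (simp only: pos_divide_less_eq)
  then have "a * ln (1 / c') < ln (real k)" using c'0 by (simp add: ln_div mult.commute)
  then show ?thesis using Delta_large_density[of c' c k a] c c' c'0 k2 a by auto
qed

section \<open>From fixed exponents to o(1)\<close>

text \<open>At n take the largest index \<open>j \<le> n\<close> whose value is already at most
  \<open>1 / (j + 1)\<close>. The bound on \<open>f 0\<close> makes j = 0 always admissible, and
  each fixed index is admissible from some n on.\<close>

lemma diagonal_null:
  fixes f :: "nat \<Rightarrow> nat \<Rightarrow> real"
  assumes lim: "\<And>i. (\<lambda>n. f i n) \<longlonglongrightarrow> 0" and f: "\<And>i n. 0 \<le> f i n" "\<And>n. f 0 n \<le> 1"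
  obtains i where "filterlim i at_top sequentially" "(\<lambda>n. f (i n) n) \<longlonglongrightarrow> 0"
proof -
  define A where "A n = {j. j \<le> n \<and> f j n \<le> 1 / (real j + 1)}" for n
  define i where "i n = Max (A n)" for n
  have fin: "finite (A n)" for n unfolding A_def by (rule finite_subset[of _ "{..n}"]) auto
  have "0 \<in> A n" for n using f(2) by (simp add: A_def)
  then have "A n \<noteq> {}" for n by blast
  then have mem: "i n \<in> A n" for n unfolding i_def using fin by (intro Max_in) auto
  have lim_i: "filterlim i at_top sequentially"
    unfolding filterlim_at_top
  proof
    fix Z
    have "eventually (\<lambda>n. f Z n < 1 / (real Z + 1)) sequentially"
      using lim by (rule order_tendstoD) auto
    then show "eventually (\<lambda>n. Z \<le> i n) sequentially"
      using eventually_ge_at_top[of Z]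
    proof eventually_elim
      case (elim n)
      then have "Z \<in> A n" by (simp add: A_def)
      then show ?case unfolding i_def using fin by (intro Max_ge)
    qed
  qed
  have "(\<lambda>n. 1 / (real (i n) + 1)) \<longlonglongrightarrow> 0"
  proof -
    have "(\<lambda>j. 1 / (real j + 1)) \<longlonglongrightarrow> 0" by real_asymp
    then show ?thesis by (rule filterlim_compose[OF _ lim_i])
  qed
  then have "(\<lambda>n. f (i n) n) \<longlonglongrightarrow> 0"
    by (rule tendsto_sandwich[OF _ _ tendsto_const, rotated 2])
      (use mem f in \<open>auto simp: A_def\<close>)
  with lim_i show ?thesis by (rule that)
qed

theorem theorem4:
  shows "\<exists>z::real. zeta = ereal z \<and>
    (\<exists>\<epsilon> :: nat \<Rightarrow> real. \<epsilon> \<longlonglongrightarrow> 0 \<and>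
      (\<lambda>n. real (card {\<sigma>. \<sigma> permutes {1..n} \<and>
          \<not> real (perm_Delta n \<sigma>) \<ge> ln (real n) powr (z - \<epsilon> n)}))
        \<in> o(\<lambda>n. fact n))"
proof -
  obtain z where z: "zeta = ereal z" using zeta_real by blast
  \<comment> \<open>For fixed i the exponent lies strictly below \<open>zeta\<close>, so
    \<open>Delta_density\<close> applies; the diagonal choice of i lets the loss tend to 0.\<close>
  define f where "f i n = real (card {\<sigma>. \<sigma> permutes {1..n} \<and>
      \<not> real (perm_Delta n \<sigma>) \<ge> ln (real n) powr (z - 1 / (real i + 1))}) / fact n" for i n :: nat
  have lim: "(\<lambda>n. f i n) \<longlonglongrightarrow> 0" for i
    unfolding f_def by (intro Delta_density) (simp add: z)
  have le1: "f i n \<le> 1" for i n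
  proof -
    have "card {\<sigma>. \<sigma> permutes {1..n} \<and> \<not> real (perm_Delta n \<sigma>) \<ge> ln (real n) powr (z - 1 / (real i + 1))}
      \<le> card {\<sigma>. \<sigma> permutes {1..n}}"
      by (intro card_mono) (auto simp: finite_permutations)
    also have "\<dots> = fact n" by (simp add: card_permutations)
    finally have "real (card {\<sigma>. \<sigma> permutes {1..n} \<and>
        \<not> real (perm_Delta n \<sigma>) \<ge> ln (real n) powr (z - 1 / (real i + 1))}) \<le> fact n"
      by (metis of_nat_fact of_nat_le_iff)
    then show ?thesis by (simp add: f_def)
  qed
  have nonneg: "0 \<le> f i n" for i n by (simp add: f_def)
  obtain i where i: "filterlim i at_top sequentially" "(\<lambda>n. f (i n) n) \<longlonglongrightarrow> 0"
    by (rule diagonal_null[of f, OF lim nonneg le1])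
  have "(\<lambda>n. 1 / (real (i n) + 1)) \<longlonglongrightarrow> 0"
  proof -
    have "(\<lambda>j. 1 / (real j + 1)) \<longlonglongrightarrow> 0" by real_asymp
    then show ?thesis by (rule filterlim_compose[OF _ i(1)])
  qed
  moreover have "(\<lambda>n. real (card {\<sigma>. \<sigma> permutes {1..n} \<and>
      \<not> real (perm_Delta n \<sigma>) \<ge> ln (real n) powr (z - 1 / (real (i n) + 1))})) \<in> o(\<lambda>n. fact n)"
    using i(2) unfolding f_def by (intro smalloI_tendsto) auto
  ultimately have "\<exists>\<epsilon> :: nat \<Rightarrow> real. \<epsilon> \<longlonglongrightarrow> 0 \<and>
      (\<lambda>n. real (card {\<sigma>. \<sigma> permutes {1..n} \<and>
          \<not> real (perm_Delta n \<sigma>) \<ge> ln (real n) powr (z - \<epsilon> n)})) \<in> o(\<lambda>n. fact n)"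
    by (intro exI[of _ "\<lambda>n. 1 / (real (i n) + 1)"] conjI)
  with z show ?thesis by blast
qed

end
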